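(* Let $n\ge1$, $a\in\mathbb{R}^n$ with $a_i>0$ for all $i$, $s>0$, $k\in\{1,\dots,n\}$, and let $U(x):=(1-a_k^{1/2}x_k)^2\,u_s(x)$ for $x\in\mathbb{R}^n$. Then, for any $x\in E_a$, $$\begin{aligned}\frac{(-\Delta)^sU(x)}{k_{n,s}\,\Gamma(1+s)}=\;&\big[J_0+5sJ_1^{(k)}+2s(s-1)J_2^{(k)}\big]a_kx_k^2-2\big[J_0+2sJ_1^{(k)}\big]a_k^{1/2}x_k+J_0-sJ_1^{(k)}\\&+s\sum_{\substack{i=1\\ i\ne k}}^n\Big[J_1^{(k)}+2(s-1)a_ia_k\int_{\partial E_a}\theta_i^2\theta_k^2\,\mu(d\theta)\Big]a_ix_i^2 .\end{aligned}$$
   Context: Let $A=\mathrm{diag}(a_1,\dots,a_n)$, $|x|_a:=\sqrt{Ax\cdot x}$, $E_a:=\{x\in\mathbb{R}^n:|x|_a<1\}$, $u_s(x):=(1-|x|_a^2)_+^s$. $\mu(d\theta)=\dfrac{d\theta}{|\theta|^{n+2s}|A\theta|}$, where $d\theta$ is the surface measure of $\partial E_a$ (counting measure if $n=1$); $J_0:=\int_{\partial E_a}\mu(d\theta)$ and $J_i^{(k)}:=a_k^i\int_{\partial E_a}\theta_k^{2i}\,\mu(d\theta)$. $k_{n,s}:=\dfrac{2^{2s-1}\Gamma(n/2+s)}{\pi^{n/2}}$. $\mathbb{N}=\{1,2,\dots\}$. Pointwise fractional Laplacian: for $s>0$, $$(-\Delta)^s u(x)=\frac{c_{n,m,s}}{2}\int_{\mathbb{R}^n}\frac{\delta_m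 u(x,y)}{|y|^{n+2s}}\,dy,\qquad \delta_m u(x,y):=\sum_{k=-m}^m(-1)^k\binom{2m}{m-k}u(x+ky),$$ where $m\in\mathbb{N}$ is any integer with $m>s$ (the value does not depend on this choice), and $c_{n,m,s}$ is the positive constant $$c_{n,m,s}=\begin{cases}\dfrac{4^{s}\Gamma(\frac n2+s)}{\pi^{n/2}\Gamma(-s)}\Big(\sum_{k=1}^{m}(-1)^{k}\binom{2m}{m-k}k^{2s}\Big)^{-1}, & s\in(0,m)\setminus\mathbb{N},\\[2mm] \dfrac{4^{s}\Gamma(\frac n2+s)\,s!}{2\pi^{n/2}}\Big(\sum_{k=2}^m(-1)^{k-s+1}\binom{2m}{m-k}k^{2s}\ln k\Big)^{-1}, & s\in\{1,\dots,m-1\}.\end{cases}$$ *)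

theory Defs
  imports "HOL-Analysis.Analysis"
begin

definition diag_matrix :: "real ^ 'n \<Rightarrow> real ^ 'n ^ 'n" where
  "diag_matrix a = (\<chi> i j. if i = j then a $ i else 0)"

definition norm_a :: "real ^ 'n \<Rightarrow> real ^ 'n \<Rightarrow> real" where
  "norm_a a x = sqrt ((diag_matrix a *v x) \<bullet> x)"

definition ellipsoid :: "real ^ 'n \<Rightarrow> (real ^ 'n) set" where
  "ellipsoid a = {x. norm_a a x < 1}"

definition u_s :: "real ^ 'n \<Rightarrow> real \<Rightarrow> real ^ 'n \<Rightarrow> real" where
  "u_s a s x = (max 0 (1 - (norm_a a x)\<^sup>2)) powr s"

text \<open>
  The boundary of the ellipsoid is, up to the null set where the \<open>j\<close>-th coordinate
  vanishes, the union of the graphs of \<open>h\<close> and \<open>- h\<close> over the projected ellipsoid in the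
  coordinates other than \<open>j\<close>, with \<open>h\<close> = \<open>ellipsoid_height j a\<close>.  A graph of \<open>g\<close> carries the
  classical area element \<open>sqrt (1 + \<bar>grad g\<bar>\<^sup>2) dy\<close>, where \<open>dy\<close> is Lebesgue measure in the
  remaining \<open>n - 1\<close> coordinates, modelled by the product measure over \<open>UNIV - {j}\<close>.  For
  \<open>n = 1\<close> that product is the unit point mass and the area element is \<open>1\<close>, so the result is
  the counting measure on the two boundary points.
\<close>

definition graph_point :: "'n \<Rightarrow> (('n \<Rightarrow> real) \<Rightarrow> real) \<Rightarrow> ('n \<Rightarrow> real) \<Rightarrow> real ^ 'n" where
  "graph_point j g y = (\<chi> i. if i = j then g y else y i)"

definition graph_area_element ::
    "'n::finite \<Rightarrow> (('n \<Rightarrow> real) \<Rightarrow> real) \<Rightarrow> ('n \<Rightarrow> real) \<Rightarrow> real" where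
  "graph_area_element j g y =
     sqrt (1 + (\<Sum>i\<in>UNIV - {j}. (deriv (\<lambda>t. g (y(i := t))) (y i))\<^sup>2))"

definition ellipsoid_shadow :: "'n::finite \<Rightarrow> real ^ 'n \<Rightarrow> ('n \<Rightarrow> real) set" where
  "ellipsoid_shadow j a = {y. (\<Sum>i\<in>UNIV - {j}. a $ i * (y i)\<^sup>2) < 1}"

definition ellipsoid_height :: "'n::finite \<Rightarrow> real ^ 'n \<Rightarrow> ('n \<Rightarrow> real) \<Rightarrow> real" where
  "ellipsoid_height j a y = sqrt ((1 - (\<Sum>i\<in>UNIV - {j}. a $ i * (y i)\<^sup>2)) / a $ j)"

text \<open>The factor \<open>count_space {1, -1}\<close> selects the upper or the lower sheet.\<close>

definition ellipsoid_surface_along :: "'n::finite \<Rightarrow> real ^ 'n \<Rightarrow> (real ^ 'n) measure" where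
  "ellipsoid_surface_along j a =
     distr
       (density (count_space {1, -1} \<Otimes>\<^sub>M PiM (UNIV - {j}) (\<lambda>_. lborel))
         (\<lambda>(\<epsilon>, y). ennreal (indicator (ellipsoid_shadow j a) y
                     * graph_area_element j (\<lambda>z. \<epsilon> * ellipsoid_height j a z) y)))
       borel
       (\<lambda>(\<epsilon>, y). graph_point j (\<lambda>z. \<epsilon> * ellipsoid_height j a z) y)"

text \<open>The measure does not depend on the coordinate along which the boundary is projected.\<close>

definition ellipsoid_surface :: "real ^ 'n::finite \<Rightarrow> (real ^ 'n) measure" where
  "ellipsoid_surface a = ellipsoid_surface_along (SOME j. True) a"

definition mu :: "real ^ 'n::finite \<Rightarrow> real \<Rightarrow> (real ^ 'n) measure" where
  "mu a s = density (ellipsoid_surface a)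
     (\<lambda>\<theta>. ennreal (1 / (norm \<theta> powr (real CARD('n) + 2 * s) * norm (diag_matrix a *v \<theta>))))"

definition J0 :: "real ^ 'n::finite \<Rightarrow> real \<Rightarrow> real" where
  "J0 a s = (LINT \<theta>:frontier (ellipsoid a)|mu a s. 1)"

definition J :: "real ^ 'n::finite \<Rightarrow> real \<Rightarrow> 'n \<Rightarrow> nat \<Rightarrow> real" where
  "J a s k i = (a $ k) ^ i * (LINT \<theta>:frontier (ellipsoid a)|mu a s. (\<theta> $ k) ^ (2 * i))"

definition k_const :: "nat \<Rightarrow> real \<Rightarrow> real" where
  "k_const n s = 2 powr (2 * s - 1) * Gamma (real n / 2 + s) / pi powr (real n / 2)"

text \<open>For natural \<open>s\<close> the exponent \<open>k - s + 1\<close> of \<open>- 1\<close> may be negative, hence \<open>powi\<close>.\<close>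

definition c_const :: "nat \<Rightarrow> nat \<Rightarrow> real \<Rightarrow> real" where
  "c_const n m s =
     (if s \<in> \<nat>
      then 4 powr s * Gamma (real n / 2 + s) * fact (nat \<lfloor>s\<rfloor>) / (2 * pi powr (real n / 2))
           * inverse (\<Sum>k = 2..m. (- 1) powi (int k - \<lfloor>s\<rfloor> + 1) * real ((2 * m) choose (m - k))
                                  * real k powr (2 * s) * ln (real k))
      else 4 powr s * Gamma (real n / 2 + s) / (pi powr (real n / 2) * Gamma (- s))
           * inverse (\<Sum>k = 1..m. (- 1) ^ k * real ((2 * m) choose (m - k))
                                  * real k powr (2 * s)))"

definition finite_diff ::
    "nat \<Rightarrow> (real ^ 'n \<Rightarrow> real) \<Rightarrow> real ^ 'n \<Rightarrow> real ^ 'n \<Rightarrow> real" where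
  "finite_diff m u x y =
     (\<Sum>k = - int m..int m.
        (- 1) powi k * real ((2 * m) choose nat (int m - k)) * u (x + of_int k *\<^sub>R y))"

definition frac_laplacian ::
    "nat \<Rightarrow> real \<Rightarrow> (real ^ 'n::finite \<Rightarrow> real) \<Rightarrow> real ^ 'n \<Rightarrow> real" where
  "frac_laplacian m s u x =
     c_const CARD('n) m s / 2
       * (LINT y|lborel. finite_diff m u x y / norm y powr (real CARD('n) + 2 * s))"

end

theory Submission
  imports Defs "HOL-Complex_Analysis.Complex_Analysis"
begin

text \<open>
  In polar coordinates \<open>y = r \<theta>\<close> with \<open>norm_a a \<theta> = 1\<close>, the weight of \<open>mu\<close> absorbs the kernel
  \<open>norm y powr - (n + 2 * s)\<close> and leaves \<open>r powr (- 1 - 2 * s)\<close> on every ray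
  (\<open>integral_kernel_polar\<close>).  On the line through \<open>x\<close> in direction \<open>\<theta>\<close> the function \<open>U\<close> is a
  quadratic polynomial times the \<open>s\<close>-th power of the positive part of
  \<open>Q(u) = c - 2 * b * u - u\<^sup>2\<close>, where \<open>c = 1 - (norm_a a x)\<^sup>2\<close> and \<open>b\<close> is the inner product of
  \<open>A x\<close> and \<open>\<theta>\<close>.  The fractional Laplacian of \<open>U\<close> is therefore the \<open>mu\<close>-average of
  one-dimensional ones, for the functions \<open>u ^ p * Q\<^sub>+ powr s\<close> with \<open>p \<le> 2\<close>.

  These have a closed form, polynomial in \<open>b\<close> and \<open>c\<close> (\<open>normalized_fractional_integral\<close>).
  For \<open>s < 1 / 2\<close>, and for \<open>p = 0\<close> after an integration by parts, the central difference may be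
  split into its shifts; the shift by \<open>k\<close> is a dilation of the shift by \<open>1\<close>, so the integral is
  \<open>S(s)\<close>, the sum of the weights times \<open>k powr (2 * s)\<close>, times an integral without differences.  There
  the substitution \<open>v = Q(u) / u\<^sup>2\<close> turns \<open>Q\<^sub>+ powr s\<close> and the kernel into powers of \<open>v\<close>; its
  inverse involves a square root, which cancels between the two sides of the base point, and
  Beta integrals remain.  The result has the form \<open>sin (pi * s) * I(s) = pi * S(s) * P(s)\<close> with a
  polynomial \<open>P\<close>.  Both sides are holomorphic for \<open>0 < Re s < m\<close>, because central differences of
  order \<open>2 * m\<close> vanish to that order at the base point, so the identity theorem removes the
  restriction \<open>s < 1 / 2\<close>.  At integers both sides vanish, and differentiating there brings in the
  logarithms in the normalizing constant.

  That constant cancels \<open>S(s)\<close>, or \<open>S'(s)\<close> at integers, provided these do not vanish.  They do not: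
  \<open>S\<close> is a sum of \<open>m\<close> exponentials, so by Rolle's theorem it has at most \<open>m - 1\<close> real zeros,
  counted with multiplicity, and \<open>1, \<dots>, m - 1\<close> are zeros because finite differences annihilate polynomials of low degree.

  It remains to integrate a polynomial in \<open>\<theta> $ k\<close> and \<open>b\<close> against \<open>mu\<close>.  The reflections
  in coordinate hyperplanes preserve \<open>mu\<close>, so only even moments survive; they are the
  coefficients in the theorem.
\<close>

section \<open>Finite differences and their symbol\<close>

text \<open>Pascal's rule turns the difference of order \<open>n + 1\<close> into the difference of order \<open>n\<close> of
  \<open>g i - g (Suc i)\<close>, which lowers the degree of a polynomial.\<close>

lemma alternating_binomial_sum_power:
  fixes x :: "'a::comm_ring_1"
  assumes "j < n"
  shows "(\<Sum>i\<le>n. (-1) ^ i * of_nat (n choose i) * (x + of_nat i) ^ j) = 0"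
  using assms
proof (induction n arbitrary: j)
  case 0
  then show ?case by simp
next
  case (Suc n)
  define g where "g i = (x + of_nat i) ^ j" for i
  have pascal: "(\<Sum>i\<le>Suc n. (-1) ^ i * of_nat (Suc n choose i) * g i)
      = (\<Sum>i\<le>n. (-1) ^ i * of_nat (n choose i) * (g i - g (Suc i)))"
  proof -
    have "(\<Sum>i\<le>Suc n. (-1) ^ i * of_nat (Suc n choose i) * g i)
      = g 0 + (\<Sum>i\<le>n. (-1) ^ Suc i * of_nat (Suc n choose Suc i) * g (Suc i))"
      by (subst sum.atMost_Suc_shift) simp
    also have "\<dots> = (g 0 + (\<Sum>i\<le>n. (-1) ^ Suc i * of_nat (n choose Suc i) * g (Suc i)))
        - (\<Sum>i\<le>n. (-1) ^ i * of_nat (n choose i) * g (Suc i))"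
      by (simp add: algebra_simps sum.distrib sum_negf sum_subtractf)
    also have "g 0 + (\<Sum>i\<le>n. (-1) ^ Suc i * of_nat (n choose Suc i) * g (Suc i))
        = (\<Sum>i\<le>Suc n. (-1) ^ i * of_nat (n choose i) * g i)"
      by (subst sum.atMost_Suc_shift) simp
    also have "\<dots> = (\<Sum>i\<le>n. (-1) ^ i * of_nat (n choose i) * g i)"
      by (simp add: binomial_eq_0)
    finally show ?thesis
      by (simp add: algebra_simps sum_subtractf)
  qed
  have step: "g (Suc i) - g i = (\<Sum>l<j. of_nat (j choose l) * (x + of_nat i) ^ l)" for i
  proof -
    have "g (Suc i) = ((x + of_nat i) + 1) ^ j"
      by (simp add: g_def algebra_simps)
    also have "\<dots> = (\<Sum>l\<le>j. of_nat (j choose l) * (x + of_nat i) ^ l)"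
      by (subst binomial_ring) simp
    also have "\<dots> = (\<Sum>l<j. of_nat (j choose l) * (x + of_nat i) ^ l) + g i"
      by (simp add: lessThan_Suc_atMost [symmetric] g_def)
    finally show ?thesis by simp
  qed
  have "(\<Sum>i\<le>n. (-1) ^ i * of_nat (n choose i) * (g (Suc i) - g i))
     = (\<Sum>l<j. of_nat (j choose l) * (\<Sum>i\<le>n. (-1) ^ i * of_nat (n choose i) * (x + of_nat i) ^ l))"
    unfolding step sum_distrib_left
    by (subst sum.swap) (simp add: mult_ac)
  also have "\<dots> = 0"
    using Suc by (intro sum.neutral) auto
  finally have "(\<Sum>i\<le>n. (-1) ^ i * of_nat (n choose i) * (g i - g (Suc i))) = 0"
    by (simp add: algebra_simps sum_subtractf)
  with pascal show ?case by (simp add: g_def)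
qed

definition diff_weight :: "nat \<Rightarrow> int \<Rightarrow> real" where
  "diff_weight m k = (- 1) powi k * real ((2 * m) choose nat (int m - k))"

text \<open>Against a kernel that is homogeneous of degree \<open>- 1 - 2 * s\<close> the shift by \<open>k\<close> contributes
  the factor \<open>k powr (2 * s)\<close>; these factors are collected here.\<close>

definition symbol_sum :: "nat \<Rightarrow> real \<Rightarrow> real" where
  "symbol_sum m s = (\<Sum>k = 1..m. diff_weight m (int k) * real k powr (2 * s))"

lemma diff_weight_minus: "\<bar>k\<bar> \<le> int m \<Longrightarrow> diff_weight m (- k) = diff_weight m k"
proof -
  assume k: "\<bar>k\<bar> \<le> int m"
  have "(2 * m) choose nat (int m - k) = (2 * m) choose (2 * m - nat (int m - k))"
    using k by (intro binomial_symmetric) auto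
  also have "2 * m - nat (int m - k) = nat (int m - - k)"
    using k by auto
  finally show ?thesis
    by (simp add: diff_weight_def power_int_minus flip: power_int_inverse)
qed

lemma diff_weight_moment_zero:
  assumes "j < 2 * m"
  shows "(\<Sum>k = - int m..int m. diff_weight m k * of_int k ^ j) = 0"
proof -
  have "(\<Sum>k = - int m..int m. diff_weight m k * of_int k ^ j)
      = (\<Sum>i\<le>2 * m. diff_weight m (int i - int m) * (of_int (int i - int m)) ^ j)"
    by (rule sum.reindex_bij_witness[of _ "\<lambda>i. int i - int m" "\<lambda>k. nat (k + int m)"]) auto
  also have "\<dots> = (\<Sum>i\<le>2 * m. (-1) ^ m * ((-1) ^ i * real ((2 * m) choose i)
                     * (- real m + real i) ^ j))"
  proof (rule sum.cong [OF refl])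
    fix i assume "i \<in> {..2 * m}"
    then have i: "i \<le> 2 * m" by simp
    have "diff_weight m (int i - int m) = diff_weight m (int m - int i)"
      using diff_weight_minus[of "int i - int m" m] i by simp
    also have "\<dots> = (- 1) powi (int m - int i) * real ((2 * m) choose i)"
      by (simp add: diff_weight_def)
    also have "(- 1 :: real) powi (int m - int i) = (- 1) ^ m * (- 1) ^ i"
      by (subst power_int_diff) (auto simp: uminus_power_if)
    finally show "diff_weight m (int i - int m) * of_int (int i - int m) ^ j
      = (-1) ^ m * ((-1) ^ i * real ((2 * m) choose i) * (- real m + real i) ^ j)"
      by simp
  qed
  also have "\<dots> = 0"
    using alternating_binomial_sum_power[OF assms, of "- real m"]
    by (simp flip: sum_distrib_left)
  finally show ?thesis .
qed

lemma sum_symmetric_int_interval: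
  fixes f :: "int \<Rightarrow> 'a::comm_monoid_add"
  shows "(\<Sum>k = - int m..int m. f k) = f 0 + (\<Sum>k = 1..m. f (int k) + f (- int k))"
proof (induction m)
  case 0
  show ?case by simp
next
  case (Suc m)
  have "{- int (Suc m)..int (Suc m)} = insert (int (Suc m)) (insert (- int (Suc m)) {- int m..int m})"
    by auto
  then have "(\<Sum>k = - int (Suc m)..int (Suc m). f k)
      = f (int (Suc m)) + (f (- int (Suc m)) + (\<Sum>k = - int m..int m. f k))"
    by simp
  with Suc.IH show ?case
    by (simp add: add_ac)
qed

lemma diff_weight_symmetric_sum:
  fixes f :: "int \<Rightarrow> 'a::real_vector"
  shows "(\<Sum>k = - int m..int m. diff_weight m k *\<^sub>R f k)
    = diff_weight m 0 *\<^sub>R f 0 + (\<Sum>k = 1..m. diff_weight m (int k) *\<^sub>R (f (int k) + f (- int k)))"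
  unfolding sum_symmetric_int_interval
  by (intro arg_cong2[where f = "(+)"] sum.cong refl)
     (simp add: diff_weight_minus scaleR_add_right)

text \<open>At an integer below \<open>m\<close> the sum is half of an even moment of order less than \<open>2 * m\<close>.\<close>

lemma symbol_sum_nat_zero:
  assumes "0 < N" "N < m"
  shows "symbol_sum m (real N) = 0"
proof -
  have "0 = (\<Sum>k = - int m..int m. diff_weight m k *\<^sub>R (of_int k ^ (2 * N) :: real))"
    using diff_weight_moment_zero[of "2 * N" m] assms by (simp add: real_scaleR_def)
  also have "\<dots> = 2 * symbol_sum m (real N)"
    using assms unfolding diff_weight_symmetric_sum symbol_sum_def sum_distrib_left
    by (simp add: zero_power)
       (intro sum.cong refl, simp flip: powr_realpow)
  finally show ?thesis by simp
qed

text \<open>\<open>Z'\<close> avoids \<open>Z\<close>, so a point of \<open>Z\<close> that happens to be a double zero of \<open>f\<close> can be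
  added to \<open>Z'\<close>.\<close>

lemma Rolle_finite_zero_set:
  fixes f f' :: "real \<Rightarrow> real"
  assumes deriv: "\<And>x. (f has_real_derivative f' x) (at x)"
    and "finite Z" "\<And>z. z \<in> Z \<Longrightarrow> f z = 0"
  shows "\<exists>Z'. finite Z' \<and> card Z' = card Z - 1 \<and> Z' \<inter> Z = {}
      \<and> (\<forall>z\<in>Z'. f' z = 0 \<and> z < Max Z)"
  using assms(2,3)
proof (induction Z rule: finite_linorder_max_induct)
  case empty
  then show ?case by (intro exI[of _ "{}"]) auto
next
  case (insert b A)
  show ?case
  proof (cases "A = {}")
    case True
    then show ?thesis by (intro exI[of _ "{}"]) auto
  next
    case False
    obtain Z' where Z': "finite Z'" "card Z' = card A - 1" "Z' \<inter> A = {}"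
        "\<forall>z\<in>Z'. f' z = 0 \<and> z < Max A"
      using insert.IH insert.prems by auto
    have Max_A: "Max A \<in> A" "Max A < b"
      using False insert.hyps by auto
    have "\<exists>z>Max A. z < b \<and> (f has_real_derivative 0) (at z)"
      by (rule Rolle)
         (use Max_A insert.prems deriv in \<open>auto intro!: continuous_at_imp_continuous_on
            intro: DERIV_isCont simp: real_differentiable_def\<close>)
    then obtain z where z: "Max A < z" "z < b" "(f has_real_derivative 0) (at z)"
      by blast
    have "f' z = 0"
      using DERIV_unique[OF deriv z(3)] .
    have "z \<notin> A"
      using z(1) insert.hyps(1) by (auto simp: not_le dest: Max_ge)
    have "z \<notin> Z'"
      using Z'(4) z(1) by auto
    have "\<forall>z'\<in>Z'. z' < b"
      using Z'(4) Max_A(2) by force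
    moreover have "Max (Set.insert b A) = b"
      using insert.hyps False Max_A by simp
    ultimately show ?thesis
      using Z' z \<open>f' z = 0\<close> \<open>z \<notin> A\<close> \<open>z \<notin> Z'\<close> Max_A insert.hyps
      by (intro exI[of _ "Set.insert z Z'"])
         (auto simp: card_gt_0_iff Suc_diff_1 False)
  qed
qed

text \<open>Dividing by one of the exponentials and differentiating removes a summand and, by Rolle's
  theorem, at most one zero.\<close>

lemma exponential_sum_zeros:
  fixes c e :: "'i \<Rightarrow> real"
  assumes "finite K" "inj_on e K" "finite Z" "card K \<le> card Z"
    and "\<And>z. z \<in> Z \<Longrightarrow> (\<Sum>k\<in>K. c k * exp (e k * z)) = 0"
    and "k \<in> K"
  shows "c k = 0"
  using assms
proof (induction K arbitrary: c e Z k rule: finite_induct)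
  case empty
  then show ?case by simp
next
  case (insert p K)
  define g where "g z = c p + (\<Sum>k\<in>K. c k * exp ((e k - e p) * z))" for z
  define g' where "g' z = (\<Sum>k\<in>K. (c k * (e k - e p)) * exp ((e k - e p) * z))" for z
  have g_eq: "g z = exp (- e p * z) * (\<Sum>k\<in>Set.insert p K. c k * exp (e k * z))" for z
    using insert.hyps
    by (simp add: g_def distrib_left sum_distrib_left mult.left_commute algebra_simps flip: exp_add)
  have g_zero: "g z = 0" if "z \<in> Z" for z
    using insert.prems(4)[OF that] by (simp add: g_eq)
  have "(g has_real_derivative g' z) (at z)" for z
    unfolding g_def [abs_def] g'_def
    by (auto intro!: derivative_eq_intros sum.cong)
  then obtain Z' where Z': "finite Z'" "card Z' = card Z - 1" "\<forall>z\<in>Z'. g' z = 0"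
    using Rolle_finite_zero_set[of g g' Z] insert.prems(2) g_zero by auto
  have others: "c k = 0" if "k \<in> K" for k
  proof -
    have "c k * (e k - e p) = 0"
    proof (rule insert.IH[of "\<lambda>k. e k - e p" Z' "\<lambda>k. c k * (e k - e p)"])
      show "inj_on (\<lambda>k. e k - e p) K"
        using insert.prems(1) by (auto simp: inj_on_def)
      show "card K \<le> card Z'"
        using insert.prems(3) insert.hyps Z'(2) by simp
    qed (use Z' that in \<open>auto simp: g'_def\<close>)
    moreover have "e k \<noteq> e p"
      using insert.prems(1) insert.hyps that by (auto simp: inj_on_def)
    ultimately show ?thesis by simp
  qed
  have "Z \<noteq> {}"
    using insert.prems(3) insert.hyps by auto
  then obtain z where "z \<in> Z" by auto
  with g_zero others have "c p = 0"
    by (auto simp: g_def)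
  with others insert.prems(5) show ?case by auto
qed

definition symbol_sum_deriv :: "nat \<Rightarrow> real \<Rightarrow> real" where
  "symbol_sum_deriv m s = (\<Sum>k = 1..m. diff_weight m (int k) * real k powr (2 * s) * (2 * ln (real k)))"

lemma symbol_sum_has_derivative:
  "(symbol_sum m has_real_derivative symbol_sum_deriv m s) (at s)"
  unfolding symbol_sum_def [abs_def] symbol_sum_deriv_def
  by (auto intro!: derivative_eq_intros sum.cong)

lemma diff_weight_nonzero: "k \<le> m \<Longrightarrow> diff_weight m (int k) \<noteq> 0"
  by (auto simp: diff_weight_def)

lemma inj_on_double_ln: "inj_on (\<lambda>k. 2 * ln (real k)) {1..m}"
  by (auto simp: inj_on_def)

text \<open>A sum of \<open>m\<close> exponentials has at most \<open>m - 1\<close> zeros, and \<open>1, \<dots>, m - 1\<close> are that many.\<close>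

lemma symbol_sum_nonzero:
  assumes "0 < s" "s < real m" "s \<notin> \<nat>"
  shows "symbol_sum m s \<noteq> 0"
proof
  assume zero: "symbol_sum m s = 0"
  define Z where "Z = Set.insert s (real ` {1..<m})"
  have m: "m \<ge> 1" using assms by auto
  have "s \<notin> real ` {1..<m}" using assms(3) by (auto simp: Nats_def)
  then have card: "card {1..m} \<le> card Z"
    using m by (simp add: Z_def card_image)
  have "(\<Sum>k = 1..m. diff_weight m (int k) * exp (2 * ln (real k) * z)) = symbol_sum m z" for z
    unfolding symbol_sum_def by (intro sum.cong) (auto simp: powr_def mult_ac)
  moreover have "symbol_sum m z = 0" if "z \<in> Z" for z
    using that zero symbol_sum_nat_zero[of _ m] by (auto simp: Z_def)
  ultimately have "diff_weight m (int 1) = 0"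
    using m card
    by (intro exponential_sum_zeros[of "{1..m}" "\<lambda>k. 2 * ln (real k)" Z "\<lambda>k. diff_weight m (int k)"])
       (use inj_on_double_ln[of m] in \<open>auto simp: Z_def\<close>)
  then show False
    using diff_weight_nonzero[of 1 m] m by simp
qed

text \<open>The summand \<open>k = 1\<close> is constant, so the derivative is a sum of \<open>m - 1\<close> exponentials.  It has
  \<open>m - 2\<close> zeros strictly between the zeros \<open>1, \<dots>, m - 1\<close> of \<open>symbol_sum m\<close>; a zero at one of those
  would be one too many.\<close>

lemma symbol_sum_deriv_nonzero:
  assumes "0 < N" "N < m"
  shows "symbol_sum_deriv m (real N) \<noteq> 0"
proof
  assume zero: "symbol_sum_deriv m (real N) = 0"
  define Z where "Z = real ` {1..<m}"
  have "finite Z" by (simp add: Z_def)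
  then obtain Z' where Z': "finite Z'" "card Z' = card Z - 1" "Z' \<inter> Z = {}"
      "\<forall>z\<in>Z'. symbol_sum_deriv m z = 0"
    using Rolle_finite_zero_set[OF symbol_sum_has_derivative, of Z m]
      symbol_sum_nat_zero[of _ m]
    by (force simp: Z_def)
  have card_Z: "card Z = m - 1" by (simp add: Z_def card_image)
  have "real N \<notin> Z'"
    using Z'(3) assms by (auto simp: Z_def)
  then have card: "card {2..m} \<le> card (Set.insert (real N) Z')"
    using Z'(1,2) card_Z assms by simp
  have "(\<Sum>k = 2..m. (diff_weight m (int k) * (2 * ln (real k))) * exp (2 * ln (real k) * z))
      = symbol_sum_deriv m z" for z
  proof -
    have "symbol_sum_deriv m z
      = (\<Sum>k\<in>{2..m}. diff_weight m (int k) * real k powr (2 * z) * (2 * ln (real k)))"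
      unfolding symbol_sum_deriv_def by (intro sum.mono_neutral_right) (auto simp: not_le less_Suc_eq)
    then show ?thesis
      by (auto simp: powr_def mult_ac intro!: sum.cong)
  qed
  then have "diff_weight m (int 2) * (2 * ln (real 2)) = 0"
    using assms card zero Z'
    by (intro exponential_sum_zeros[of "{2..m}" "\<lambda>k. 2 * ln (real k)" "Set.insert (real N) Z'"
          "\<lambda>k. diff_weight m (int k) * (2 * ln (real k))"])
       (auto intro: inj_on_subset[OF inj_on_double_ln[of m]])
  then show False
    using diff_weight_nonzero[of 2 m] assms by simp
qed

section \<open>Central differences along a line\<close>

lemma sum_abs_diff_weight: "(\<Sum>k = - int m..int m. \<bar>diff_weight m k\<bar>) = 4 ^ m"
proof -
  have "(\<Sum>k = - int m..int m. \<bar>diff_weight m k\<bar>) = (\<Sum>i\<le>2 * m. real ((2 * m) choose i))"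
    by (rule sum.reindex_bij_witness[of _ "\<lambda>i. int m - int i" "\<lambda>k. nat (int m - k)"])
       (auto simp: diff_weight_def abs_mult power_int_abs)
  also have "\<dots> = real (\<Sum>i\<le>2 * m. (2 * m) choose i)"
    by simp
  also have "\<dots> = 4 ^ m"
    unfolding choose_row_sum by (simp add: power_mult)
  finally show ?thesis .
qed

definition central_diff :: "nat \<Rightarrow> (real \<Rightarrow> 'a::real_vector) \<Rightarrow> real \<Rightarrow> 'a" where
  "central_diff m f r = (\<Sum>k = - int m..int m. diff_weight m k *\<^sub>R f (of_int k * r))"

text \<open>The vanishing moments of the weights remove the first \<open>2 * m\<close> Taylor coefficients, and
  Cauchy's inequality bounds the others.  The constants are explicit because the bound is needed
  uniformly over families of functions.\<close>

lemma central_diff_bound_of_holomorphic: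
  fixes F :: "complex \<Rightarrow> complex" and f :: "real \<Rightarrow> complex"
  assumes R: "0 < R" "R < R'" and hol: "F holomorphic_on ball 0 R'"
    and bound: "\<And>z. cmod z < R' \<Longrightarrow> cmod (F z) \<le> B"
    and f: "\<And>u. \<bar>u\<bar> < R' \<Longrightarrow> f u = F (of_real u)"
    and r: "0 \<le> r" "real m * r \<le> R / 2"
  shows "norm (central_diff m f r) \<le> 2 * 4 ^ m * B * (real m * r / R) ^ (2 * m)"
proof -
  define A where "A j = (deriv ^^ j) F 0 / fact j" for j
  define x where "x = real m * r / R"
  define M where "M j = (\<Sum>k = - int m..int m. diff_weight m k * of_int k ^ j)" for j
  have x: "0 \<le> x" "x \<le> 1 / 2"
    using r R by (auto simp: x_def field_simps)
  have B: "0 \<le> B"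
    using bound[of 0] R by (smt (verit) norm_ge_zero norm_zero)
  have A: "cmod (A j) \<le> B / R ^ j" for j
  proof -
    have "cmod ((deriv ^^ j) F 0) \<le> fact j * B / R ^ j"
      by (rule Cauchy_inequality)
         (use hol R bound in \<open>auto intro!: holomorphic_on_imp_continuous_on
            intro: holomorphic_on_subset\<close>)
    then show ?thesis
      by (simp add: A_def norm_divide field_simps)
  qed
  have kr: "\<bar>of_int k * r\<bar> \<le> real m * r" if "k \<in> {- int m..int m}" for k
    using that r by (auto simp: abs_mult intro!: mult_right_mono)
  have "(\<lambda>j. \<Sum>k = - int m..int m. diff_weight m k *\<^sub>R (A j * (of_real (of_int k * r)) ^ j))
      sums central_diff m f r"
    unfolding central_diff_def
  proof (intro sums_sum sums_scaleR_right)
    fix k assume k: "k \<in> {- int m..int m}"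
    have lt: "\<bar>of_int k * r\<bar> < R'"
      using kr[OF k] r R by linarith
    have "(\<lambda>j. A j * (of_real (of_int k * r) - 0) ^ j) sums F (of_real (of_int k * r))"
      unfolding A_def by (rule holomorphic_power_series[OF hol]) (use lt in \<open>simp add: norm_mult abs_mult\<close>)
    then show "(\<lambda>j. A j * of_real (of_int k * r) ^ j) sums f (of_int k * r)"
      using f[OF lt] by simp
  qed
  also have "(\<lambda>j. \<Sum>k = - int m..int m. diff_weight m k *\<^sub>R (A j * (of_real (of_int k * r)) ^ j))
     = (\<lambda>j. A j * of_real (r ^ j * M j))"
    by (simp add: M_def scaleR_conv_of_real power_mult_distrib sum_distrib_left mult_ac)
  finally have "(\<lambda>j. A j * of_real (r ^ j * M j)) sums central_diff m f r" .
  moreover have "M j = 0" if "j < 2 * m" for j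
    using diff_weight_moment_zero[OF that] by (simp add: M_def)
  ultimately have sums: "(\<lambda>i. A (i + 2 * m) * of_real (r ^ (i + 2 * m) * M (i + 2 * m)))
      sums central_diff m f r"
    by (subst sums_iff_shift) simp
  have M: "\<bar>M j\<bar> \<le> 4 ^ m * real m ^ j" for j
  proof -
    have "\<bar>M j\<bar> \<le> (\<Sum>k = - int m..int m. \<bar>diff_weight m k\<bar> * real m ^ j)"
      unfolding M_def
      by (rule order.trans[OF sum_abs])
         (auto simp: abs_mult power_abs intro!: sum_mono mult_left_mono power_mono)
    also have "\<dots> = 4 ^ m * real m ^ j"
      by (simp add: sum_abs_diff_weight flip: sum_distrib_right)
    finally show ?thesis .
  qed
  have term_le: "cmod (A j * of_real (r ^ j * M j)) \<le> 4 ^ m * B * x ^ j" for j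
  proof -
    have "cmod (A j * of_real (r ^ j * M j)) = cmod (A j) * (r ^ j * \<bar>M j\<bar>)"
      using r by (simp add: norm_mult norm_power abs_mult)
    also have "\<dots> \<le> B / R ^ j * (r ^ j * (4 ^ m * real m ^ j))"
      using A[of j] M[of j] r B R by (intro mult_mono) auto
    also have "\<dots> = 4 ^ m * B * x ^ j"
      by (simp add: x_def power_divide power_mult_distrib)
    finally show ?thesis .
  qed
  have geo: "(\<lambda>i. 4 ^ m * B * x ^ (2 * m) * x ^ i) sums (4 ^ m * B * x ^ (2 * m) * (1 / (1 - x)))"
    using x by (intro sums_mult geometric_sums) auto
  have "norm (central_diff m f r) \<le> 4 ^ m * B * x ^ (2 * m) * (1 / (1 - x))"
    using term_le[of "_ + 2 * m"] by (intro norm_sums_le[OF sums geo]) (simp add: power_add mult_ac)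
  also have "\<dots> \<le> 4 ^ m * B * x ^ (2 * m) * 2"
    using x B by (intro mult_left_mono) (auto simp: field_simps)
  finally show ?thesis
    by (simp add: x_def mult_ac)
qed

text \<open>The value of \<open>1 - (norm_a a y)\<^sup>2\<close> at the point \<open>y = x + u \<theta>\<close> of a line, where
  \<open>c = 1 - (norm_a a x)\<^sup>2\<close> and \<open>b\<close> is the inner product of \<open>A x\<close> and \<open>\<theta>\<close>.\<close>

definition quad :: "real \<Rightarrow> real \<Rightarrow> real \<Rightarrow> real" where
  "quad c b u = c - 2 * b * u - u\<^sup>2"

text \<open>The exponent is complex since formulas proved for small \<open>s\<close> are continued analytically.\<close>

definition bump :: "nat \<Rightarrow> real \<Rightarrow> real \<Rightarrow> complex \<Rightarrow> real \<Rightarrow> complex" where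
  "bump p c b s u = of_real (u ^ p) * of_real (max 0 (quad c b u)) powr s"

definition fractional_integrand :: "nat \<Rightarrow> nat \<Rightarrow> real \<Rightarrow> real \<Rightarrow> complex \<Rightarrow> real \<Rightarrow> complex" where
  "fractional_integrand m p c b s r = central_diff m (bump p c b s) r * of_real r powr (- 1 - 2 * s)"

lemma bump_bound:
  assumes c: "0 < c" "c \<le> 1" and b: "\<bar>b\<bar> \<le> 1" and "p \<le> 2"
    and s: "0 < Re s" "Re s \<le> real m"
  shows "cmod (bump p c b s u) \<le> 9 * 2 ^ m"
proof (cases "quad c b u > 0")
  case True
  have u: "\<bar>u\<bar> \<le> 3"
  proof (rule ccontr)
    assume "\<not> \<bar>u\<bar> \<le> 3"
    then have "\<bar>u\<bar> * 3 \<le> \<bar>u\<bar> * \<bar>u\<bar>" by (intro mult_left_mono) auto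
    moreover have "\<bar>b * u\<bar> \<le> 1 * \<bar>u\<bar>"
      unfolding abs_mult using b by (intro mult_right_mono) auto
    moreover have "\<bar>u\<bar> * \<bar>u\<bar> = u\<^sup>2" by (simp add: power2_eq_square)
    ultimately show False
      using True c \<open>\<not> \<bar>u\<bar> \<le> 3\<close> unfolding quad_def by linarith
  qed
  have "quad c b u = c + b\<^sup>2 - (u + b)\<^sup>2"
    by (simp add: quad_def power2_eq_square algebra_simps)
  moreover have "b\<^sup>2 \<le> 1"
    using b by (simp add: abs_square_le_1)
  ultimately have quad: "quad c b u \<le> 2"
    using c by (smt (verit) zero_le_power2)
  have "cmod (bump p c b s u) = \<bar>u\<bar> ^ p * quad c b u powr Re s"
    using True by (simp add: bump_def norm_mult norm_power norm_powr_real_powr)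
  also have "\<dots> \<le> 3 ^ 2 * 2 powr real m"
  proof (intro mult_mono)
    have "\<bar>u\<bar> ^ p \<le> 3 ^ p" using u by (intro power_mono) auto
    also have "\<dots> \<le> 3 ^ 2" using \<open>p \<le> 2\<close> by (intro power_increasing) auto
    finally show "\<bar>u\<bar> ^ p \<le> 3 ^ 2" .
    have "quad c b u powr Re s \<le> 2 powr Re s"
      using True quad s by (intro powr_mono2) auto
    also have "\<dots> \<le> 2 powr real m" using s by (intro powr_mono) auto
    finally show "quad c b u powr Re s \<le> 2 powr real m" .
  qed auto
  finally show ?thesis by (simp add: powr_realpow)
next
  case False
  then show ?thesis by (simp add: bump_def)
qed

text \<open>On the disc of radius \<open>c / 6\<close> the polynomial \<open>c - 2 * b * z - z\<^sup>2\<close> stays within \<open>c / 2\<close> of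
  \<open>c\<close>, so its logarithm is holomorphic and bounded there, uniformly in \<open>b\<close>.\<close>

lemma central_diff_bump_bound_near_0:
  assumes c: "0 < c" "c \<le> 1" and b: "\<bar>b\<bar> \<le> 1"
    and s: "cmod s \<le> real m + 1" and r: "0 \<le> r" "real m * r \<le> c / 24"
  shows "norm (central_diff m (bump p c b s) r)
     \<le> 2 * 4 ^ m * exp ((real m + 1) * (\<bar>ln (c / 2)\<bar> + ln 2 + pi)) * (real m * r / (c / 12)) ^ (2 * m)"
proof (rule central_diff_bound_of_holomorphic)
  define Q where "Q z = of_real c - 2 * of_real b * z - z\<^sup>2" for z :: complex
  define F where "F z = z ^ p * exp (s * Ln (Q z))" for z :: complex
  have Q: "Re (Q z) > c / 2" "cmod (Q z) \<le> 2" if "cmod z < c / 6" for z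
  proof -
    have "cmod (Q z - of_real c) = cmod (2 * of_real b * z + z\<^sup>2)"
      by (subst norm_minus_commute) (simp add: Q_def algebra_simps)
    also have "\<dots> \<le> 2 * \<bar>b\<bar> * cmod z + (cmod z)\<^sup>2"
      by (rule order.trans[OF norm_triangle_ineq]) (simp add: norm_mult norm_power)
    also have "\<dots> \<le> 2 * 1 * cmod z + 1 * cmod z"
      using b that c unfolding power2_eq_square
      by (intro add_mono mult_mono) auto
    also have "\<dots> < c / 2" using that by simp
    finally have lt: "cmod (Q z - of_real c) < c / 2" .
    have "\<bar>Re (Q z - of_real c)\<bar> < c / 2"
      using abs_Re_le_cmod[of "Q z - of_real c"] lt by linarith
    moreover have "Re (Q z - of_real c) = Re (Q z) - c" by simp
    ultimately show "Re (Q z) > c / 2" by linarith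
    have "cmod (Q z) \<le> cmod (Q z - of_real c) + cmod (of_real c :: complex)"
      using norm_triangle_ineq[of "Q z - of_real c" "of_real c"] by simp
    then show "cmod (Q z) \<le> 2" using lt c by simp
  qed
  show "F holomorphic_on ball 0 (c / 6)"
    unfolding F_def Q_def
  proof (intro holomorphic_intros)
    fix z assume "z \<in> ball (0::complex) (c / 6)"
    then have "Re (Q z) > 0" using Q(1)[of z] c by (auto simp: dist_norm)
    then show "of_real c - 2 * of_real b * z - z\<^sup>2 \<notin> \<real>\<^sub>\<le>\<^sub>0"
      by (auto simp: Q_def complex_nonpos_Reals_iff)
  qed
  show "cmod (F z) \<le> exp ((real m + 1) * (\<bar>ln (c / 2)\<bar> + ln 2 + pi))" if z: "cmod z < c / 6" for z
  proof -
    have pos: "cmod (Q z) > c / 2"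
      using Q(1)[OF z] complex_Re_le_cmod[of "Q z"] by linarith
    then have nz: "Q z \<noteq> 0" using c by auto
    have "cmod (Ln (Q z)) \<le> \<bar>Re (Ln (Q z))\<bar> + \<bar>Im (Ln (Q z))\<bar>"
      by (rule cmod_le)
    also have "\<bar>Re (Ln (Q z))\<bar> \<le> \<bar>ln (c / 2)\<bar> + ln 2"
    proof -
      have "ln (c / 2) \<le> ln (cmod (Q z))" "ln (cmod (Q z)) \<le> ln 2"
        using pos Q(2)[OF z] c nz by (auto intro!: ln_mono)
      moreover have "ln 2 \<ge> (0 :: real)" by simp
      ultimately have "\<bar>ln (cmod (Q z))\<bar> \<le> \<bar>ln (c / 2)\<bar> + ln 2" by linarith
      then show ?thesis using nz by (simp add: Re_Ln)
    qed
    also have "\<bar>Im (Ln (Q z))\<bar> \<le> pi"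
      using Im_Ln_le_pi[OF nz] mpi_less_Im_Ln[OF nz] by linarith
    finally have Ln: "cmod (Ln (Q z)) \<le> \<bar>ln (c / 2)\<bar> + ln 2 + pi" by simp
    have "cmod (F z) = cmod z ^ p * exp (Re (s * Ln (Q z)))"
      by (simp add: F_def norm_mult norm_power)
    also have "\<dots> \<le> 1 * exp (Re (s * Ln (Q z)))"
      using z c by (intro mult_right_mono power_le_one) auto
    also have "Re (s * Ln (Q z)) \<le> cmod s * cmod (Ln (Q z))"
      using complex_Re_le_cmod[of "s * Ln (Q z)"] by (simp add: norm_mult)
    also have "\<dots> \<le> (real m + 1) * (\<bar>ln (c / 2)\<bar> + ln 2 + pi)"
      using s Ln by (intro mult_mono) auto
    finally show ?thesis by simp
  qed
  show "bump p c b s u = F (of_real u)" if "\<bar>u\<bar> < c / 6" for u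
  proof -
    have eq: "Q (of_real u) = of_real (quad c b u)"
      by (simp add: Q_def quad_def)
    have "quad c b u > 0"
      using Q(1)[of "of_real u"] that c unfolding eq by simp
    then show ?thesis
      by (simp add: bump_def F_def eq powr_def)
  qed
  show "0 < c / 12" "c / 12 < c / 6" "0 \<le> r" "real m * r \<le> c / 12 / 2"
    using c r by auto
qed

lemma set_integrable_powr_near_0:
  assumes "e > -1" "\<rho> \<ge> 0"
  shows "set_integrable lborel {0<..\<rho>} (\<lambda>r::real. r powr e)"
proof -
  have "(\<lambda>r. r powr e) absolutely_integrable_on {0..\<rho>}"
    using integrable_on_powr_from_0[OF assms] by (subst absolutely_integrable_on_iff_nonneg) auto
  then have "set_integrable lborel {0..\<rho>} (\<lambda>r. r powr e)"
    unfolding set_integrable_def by (subst (asm) integrable_completion) auto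
  then show ?thesis
    by (rule set_integrable_subset) auto
qed

lemma set_integrable_powr_near_infinity:
  assumes "e < -1" "\<rho> > 0"
  shows "set_integrable lborel {\<rho><..} (\<lambda>r::real. r powr e)"
proof -
  have "(\<lambda>r. r powr e) absolutely_integrable_on {\<rho>..}"
    using has_integral_powr_to_inf[OF assms] by (subst absolutely_integrable_on_iff_nonneg) auto
  then have "set_integrable lborel {\<rho>..} (\<lambda>r. r powr e)"
    unfolding set_integrable_def by (subst (asm) integrable_completion) auto
  then show ?thesis
    by (rule set_integrable_subset) auto
qed

text \<open>The majorant does not depend on \<open>b\<close>, which makes the integral over all directions converge,
  and holds for all \<open>s\<close> in a rectangle, which makes the integral holomorphic.\<close>

lemma fractional_integrand_dominated:
  assumes c: "0 < c" "c \<le> 1" and \<sigma>: "0 < \<sigma>1" "\<sigma>2 < real m"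
  shows "\<exists>g. set_integrable lborel {0<..} g \<and>
    (\<forall>b p s r. \<bar>b\<bar> \<le> 1 \<longrightarrow> p \<le> 2 \<longrightarrow> \<sigma>1 \<le> Re s \<longrightarrow> Re s \<le> \<sigma>2 \<longrightarrow> \<bar>Im s\<bar> \<le> 1 \<longrightarrow> 0 < r \<longrightarrow>
       cmod (fractional_integrand m p c b s r) \<le> g r)"
proof (cases "\<sigma>1 \<le> \<sigma>2")
  case False
  then show ?thesis
    by (intro exI[of _ "\<lambda>_. 0"]) (auto simp: set_integrable_def)
next
  case True
  \<comment> \<open>the radius up to which the bound near \<open>0\<close> applies\<close>
  define \<rho> where "\<rho> = c / (24 * real m)"
  have "0 < real m" using True \<sigma> by linarith
  then have m: "real m \<ge> 1" by (auto simp: Suc_le_eq)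
  have \<rho>: "0 < \<rho>" "\<rho> \<le> 1"
    using c m by (auto simp: \<rho>_def field_simps)
  define C1 where "C1 = 2 * 4 ^ m * exp ((real m + 1) * (\<bar>ln (c / 2)\<bar> + ln 2 + pi))
      * (real m / (c / 12)) ^ (2 * m)"
  define C2 where "C2 = (4 ^ m * (9 * 2 ^ m) :: real)"
  define g where "g r = (if r \<le> \<rho> then C1 * r powr (2 * real m - 1 - 2 * \<sigma>2)
      else C2 * (r powr (- 1 - 2 * \<sigma>1) + r powr (- 1 - 2 * \<sigma>2)))" for r :: real
  have "set_integrable lborel ({0<..\<rho>} \<union> {\<rho><..}) g"
  proof (rule set_integrable_Un)
    have "set_integrable lborel {0<..\<rho>} (\<lambda>r. C1 * r powr (2 * real m - 1 - 2 * \<sigma>2))"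
      using \<sigma> \<rho> by (intro set_integrable_mult_right set_integrable_powr_near_0) auto
    then show "set_integrable lborel {0<..\<rho>} g"
      by (rule set_integrable_cong[THEN iffD1, rotated -1]) (auto simp: g_def)
    have "set_integrable lborel {\<rho><..} (\<lambda>r. C2 * (r powr (- 1 - 2 * \<sigma>1) + r powr (- 1 - 2 * \<sigma>2)))"
      using \<sigma> \<rho> True by (intro set_integrable_mult_right set_integral_add set_integrable_powr_near_infinity) auto
    then show "set_integrable lborel {\<rho><..} g"
      by (rule set_integrable_cong[THEN iffD1, rotated -1]) (auto simp: g_def)
  qed auto
  moreover have "{0<..\<rho>} \<union> {\<rho><..} = {0<..}" using \<rho> by auto
  moreover have "cmod (fractional_integrand m p c b s r) \<le> g r"
    if b: "\<bar>b\<bar> \<le> 1" and p: "p \<le> 2" and s: "\<sigma>1 \<le> Re s" "Re s \<le> \<sigma>2" "\<bar>Im s\<bar> \<le> 1" and r: "0 < r"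
    for b p s r
  proof -
    have norm: "cmod (fractional_integrand m p c b s r)
        = norm (central_diff m (bump p c b s) r) * r powr (- 1 - 2 * Re s)"
      using r by (simp add: fractional_integrand_def norm_mult norm_powr_real_powr)
    show ?thesis
    proof (cases "r \<le> \<rho>")
      case True
      have s': "cmod s \<le> real m + 1"
        using cmod_le[of s] s \<sigma> by linarith
      have "real m * r \<le> real m * \<rho>" using True m by (intro mult_left_mono) auto
      also have "\<dots> = c / 24" using m by (simp add: \<rho>_def)
      finally have "norm (central_diff m (bump p c b s) r) \<le> C1 * r ^ (2 * m)"
        using central_diff_bump_bound_near_0[OF c b s', of r p] r
        by (simp add: C1_def power_divide power_mult_distrib mult_ac)
      moreover have "r powr (- 1 - 2 * Re s) \<le> r powr (- 1 - 2 * \<sigma>2)"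
        using r True \<rho> s by (intro powr_mono') auto
      ultimately have "cmod (fractional_integrand m p c b s r) \<le> C1 * r ^ (2 * m) * r powr (- 1 - 2 * \<sigma>2)"
        unfolding norm using r by (intro mult_mono) (auto simp: C1_def)
      also have "\<dots> = g r"
        using True r by (simp add: g_def mult.assoc flip: powr_realpow powr_add) (simp add: algebra_simps)
      finally show ?thesis .
    next
      case False
      have "norm (central_diff m (bump p c b s) r)
          \<le> (\<Sum>k = - int m..int m. \<bar>diff_weight m k\<bar> * (9 * 2 ^ m))"
        unfolding central_diff_def using bump_bound[OF c b p] s \<sigma>
        by (intro order.trans[OF norm_sum] sum_mono) (auto intro!: mult_left_mono)
      also have "\<dots> = C2"
        by (simp add: C2_def sum_abs_diff_weight flip: sum_distrib_right)
      finally have 1: "norm (central_diff m (bump p c b s) r) \<le> C2" .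
      have 2: "r powr (- 1 - 2 * Re s) \<le> r powr (- 1 - 2 * \<sigma>1) + r powr (- 1 - 2 * \<sigma>2)"
      proof (cases "r \<le> 1")
        case True
        then have "r powr (- 1 - 2 * Re s) \<le> r powr (- 1 - 2 * \<sigma>2)"
          using r s by (intro powr_mono') auto
        then show ?thesis by (simp add: add_increasing)
      next
        case False
        then have "r powr (- 1 - 2 * Re s) \<le> r powr (- 1 - 2 * \<sigma>1)"
          using r s by (intro powr_mono) auto
        then show ?thesis by (simp add: add_increasing2)
      qed
      show ?thesis
        unfolding norm using 1 2 False
        by (auto simp: g_def C2_def intro!: mult_mono)
    qed
  qed
  ultimately show ?thesis by metis
qed

section \<open>Holomorphic dependence on the order\<close>

text \<open>By Cauchy's inequality the majorant of the functions also bounds their derivatives, hence the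
  difference quotients, up to a constant; dominated convergence then applies.\<close>

lemma holomorphic_on_dominated_integral:
  fixes f :: "complex \<Rightarrow> 'b \<Rightarrow> complex"
  assumes U: "open U"
    and meas: "\<And>s. s \<in> U \<Longrightarrow> f s \<in> borel_measurable M"
    and hol: "\<And>t. t \<in> space M \<Longrightarrow> (\<lambda>s. f s t) holomorphic_on U"
    and dom: "\<And>s0. s0 \<in> U \<Longrightarrow> \<exists>r>0. \<exists>g. integrable M g \<and> ball s0 r \<subseteq> U \<and>
      (\<forall>s\<in>ball s0 r. \<forall>t\<in>space M. cmod (f s t) \<le> g t)"
  shows "(\<lambda>s. LINT t|M. f s t) holomorphic_on U"
  unfolding holomorphic_on_open[OF U]
proof
  fix s0 assume s0: "s0 \<in> U"
  obtain r g where r: "r > 0" and g: "integrable M g" and sub: "ball s0 r \<subseteq> U"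
    and bound: "\<And>s t. s \<in> ball s0 r \<Longrightarrow> t \<in> space M \<Longrightarrow> cmod (f s t) \<le> g t"
    using dom[OF s0] by metis
  define f' where "f' t = deriv (\<lambda>s. f s t) s0" for t
  have integrable: "integrable M (f s)" if "s \<in> ball s0 r" for s
    using bound[OF that] meas sub that
    by (intro Bochner_Integration.integrable_bound[OF g]) (auto intro!: AE_I2 order.trans[OF _ abs_ge_self])
  have f': "((\<lambda>s. f s t) has_field_derivative f' t) (at s0)" if "t \<in> space M" for t
    unfolding f'_def by (rule holomorphic_derivI[OF hol[OF that] U s0])
  have lipschitz: "cmod (f s t - f s0 t) \<le> (4 * g t / r) * cmod (s - s0)"
    if s: "s \<in> ball s0 (r / 2)" and t: "t \<in> space M" for s t
  proof (rule field_differentiable_bound[where S = "ball s0 (r / 2)" and f' = "\<lambda>z. deriv (\<lambda>s. f s t) z"])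
    fix z assume z: "z \<in> ball s0 (r / 2)"
    have sub_z: "cball z (r / 4) \<subseteq> ball s0 r"
    proof
      fix w assume "w \<in> cball z (r / 4)"
      then show "w \<in> ball s0 r"
        using z dist_triangle[of s0 w z] r by auto
    qed
    have hol_z: "(\<lambda>s. f s t) holomorphic_on cball z (r / 4)"
      using hol[OF t] sub sub_z by (blast intro: holomorphic_on_subset)
    have "z \<in> U" using z sub r by auto
    then show "((\<lambda>s. f s t) has_field_derivative deriv (\<lambda>s. f s t) z) (at z within ball s0 (r / 2))"
      using holomorphic_derivI[OF hol[OF t] U] has_field_derivative_at_within by blast
    have "cmod ((deriv ^^ 1) (\<lambda>s. f s t) z) \<le> fact 1 * g t / (r / 4) ^ 1"
    proof (rule Cauchy_inequality)
      show "(\<lambda>s. f s t) holomorphic_on ball z (r / 4)"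
        using hol_z ball_subset_cball holomorphic_on_subset by blast
      show "continuous_on (cball z (r / 4)) (\<lambda>s. f s t)"
        using hol_z by (rule holomorphic_on_imp_continuous_on)
      show "cmod (f x t) \<le> g t" if "cmod (z - x) = r / 4" for x
        using that sub_z t by (intro bound) (auto simp: dist_norm)
    qed (use r in auto)
    then show "cmod (deriv (\<lambda>s. f s t) z) \<le> 4 * g t / r"
      by (simp add: field_simps)
  qed (use s r in auto)
  have "((\<lambda>s. ((LINT t|M. f s t) - (LINT t|M. f s0 t)) / (s - s0)) \<longlongrightarrow> (LINT t|M. f' t)) (at s0)"
    unfolding tendsto_at_iff_sequentially comp_def
  proof (intro allI impI)
    fix X :: "nat \<Rightarrow> complex"
    assume X: "\<forall>i. X i \<in> UNIV - {s0}" "X \<longlonglongrightarrow> s0"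
    have "eventually (\<lambda>i. X i \<in> ball s0 (r / 2)) sequentially"
      using X(2) r by (intro topological_tendstoD) auto
    then obtain N where N: "\<And>i. X (i + N) \<in> ball s0 (r / 2)"
      by (metis eventually_sequentially le_add2)
    have X_ne: "X i \<noteq> s0" for i using X(1) by auto
    have X_in: "X (i + N) \<in> ball s0 r" for i using N[of i] r by auto
    have s0_in: "s0 \<in> ball s0 r" using r by auto
    have quotient: "(\<lambda>i. (f (X (i + N)) t - f s0 t) / (X (i + N) - s0)) \<longlonglongrightarrow> f' t"
      if "t \<in> space M" for t
    proof -
      have "((\<lambda>s. (f s t - f s0 t) / (s - s0)) \<longlongrightarrow> f' t) (at s0)"
        using f'[OF that] by (simp add: has_field_derivative_iff)
      then have "(\<lambda>i. (f (X i) t - f s0 t) / (X i - s0)) \<longlonglongrightarrow> f' t"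
        using X unfolding tendsto_at_iff_sequentially comp_def by auto
      then show ?thesis by (rule LIMSEQ_ignore_initial_segment)
    qed
    have meas_q: "(\<lambda>t. (f (X (i + N)) t - f s0 t) / (X (i + N) - s0)) \<in> borel_measurable M" for i
      using meas X_in[of i] s0 sub by (intro borel_measurable_divide borel_measurable_diff) auto
    have "f' \<in> borel_measurable M"
      by (rule borel_measurable_LIMSEQ_metric[OF meas_q quotient])
    then have "(\<lambda>i. LINT t|M. (f (X (i + N)) t - f s0 t) / (X (i + N) - s0)) \<longlonglongrightarrow> (LINT t|M. f' t)"
    proof (rule integral_dominated_convergence)
      show "integrable M (\<lambda>t. 4 * g t / r)"
        using g by simp
      show "AE t in M. cmod ((f (X (i + N)) t - f s0 t) / (X (i + N) - s0)) \<le> 4 * g t / r" for i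
        using lipschitz[OF N[of i]] X_ne[of "i + N"]
        by (intro AE_I2) (auto simp: norm_divide divide_simps)
    qed (use quotient meas_q in auto)
    moreover have quotient_integral: "(LINT t|M. (f (X (i + N)) t - f s0 t) / (X (i + N) - s0))
        = ((LINT t|M. f (X (i + N)) t) - (LINT t|M. f s0 t)) / (X (i + N) - s0)" for i
      using integrable[OF X_in[of i]] integrable[OF s0_in] by simp
    ultimately have "(\<lambda>i. ((LINT t|M. f (X (i + N)) t) - (LINT t|M. f s0 t)) / (X (i + N) - s0))
        \<longlonglongrightarrow> (LINT t|M. f' t)"
      by (simp only: quotient_integral)
    then show "(\<lambda>i. ((LINT t|M. f (X i) t) - (LINT t|M. f s0 t)) / (X i - s0))
        \<longlonglongrightarrow> (LINT t|M. f' t)"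
      by (rule LIMSEQ_offset)
  qed
  then show "\<exists>f'. ((\<lambda>s. LINT t|M. f s t) has_field_derivative f') (at s0)"
    by (auto simp: has_field_derivative_iff)
qed

lemma measurable_quad [measurable]: "quad c b \<in> borel_measurable borel"
  unfolding quad_def [abs_def] by measurable

lemma bump_measurable [measurable]: "bump p c b s \<in> borel_measurable borel"
proof -
  have eq: "bump p c b s = (\<lambda>u. if quad c b u > 0
      then of_real (u ^ p) * exp (s * of_real (ln (quad c b u))) else 0)"
    by (auto simp: fun_eq_iff bump_def powr_def Ln_of_real)
  show ?thesis unfolding eq by measurable
qed

lemma fractional_integrand_measurable [measurable]:
  "(\<lambda>r. indicator {0<..} r *\<^sub>R fractional_integrand m p c b s r) \<in> borel_measurable borel"
proof -
  have eq: "(\<lambda>r. indicator {0<..} r *\<^sub>R fractional_integrand m p c b s r)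
    = (\<lambda>r. if r > 0 then central_diff m (bump p c b s) r * exp ((- 1 - 2 * s) * of_real (ln r)) else 0)"
    by (auto simp: fun_eq_iff fractional_integrand_def powr_def Ln_of_real)
  show ?thesis unfolding eq central_diff_def by measurable
qed

text \<open>The bound on the imaginary part keeps \<open>s\<close> bounded, as the majorants require.\<close>

definition strip :: "nat \<Rightarrow> complex set" where
  "strip m = {s. 0 < Re s \<and> Re s < real m \<and> \<bar>Im s\<bar> < 1}"

lemma open_strip: "open (strip m)"
  unfolding strip_def
  by (intro open_Collect_conj open_Collect_less continuous_intros)

lemma connected_strip: "connected (strip m)"
proof -
  have "strip m = {s. 0 < Re s} \<inter> {s. Re s < real m} \<inter> {s. Im s < 1} \<inter> {s. Im s > -1}"
    by (auto simp: strip_def)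
  then have "convex (strip m)"
    by (simp add: convex_Int convex_halfspace_Re_gt convex_halfspace_Re_lt
          convex_halfspace_Im_gt convex_halfspace_Im_lt)
  then show ?thesis by (rule convex_connected)
qed

definition fractional_integral :: "nat \<Rightarrow> nat \<Rightarrow> real \<Rightarrow> real \<Rightarrow> complex \<Rightarrow> complex" where
  "fractional_integral m p c b s = (LINT r:{0<..}|lborel. fractional_integrand m p c b s r)"

lemma fractional_integral_holomorphic:
  assumes c: "0 < c" "c \<le> 1" and b: "\<bar>b\<bar> \<le> 1" and p: "p \<le> 2"
  shows "fractional_integral m p c b holomorphic_on strip m"
  unfolding fractional_integral_def [abs_def] set_lebesgue_integral_def
proof (rule holomorphic_on_dominated_integral[OF open_strip])
  show "(\<lambda>s. indicator {0<..} r *\<^sub>R fractional_integrand m p c b s r) holomorphic_on strip m" for r :: real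
    unfolding fractional_integrand_def central_diff_def bump_def scaleR_conv_of_real
    by (intro holomorphic_intros)
  fix s0 assume s0: "s0 \<in> strip m"
  then obtain r where r: "r > 0" "cball s0 r \<subseteq> strip m"
    using open_contains_cball open_strip by blast
  have in_strip: "s0 - of_real r \<in> strip m" "s0 + of_real r \<in> strip m"
    using r by (auto intro!: subsetD[OF r(2)] simp: dist_norm)
  define \<sigma>1 \<sigma>2 where "\<sigma>1 = Re s0 - r" and "\<sigma>2 = Re s0 + r"
  have \<sigma>: "0 < \<sigma>1" "\<sigma>2 < real m"
    using in_strip by (auto simp: strip_def \<sigma>1_def \<sigma>2_def)
  obtain g where g: "set_integrable lborel {0<..} g"
    and g_bound: "\<And>b p s r. \<lbrakk>\<bar>b\<bar> \<le> 1; p \<le> 2; \<sigma>1 \<le> Re s; Re s \<le> \<sigma>2; \<bar>Im s\<bar> \<le> 1; 0 < r\<rbrakk> \<Longrightarrow>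
       cmod (fractional_integrand m p c b s r) \<le> g r"
    using fractional_integrand_dominated[OF c \<sigma>] by metis
  have "cmod (indicator {0<..} t *\<^sub>R fractional_integrand m p c b s t) \<le> indicator {0<..} t *\<^sub>R g t"
    if s: "s \<in> ball s0 r" for s and t :: real
  proof (cases "t > 0")
    case True
    have "\<bar>Re s - Re s0\<bar> < r"
      using s abs_Re_le_cmod[of "s - s0"] by (simp add: dist_norm norm_minus_commute)
    moreover have "s \<in> strip m" using s r(2) by auto
    ultimately show ?thesis
      using g_bound[OF b p, of s t] True by (auto simp: \<sigma>1_def \<sigma>2_def strip_def)
  qed auto
  then show "\<exists>r>0. \<exists>g. integrable lborel g \<and> ball s0 r \<subseteq> strip m \<and>
      (\<forall>s\<in>ball s0 r. \<forall>t\<in>space lborel.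
         cmod (indicator {0<..} t *\<^sub>R fractional_integrand m p c b s t) \<le> g t)"
    using r g by (intro exI[of _ r] conjI exI[of _ "\<lambda>t. indicator {0<..} t *\<^sub>R g t"])
      (auto simp: set_integrable_def)
qed auto

section \<open>Reduction to Beta integrals\<close>

lemma set_integral_change_of_variables:
  fixes f g g' :: "real \<Rightarrow> real"
  assumes [measurable]: "S \<in> sets borel" "g ` S \<in> sets borel"
    "f \<in> borel_measurable borel" "g \<in> borel_measurable borel" "g' \<in> borel_measurable borel"
    and deriv: "\<And>x. x \<in> S \<Longrightarrow> (g has_field_derivative g' x) (at x)"
    and inj: "inj_on g S"
  shows "set_integrable lborel (g ` S) f \<longleftrightarrow> set_integrable lborel S (\<lambda>x. \<bar>g' x\<bar> * f (g x))" (is ?th1)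
    and "(LINT x:g ` S|lborel. f x) = (LINT x:S|lborel. \<bar>g' x\<bar> * f (g x))" (is ?th2)
proof -
  have lebesgue_iff: "h absolutely_integrable_on A \<longleftrightarrow> set_integrable lborel A h"
    if "A \<in> sets borel" "h \<in> borel_measurable borel" for A and h :: "real \<Rightarrow> real"
    unfolding set_integrable_def using that by (subst integrable_completion) auto
  have S: "S \<in> sets lebesgue" by simp
  have cov: "(\<lambda>x. \<bar>g' x\<bar> * f (g x)) absolutely_integrable_on S \<and>
           integral S (\<lambda>x. \<bar>g' x\<bar> * f (g x)) = b
     \<longleftrightarrow> f absolutely_integrable_on (g ` S) \<and> integral (g ` S) f = b" for b
    using has_absolute_integral_change_of_variables_1'[OF S _ inj, of g' f b] deriv
    by (blast intro: has_field_derivative_at_within)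
  show iff: ?th1
    using cov by (subst (1 2) lebesgue_iff [symmetric]) auto
  show ?th2
  proof (cases "set_integrable lborel (g ` S) f")
    case True
    then have "f absolutely_integrable_on (g ` S)"
      by (subst lebesgue_iff) auto
    then have "integral S (\<lambda>x. \<bar>g' x\<bar> * f (g x)) = integral (g ` S) f"
      using cov[of "integral (g ` S) f"] by simp
    then show ?thesis
      using True iff by (simp add: set_borel_integral_eq_integral)
  next
    case False
    then show ?thesis
      using iff by (simp add: set_lebesgue_integral_def set_integrable_def not_integrable_integral_eq)
  qed
qed

lemma Beta_half_line:
  assumes "a > 0" "b > (0::real)"
  shows "set_integrable lborel {0<..} (\<lambda>v. v powr (a - 1) * (1 + v) powr (- a - b))"
    and "(LINT v:{0<..}|lborel. v powr (a - 1) * (1 + v) powr (- a - b)) = Beta a b"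
proof -
  define g :: "real \<Rightarrow> real" where "g t = t / (1 - t)" for t
  define g' :: "real \<Rightarrow> real" where "g' t = 1 / (1 - t)\<^sup>2" for t
  define f where "f v = v powr (a - 1) * (1 + v) powr (- a - b)" for v :: real
  have image: "g ` {0<..<1} = {0<..}"
  proof (intro equalityI subsetI)
    fix v :: real assume v: "v \<in> {0<..}"
    then have "v = g (v / (1 + v))" by (simp add: g_def field_simps)
    then show "v \<in> g ` {0<..<1}" using v by (intro image_eqI[of _ _ "v / (1 + v)"]) auto
  qed (auto simp: g_def)
  have [measurable]: "g \<in> borel_measurable borel" "g' \<in> borel_measurable borel" "f \<in> borel_measurable borel"
    unfolding g_def [abs_def] g'_def [abs_def] f_def [abs_def] by measurable
  have deriv: "(g has_field_derivative g' t) (at t)" if "t \<in> {0<..<1}" for t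
    using that unfolding g_def [abs_def] g'_def
    by (auto intro!: derivative_eq_intros simp: power2_eq_square)
  have inj: "inj_on g {0<..<1}"
    by (auto simp: inj_on_def g_def field_simps)
  have eq: "\<bar>g' t\<bar> * f (g t) = t powr (a - 1) * (1 - t) powr (b - 1)" if "t \<in> {0<..<1}" for t
  proof -
    have t: "0 < t" "0 < 1 - t" using that by auto
    have "1 + g t = 1 / (1 - t)" using t by (simp add: g_def field_simps)
    then have "f (g t) = (t / (1 - t)) powr (a - 1) * (1 / (1 - t)) powr (- a - b)"
      by (simp add: f_def g_def)
    also have "(t / (1 - t)) powr (a - 1) = t powr (a - 1) * (1 - t) powr (1 - a)"
      using t powr_minus_divide[of "1 - t" "a - 1"] by (simp add: powr_divide)
    also have "(1 / (1 - t)) powr (- a - b) = (1 - t) powr (a + b)"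
      using t powr_minus_divide[of "1 - t" "- a - b"] by (simp add: powr_divide add.commute)
    finally have "f (g t) = t powr (a - 1) * ((1 - t) powr (1 - a) * (1 - t) powr (a + b))"
      by (simp only: mult.assoc)
    also have "(1 - t) powr (1 - a) * (1 - t) powr (a + b) = (1 - t) powr (b - 1) * (1 - t)\<^sup>2"
      using t by (simp flip: powr_add powr_numeral)
    finally show ?thesis using t by (simp add: g'_def)
  qed
  have Beta: "set_integrable lborel {0<..<1} (\<lambda>t. t powr (a - 1) * (1 - t) powr (b - 1))"
    by (rule set_integrable_subset[OF integrable_Beta[OF assms]]) auto
  have "set_integrable lborel {0<..<1} (\<lambda>t. \<bar>g' t\<bar> * f (g t))"
    using Beta by (rule set_integrable_cong[THEN iffD1, rotated -1]) (auto simp: eq)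
  then have "set_integrable lborel {0<..} f"
    using set_integral_change_of_variables(1)[of "{0<..<1}" g f g'] deriv inj
    by (simp add: image)
  then show "set_integrable lborel {0<..} (\<lambda>v. v powr (a - 1) * (1 + v) powr (- a - b))"
    by (simp add: f_def [abs_def])
  have "(LINT v:{0<..}|lborel. f v) = (LINT t:{0<..<1}|lborel. \<bar>g' t\<bar> * f (g t))"
    using set_integral_change_of_variables(2)[of "{0<..<1}" g f g'] deriv inj
    by (simp add: image)
  also have "\<dots> = (LINT t:{0<..<1}|lborel. t powr (a - 1) * (1 - t) powr (b - 1))"
    by (intro set_lebesgue_integral_cong) (auto simp: eq)
  also have "\<dots> = integral {0<..<1} (\<lambda>t. t powr (a - 1) * (1 - t) powr (b - 1))"
    using Beta by (rule set_borel_integral_eq_integral(2))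
  also have "\<dots> = Beta a b"
    using has_integral_Beta_real[OF assms] by (intro integral_unique) (simp add: has_integral_Icc_iff_Ioo)
  finally show "(LINT v:{0<..}|lborel. v powr (a - 1) * (1 + v) powr (- a - b)) = Beta a b"
    by (simp add: f_def)
qed

text \<open>Solving \<open>quad c b u = v * u\<^sup>2\<close> for \<open>1 / u\<close> gives \<open>(b + quad_disc c b v) / c\<close>, the solution
  being positive.\<close>

definition quad_disc :: "real \<Rightarrow> real \<Rightarrow> real \<Rightarrow> real" where
  "quad_disc c b v = sqrt (b\<^sup>2 + c * (1 + v))"

definition quad_root :: "real \<Rightarrow> real \<Rightarrow> real \<Rightarrow> real" where
  "quad_root c b v = c / (quad_disc c b v + b)"

context
  fixes c b :: real
  assumes c: "0 < c"
begin

lemma quad_disc_gt: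
  assumes "v \<ge> 0" shows "quad_disc c b v > \<bar>b\<bar>"
proof -
  have "c * (1 + v) > 0"
    using assms c by (intro mult_pos_pos) auto
  then have "sqrt (b\<^sup>2) < quad_disc c b v"
    unfolding quad_disc_def by (intro real_sqrt_less_mono) simp
  then show ?thesis by simp
qed

lemma quad_disc_square: "v \<ge> 0 \<Longrightarrow> (quad_disc c b v)\<^sup>2 = b\<^sup>2 + c * (1 + v)"
  using c by (simp add: quad_disc_def)

lemma quad_root_pos: "v \<ge> 0 \<Longrightarrow> quad_root c b v > 0"
  using quad_disc_gt[of v] c by (auto simp: quad_root_def intro!: divide_pos_pos)

lemma quad_root_alt: "v \<ge> 0 \<Longrightarrow> quad_root c b v = (quad_disc c b v - b) / (1 + v)"
proof -
  assume v: "v \<ge> 0"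
  have "(quad_disc c b v - b) * (quad_disc c b v + b) = c * (1 + v)"
    using quad_disc_square[OF v] by (simp add: algebra_simps power2_eq_square)
  then show ?thesis
    using quad_disc_gt[OF v] v by (simp add: quad_root_def field_simps)
qed

lemma quad_at_root:
  assumes v: "v \<ge> 0" shows "quad c b (quad_root c b v) = v * (quad_root c b v)\<^sup>2"
proof -
  define w where "w = quad_disc c b v + b"
  have w: "w > 0" using quad_disc_gt[OF v] by (simp add: w_def)
  have sq: "(quad_disc c b v)\<^sup>2 = b\<^sup>2 + c * (1 + v)" using quad_disc_square[OF v] .
  have "c * w\<^sup>2 - 2 * b * c * w - c\<^sup>2 = c * ((quad_disc c b v)\<^sup>2 - b\<^sup>2 - c)"
    by (simp add: w_def power2_eq_square algebra_simps)
  also have "\<dots> = v * c\<^sup>2" unfolding sq by (simp add: power2_eq_square algebra_simps)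
  finally have eq: "c * w\<^sup>2 - 2 * b * c * w - c\<^sup>2 = v * c\<^sup>2" .
  have "quad c b (c / w) = (c * w\<^sup>2 - 2 * b * c * w - c\<^sup>2) / w\<^sup>2"
    using w by (simp add: quad_def field_simps power2_eq_square)
  also have "\<dots> = v * (c / w)\<^sup>2"
    unfolding eq by (simp add: power_divide)
  finally show ?thesis by (simp add: quad_root_def w_def)
qed

lemma quad_root_image: "quad_root c b ` {0<..} = {u. 0 < u \<and> 0 < quad c b u}"
proof (intro equalityI subsetI)
  fix u assume "u \<in> {u. 0 < u \<and> 0 < quad c b u}"
  then have u: "0 < u" "0 < quad c b u" by auto
  define v where "v = quad c b u / u\<^sup>2"
  have v: "v > 0" using u by (simp add: v_def)
  have "2 * (c - b * u) = quad c b u + u\<^sup>2 + c"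
    by (simp add: quad_def)
  then have pos: "c - b * u > 0" using u c by (smt (verit) zero_le_power2)
  have "(c / u - b)\<^sup>2 = b\<^sup>2 + c * (1 + v)"
    using u by (simp add: v_def quad_def field_simps power2_eq_square)
  moreover have "c / u - b = (c - b * u) / u" using u by (simp add: field_simps)
  then have "c / u - b \<ge> 0" using pos u by simp
  ultimately have "quad_disc c b v = c / u - b"
    unfolding quad_disc_def by (metis real_sqrt_unique)
  then have "quad_root c b v = u" using u c by (simp add: quad_root_def)
  then show "u \<in> quad_root c b ` {0<..}" using v by force
qed (use quad_root_pos quad_at_root in \<open>auto simp: less_imp_le intro!: mult_pos_pos zero_less_power\<close>)

lemma quad_root_deriv:
  assumes v: "v > 0"
  shows "(quad_root c b has_field_derivative - ((quad_root c b v)\<^sup>2 / (2 * quad_disc c b v))) (at v)"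
proof -
  define D where "D = quad_disc c b v"
  have D: "D > \<bar>b\<bar>" using quad_disc_gt[of v] v by (simp add: D_def)
  have pos: "b\<^sup>2 + c * (1 + v) > 0" using v c by (intro add_nonneg_pos mult_pos_pos) auto
  have "((\<lambda>v. b\<^sup>2 + c * (1 + v)) has_field_derivative c) (at v)"
    by (auto intro!: derivative_eq_intros)
  from DERIV_chain2[OF DERIV_real_sqrt[OF pos] this]
  have "(quad_disc c b has_field_derivative c / (2 * D)) (at v)"
    unfolding quad_disc_def [abs_def] by (simp add: D_def quad_disc_def field_simps)
  then have "(quad_root c b has_field_derivative - (c * (c / (2 * D))) / (D + b)\<^sup>2) (at v)"
    unfolding quad_root_def [abs_def] using D
    by (auto intro!: derivative_eq_intros simp: D_def power2_eq_square)
  then show ?thesis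
    by (simp add: quad_root_def D_def [symmetric] power_divide power2_eq_square mult_ac)
qed

lemma quad_disc_measurable [measurable]: "quad_disc c b \<in> borel_measurable borel"
  and quad_root_measurable [measurable]: "quad_root c b \<in> borel_measurable borel"
  unfolding quad_disc_def [abs_def] quad_root_def [abs_def] by measurable

text \<open>With \<open>v = Q(u) / u\<^sup>2\<close> both the power of \<open>Q\<close> and the singular kernel become powers of \<open>v\<close>.\<close>

lemma quad_power_substitution:
  fixes \<sigma> :: real and j :: nat
  defines "f \<equiv> \<lambda>u. max 0 (quad c b u) powr \<sigma> * u powr (real j - 2 - 2 * \<sigma>)"
    and "h \<equiv> \<lambda>v. v powr \<sigma> * (quad_root c b v) ^ j / (2 * quad_disc c b v)"
  shows "set_integrable lborel {0<..} f \<longleftrightarrow> set_integrable lborel {0<..} h"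
    and "(LINT u:{0<..}|lborel. f u) = (LINT v:{0<..}|lborel. h v)"
proof -
  define g where "g = quad_root c b"
  define g' where "g' v = - ((quad_root c b v)\<^sup>2 / (2 * quad_disc c b v))" for v
  define T where "T = {u. 0 < u \<and> 0 < quad c b u}"
  have T: "g ` {0<..} = T" by (simp add: T_def g_def quad_root_image)
  have T_meas: "T \<in> sets borel"
    unfolding T_def by measurable
  have meas: "f \<in> borel_measurable borel" "g \<in> borel_measurable borel" "g' \<in> borel_measurable borel"
    unfolding f_def g_def g'_def [abs_def] by measurable
  have inj: "inj_on g {0<..}"
  proof (rule inj_on_inverseI)
    fix v :: real assume v: "v \<in> {0<..}"
    then show "(\<lambda>u. quad c b u / u\<^sup>2) (g v) = v"
      using quad_root_pos[of v] by (simp add: g_def quad_at_root)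
  qed
  have deriv: "(g has_field_derivative g' v) (at v)" if "v \<in> {0<..}" for v
    using quad_root_deriv that by (auto simp: g_def g'_def)
  have eq: "\<bar>g' v\<bar> * f (g v) = h v" if "v \<in> {0<..}" for v
  proof -
    define u where "u = quad_root c b v"
    have v: "v > 0" using that by simp
    have u: "u > 0" using quad_root_pos[of v] v by (simp add: u_def)
    have D: "quad_disc c b v > 0" using quad_disc_gt[of v] v by linarith
    have "f (g v) = (v * u\<^sup>2) powr \<sigma> * u powr (real j - 2 - 2 * \<sigma>)"
      using v by (simp add: f_def g_def u_def quad_at_root)
    also have "\<dots> = v powr \<sigma> * (u powr (2 * \<sigma>) * u powr (real j - 2 - 2 * \<sigma>))"
      using u v by (simp add: powr_mult powr_powr flip: powr_numeral)
    also have "u powr (2 * \<sigma>) * u powr (real j - 2 - 2 * \<sigma>) = u ^ j / u\<^sup>2"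
      using u by (simp add: powr_diff powr_realpow flip: powr_add)
    finally show ?thesis
      using u D by (simp add: h_def g'_def u_def [symmetric] abs_mult)
  qed
  have zero: "f u = 0" if "u \<notin> T" "u > 0" for u
    using that by (auto simp: T_def f_def)
  have ind: "indicator {0<..} u *\<^sub>R f u = indicator T u *\<^sub>R f u" for u
    using zero[of u] by (auto simp: T_def indicator_def)
  note cov = set_integral_change_of_variables[of "{0<..}" g f g', unfolded T, OF _ T_meas meas deriv inj]
  have "set_integrable lborel {0<..} f \<longleftrightarrow> set_integrable lborel T f"
    unfolding set_integrable_def ind ..
  also have "\<dots> \<longleftrightarrow> set_integrable lborel {0<..} (\<lambda>v. \<bar>g' v\<bar> * f (g v))"
    by (rule cov) auto
  also have "\<dots> \<longleftrightarrow> set_integrable lborel {0<..} h"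
    by (rule set_integrable_cong) (auto simp: eq)
  finally show "set_integrable lborel {0<..} f \<longleftrightarrow> set_integrable lborel {0<..} h" .
  have "(LINT u:{0<..}|lborel. f u) = (LINT u:T|lborel. f u)"
    unfolding set_lebesgue_integral_def ind ..
  also have "\<dots> = (LINT v:{0<..}|lborel. \<bar>g' v\<bar> * f (g v))"
    by (rule cov) auto
  also have "\<dots> = (LINT v:{0<..}|lborel. h v)"
    by (rule set_lebesgue_integral_cong) (auto simp: eq)
  finally show "(LINT u:{0<..}|lborel. f u) = (LINT v:{0<..}|lborel. h v)" .
qed

text \<open>The root decays like \<open>(1 + v) powr (- 1 / 2)\<close> and the discriminant grows like
  \<open>(1 + v) powr (1 / 2)\<close>, so a Beta integrand is a majorant.\<close>

lemma quad_root_power_integrable: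
  assumes "c \<le> 1" "\<bar>b\<bar> \<le> 1" "-1 < \<sigma>" "\<sigma> < (real j - 1) / 2"
  shows "set_integrable lborel {0<..} (\<lambda>v. v powr \<sigma> * (quad_root c b v) ^ j / (2 * quad_disc c b v))"
proof (rule set_integrable_bound)
  show "set_integrable lborel {0<..} (\<lambda>v. (3 ^ j / (2 * sqrt c)) * (v powr (\<sigma> + 1 - 1)
      * (1 + v) powr (- (\<sigma> + 1) - ((real j - 1) / 2 - \<sigma>))))"
    using assms by (intro set_integrable_mult_right Beta_half_line) auto
  show "set_borel_measurable lborel {0<..} (\<lambda>v. v powr \<sigma> * (quad_root c b v) ^ j / (2 * quad_disc c b v))"
    unfolding set_borel_measurable_def by measurable
  show "AE v in lborel. v \<in> {0<..} \<longrightarrow>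
      norm (v powr \<sigma> * (quad_root c b v) ^ j / (2 * quad_disc c b v))
    \<le> norm (3 ^ j / (2 * sqrt c) * (v powr (\<sigma> + 1 - 1) * (1 + v) powr (- (\<sigma> + 1) - ((real j - 1) / 2 - \<sigma>))))"
  proof (intro AE_I2 impI)
    fix v :: real assume "v \<in> {0<..}"
    then have v: "v > 0" by simp
    define D where "D = quad_disc c b v"
    define w where "w = sqrt (1 + v)"
    have w: "w \<ge> 1" "w > 0" "w\<^sup>2 = 1 + v" using v by (auto simp: w_def)
    have D: "D > \<bar>b\<bar>" using quad_disc_gt[of v] v by (simp add: D_def)
    have D_ge: "D \<ge> sqrt c * w"
      unfolding D_def quad_disc_def w_def by (simp flip: real_sqrt_mult)
    have "D \<le> sqrt (2\<^sup>2 * (1 + v))"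
      unfolding D_def quad_disc_def
    proof (rule real_sqrt_le_mono)
      have "b\<^sup>2 \<le> 1" using assms by (simp add: abs_square_le_1)
      moreover have "c * (1 + v) \<le> 1 * (1 + v)" using assms v by (intro mult_right_mono) auto
      ultimately have "b\<^sup>2 + c * (1 + v) \<le> 1 + 1 * (1 + v)" by (rule add_mono)
      also have "\<dots> \<le> 2\<^sup>2 * (1 + v)" using v by simp
      finally show "b\<^sup>2 + c * (1 + v) \<le> 2\<^sup>2 * (1 + v)" .
    qed
    then have D_le: "D \<le> 2 * w" unfolding real_sqrt_mult w_def by simp
    have "quad_root c b v = (D - b) / w\<^sup>2"
      using quad_root_alt[of v] v by (simp add: D_def w)
    also have "\<dots> \<le> 3 * w / w\<^sup>2"
      using D_le assms w v by (intro divide_right_mono) auto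
    finally have root: "quad_root c b v \<le> 3 / w"
      using w by (simp add: power2_eq_square)
    have "norm (v powr \<sigma> * (quad_root c b v) ^ j / (2 * quad_disc c b v))
        = v powr \<sigma> * (quad_root c b v) ^ j / (2 * D)"
      using quad_root_pos[of v] v D by (simp add: D_def abs_mult)
    also have "\<dots> \<le> v powr \<sigma> * (3 / w) ^ j / (2 * (sqrt c * w))"
      using quad_root_pos[of v] v root D_ge w c D
      by (intro frac_le mult_left_mono power_mono mult_nonneg_nonneg mult_pos_pos) auto
    also have "\<dots> = 3 ^ j / (2 * sqrt c) * (v powr \<sigma> * (1 / w ^ (j + 1)))"
      by (simp add: power_divide mult_ac)
    also have "1 / w ^ (j + 1) = (1 + v) powr (- (\<sigma> + 1) - ((real j - 1) / 2 - \<sigma>))"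
    proof -
      have w_powr: "w = (1 + v) powr (1 / 2)" using v by (simp add: w_def powr_half_sqrt)
      have "w ^ (j + 1) = w powr real (j + 1)" using w by (intro powr_realpow [symmetric]) auto
      also have "\<dots> = (1 + v) powr (1 / 2 * real (j + 1))" by (simp only: w_powr powr_powr)
      also have "1 / 2 * real (j + 1) = (real j + 1) / 2" by simp
      finally have "1 / w ^ (j + 1) = (1 + v) powr (- ((real j + 1) / 2))"
        by (simp add: powr_minus_divide)
      also have "- ((real j + 1) / 2) = - (\<sigma> + 1) - ((real j - 1) / 2 - \<sigma>)"
        by (simp add: field_simps)
      finally show ?thesis .
    qed
    also have "3 ^ j / (2 * sqrt c) * (v powr \<sigma> * (1 + v) powr (- (\<sigma> + 1) - ((real j - 1) / 2 - \<sigma>)))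
        \<le> norm (3 ^ j / (2 * sqrt c) * (v powr (\<sigma> + 1 - 1) * (1 + v) powr (- (\<sigma> + 1) - ((real j - 1) / 2 - \<sigma>))))"
      using c by simp
    finally show "norm (v powr \<sigma> * (quad_root c b v) ^ j / (2 * quad_disc c b v))
      \<le> norm (3 ^ j / (2 * sqrt c) * (v powr (\<sigma> + 1 - 1) * (1 + v) powr (- (\<sigma> + 1) - ((real j - 1) / 2 - \<sigma>))))" .
  qed
qed

end

lemma quad_disc_minus: "quad_disc c (- b) v = quad_disc c b v"
  by (simp add: quad_disc_def)

section \<open>One-dimensional integrals of small order\<close>

lemma set_integrable_congI:
  assumes "set_integrable M A f" "\<And>x. x \<in> A \<Longrightarrow> f x = g x"
  shows "set_integrable M A g"
  using assms by (simp cong: set_integrable_cong)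

lemma set_integral_sum:
  fixes f :: "'i \<Rightarrow> 'a \<Rightarrow> real"
  assumes "\<And>i. i \<in> I \<Longrightarrow> set_integrable M A (f i)"
  shows "set_integrable M A (\<lambda>x. \<Sum>i\<in>I. f i x)"
    and "(LINT x:A|M. (\<Sum>i\<in>I. f i x)) = (\<Sum>i\<in>I. LINT x:A|M. f i x)"
  using assms unfolding set_integrable_def set_lebesgue_integral_def scaleR_sum_right
  by (auto intro!: Bochner_Integration.integrable_sum Bochner_Integration.integral_sum)

text \<open>The exponent of \<open>u\<close> is the one for which the substitution \<open>v = quad c b u / u\<^sup>2\<close> leaves the
  \<open>j\<close>-th power of the root.\<close>

definition quad_moment :: "real \<Rightarrow> real \<Rightarrow> real \<Rightarrow> nat \<Rightarrow> real" where
  "quad_moment c b \<sigma> j = (LINT u:{0<..}|lborel. max 0 (quad c b u) powr \<sigma> * u powr (real j - 2 - 2 * \<sigma>))"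

lemma quad_moment_integrable:
  assumes "0 < c" "c \<le> 1" "\<bar>b\<bar> \<le> 1" "-1 < \<sigma>" "\<sigma> < (real j - 1) / 2"
  shows "set_integrable lborel {0<..} (\<lambda>u. max 0 (quad c b u) powr \<sigma> * u powr (real j - 2 - 2 * \<sigma>))"
  using quad_power_substitution(1)[OF assms(1)] quad_root_power_integrable[OF assms] by simp

lemma quad_moment_combination:
  assumes "0 < c" "c \<le> 1" "\<bar>b\<bar> \<le> 1" "-1 < \<sigma>" "\<sigma> < (real j - 1) / 2"
  shows "quad_moment c b \<sigma> j + \<epsilon> * quad_moment c (- b) \<sigma> j
    = (LINT v:{0<..}|lborel. v powr \<sigma> *
        (((quad_root c b v) ^ j + \<epsilon> * (quad_root c (- b) v) ^ j) / (2 * quad_disc c b v)))"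
proof -
  have b': "\<bar>- b\<bar> \<le> 1" using assms by simp
  have int: "set_integrable lborel {0<..} (\<lambda>v. v powr \<sigma> * (quad_root c b v) ^ j / (2 * quad_disc c b v))"
    "set_integrable lborel {0<..} (\<lambda>v. v powr \<sigma> * (quad_root c (- b) v) ^ j / (2 * quad_disc c b v))"
    using quad_root_power_integrable[OF assms]
      quad_root_power_integrable[OF assms(1,2) b' assms(4,5)] by (simp_all add: quad_disc_minus)
  have "quad_moment c b \<sigma> j + \<epsilon> * quad_moment c (- b) \<sigma> j
     = (LINT v:{0<..}|lborel. v powr \<sigma> * (quad_root c b v) ^ j / (2 * quad_disc c b v))
       + \<epsilon> * (LINT v:{0<..}|lborel. v powr \<sigma> * (quad_root c (- b) v) ^ j / (2 * quad_disc c b v))"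
    unfolding quad_moment_def quad_power_substitution(2)[OF assms(1)] quad_disc_minus ..
  also have "\<dots> = (LINT v:{0<..}|lborel. v powr \<sigma> * (quad_root c b v) ^ j / (2 * quad_disc c b v)
       + \<epsilon> * (v powr \<sigma> * (quad_root c (- b) v) ^ j / (2 * quad_disc c b v)))"
    by (simp only: set_integral_add(2)[OF int(1) set_integrable_mult_right[OF int(2)]]
          set_integral_mult_right)
  also have "\<dots> = (LINT v:{0<..}|lborel. v powr \<sigma> *
        (((quad_root c b v) ^ j + \<epsilon> * (quad_root c (- b) v) ^ j) / (2 * quad_disc c b v)))"
    by (intro set_lebesgue_integral_cong) (auto simp: add_divide_distrib algebra_simps)
  finally show ?thesis .
qed

lemma quad_root_combinations:
  fixes b c v :: real
  assumes c: "0 < c" and v: "v > 0"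
  defines "D \<equiv> quad_disc c b v" and "u1 \<equiv> quad_root c b v" and "u2 \<equiv> quad_root c (- b) v"
  shows "(u1 + u2) / (2 * D) = 1 / (1 + v)"
    and "(u1\<^sup>2 - u2\<^sup>2) / (2 * D) = - 2 * b / (1 + v)\<^sup>2"
    and "(u1 ^ 3 + u2 ^ 3) / (2 * D) = c / (1 + v)\<^sup>2 + 4 * b\<^sup>2 / (1 + v) ^ 3"
proof -
  have D: "D > 0" using quad_disc_gt[OF c, of v b] v unfolding D_def by linarith
  have sq: "D\<^sup>2 = b\<^sup>2 + c * (1 + v)" using quad_disc_square[OF c, of v b] v by (simp add: D_def)
  define w where "w = 1 + v"
  have w: "w > 0" using v by (simp add: w_def)
  have u: "u1 = (D - b) / w" "u2 = (D + b) / w"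
    using quad_root_alt[OF c, of v b] quad_root_alt[OF c, of v "- b"] v
    by (simp_all add: u1_def u2_def D_def quad_disc_minus w_def)
  show "(u1 + u2) / (2 * D) = 1 / (1 + v)"
    using D w unfolding w_def [symmetric] u by (simp add: field_simps)
  show "(u1\<^sup>2 - u2\<^sup>2) / (2 * D) = - 2 * b / (1 + v)\<^sup>2"
    using D w unfolding w_def [symmetric] u by (simp add: field_simps power2_eq_square)
  have "u1 ^ 3 + u2 ^ 3 = 2 * D * (D\<^sup>2 + 3 * b\<^sup>2) / w ^ 3"
    using w unfolding u by (simp add: field_simps power2_eq_square power3_eq_cube)
  then have "(u1 ^ 3 + u2 ^ 3) / (2 * D) = (D\<^sup>2 + 3 * b\<^sup>2) / w ^ 3"
    using D by simp
  also have "\<dots> = (c * w + 4 * b\<^sup>2) / w ^ 3" unfolding sq w_def by simp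
  also have "\<dots> = c / w\<^sup>2 + 4 * b\<^sup>2 / w ^ 3"
    using w by (simp add: field_simps power2_eq_square power3_eq_cube)
  finally show "(u1 ^ 3 + u2 ^ 3) / (2 * D) = c / (1 + v)\<^sup>2 + 4 * b\<^sup>2 / (1 + v) ^ 3"
    by (simp add: w_def)
qed

lemma Beta_half_line_nat:
  fixes \<sigma> :: real
  assumes "\<sigma> > -1" "\<sigma> < real n - 1"
  shows "set_integrable lborel {0<..} (\<lambda>v. v powr \<sigma> * (1 / (1 + v) ^ n))"
    and "(LINT v:{0<..}|lborel. v powr \<sigma> * (1 / (1 + v) ^ n)) = Beta (\<sigma> + 1) (real n - 1 - \<sigma>)"
proof -
  have eq: "v powr (\<sigma> + 1 - 1) * (1 + v) powr (- (\<sigma> + 1) - (real n - 1 - \<sigma>)) = v powr \<sigma> * (1 / (1 + v) ^ n)"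
    if "v \<in> {0<..}" for v :: real
  proof -
    have v: "v > 0" using that by simp
    have "- (\<sigma> + 1) - (real n - 1 - \<sigma>) = - real n" by simp
    then have "(1 + v) powr (- (\<sigma> + 1) - (real n - 1 - \<sigma>)) = 1 / (1 + v) ^ n"
      using v by (simp only: powr_minus_divide) (simp add: powr_realpow)
    then show ?thesis by simp
  qed
  have pos: "\<sigma> + 1 > 0" "real n - 1 - \<sigma> > 0" using assms by auto
  show "set_integrable lborel {0<..} (\<lambda>v. v powr \<sigma> * (1 / (1 + v) ^ n))"
    using Beta_half_line(1)[OF pos] by (rule set_integrable_congI) (rule eq)
  show "(LINT v:{0<..}|lborel. v powr \<sigma> * (1 / (1 + v) ^ n)) = Beta (\<sigma> + 1) (real n - 1 - \<sigma>)"
    unfolding Beta_half_line(2)[OF pos, symmetric]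
    by (intro set_lebesgue_integral_cong allI impI eq [symmetric]) auto
qed

text \<open>In the sums over the two sides of the base point the square roots cancel.\<close>

lemma quad_moment_values:
  assumes c: "0 < c" "c \<le> 1" and b: "\<bar>b\<bar> \<le> 1" and s: "0 < s" "s < 1 / 2"
  shows "quad_moment c b (s - 1) 0 = quad_moment c (- b) (s - 1) 0"
    and "quad_moment c b (s - 1) 1 + quad_moment c (- b) (s - 1) 1 = Beta s (1 - s)"
    and "quad_moment c b s 2 - quad_moment c (- b) s 2 = - 2 * b * Beta (s + 1) (1 - s)"
    and "quad_moment c b s 3 + quad_moment c (- b) s 3
      = c * Beta (s + 1) (1 - s) + 4 * b\<^sup>2 * Beta (s + 1) (2 - s)"
proof -
  show "quad_moment c b (s - 1) 0 = quad_moment c (- b) (s - 1) 0"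
    using quad_moment_combination[OF c b, of "s - 1" 0 "-1"] s by (simp add: set_lebesgue_integral_def)
  have "quad_moment c b (s - 1) 1 + 1 * quad_moment c (- b) (s - 1) 1
      = (LINT v:{0<..}|lborel. v powr (s - 1) *
          ((quad_root c b v ^ 1 + 1 * quad_root c (- b) v ^ 1) / (2 * quad_disc c b v)))"
    using s by (intro quad_moment_combination[OF c b]) auto
  also have "\<dots> = (LINT v:{0<..}|lborel. v powr (s - 1) * (1 / (1 + v) ^ 1))"
  proof (intro set_lebesgue_integral_cong allI impI)
    fix v :: real assume "v \<in> {0<..}"
    then have "(quad_root c b v ^ 1 + 1 * quad_root c (- b) v ^ 1) / (2 * quad_disc c b v) = 1 / (1 + v) ^ 1"
      using quad_root_combinations(1)[OF c(1), of v b] by simp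
    then show "v powr (s - 1) * ((quad_root c b v ^ 1 + 1 * quad_root c (- b) v ^ 1) / (2 * quad_disc c b v))
        = v powr (s - 1) * (1 / (1 + v) ^ 1)" by (simp only:)
  qed auto
  finally have "quad_moment c b (s - 1) 1 + 1 * quad_moment c (- b) (s - 1) 1
      = (LINT v:{0<..}|lborel. v powr (s - 1) * (1 / (1 + v) ^ 1))" .
  then show "quad_moment c b (s - 1) 1 + quad_moment c (- b) (s - 1) 1 = Beta s (1 - s)"
    using Beta_half_line_nat(2)[of "s - 1" 1] s by simp
  have "quad_moment c b s 2 + - 1 * quad_moment c (- b) s 2
      = (LINT v:{0<..}|lborel. v powr s *
          ((quad_root c b v ^ 2 + - 1 * quad_root c (- b) v ^ 2) / (2 * quad_disc c b v)))"
    using s by (intro quad_moment_combination[OF c b]) auto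
  also have "\<dots> = (LINT v:{0<..}|lborel. (- 2 * b) * (v powr s * (1 / (1 + v) ^ 2)))"
  proof (intro set_lebesgue_integral_cong allI impI)
    fix v :: real assume "v \<in> {0<..}"
    then have "(quad_root c b v ^ 2 + - 1 * quad_root c (- b) v ^ 2) / (2 * quad_disc c b v)
        = - 2 * b / (1 + v) ^ 2"
      using quad_root_combinations(2)[OF c(1), of v b] by simp
    then show "v powr s * ((quad_root c b v ^ 2 + - 1 * quad_root c (- b) v ^ 2) / (2 * quad_disc c b v))
        = (- 2 * b) * (v powr s * (1 / (1 + v) ^ 2))" by (simp only:) simp
  qed auto
  also have "\<dots> = (- 2 * b) * (LINT v:{0<..}|lborel. v powr s * (1 / (1 + v) ^ 2))"
    by (rule set_integral_mult_right)
  finally show "quad_moment c b s 2 - quad_moment c (- b) s 2 = - 2 * b * Beta (s + 1) (1 - s)"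
    using Beta_half_line_nat(2)[of s 2] s by simp
  have "quad_moment c b s 3 + 1 * quad_moment c (- b) s 3
      = (LINT v:{0<..}|lborel. v powr s *
          ((quad_root c b v ^ 3 + 1 * quad_root c (- b) v ^ 3) / (2 * quad_disc c b v)))"
    using s by (intro quad_moment_combination[OF c b]) auto
  also have "\<dots> = (LINT v:{0<..}|lborel. c * (v powr s * (1 / (1 + v) ^ 2)) + 4 * b\<^sup>2 * (v powr s * (1 / (1 + v) ^ 3)))"
  proof (intro set_lebesgue_integral_cong allI impI)
    fix v :: real assume "v \<in> {0<..}"
    then have "(quad_root c b v ^ 3 + 1 * quad_root c (- b) v ^ 3) / (2 * quad_disc c b v)
        = c / (1 + v) ^ 2 + 4 * b\<^sup>2 / (1 + v) ^ 3"
      using quad_root_combinations(3)[OF c(1), of v b] by simp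
    then show "v powr s * ((quad_root c b v ^ 3 + 1 * quad_root c (- b) v ^ 3) / (2 * quad_disc c b v))
        = c * (v powr s * (1 / (1 + v) ^ 2)) + 4 * b\<^sup>2 * (v powr s * (1 / (1 + v) ^ 3))"
      by (simp only: distrib_left) (simp add: mult_ac)
  qed auto
  also have "\<dots> = c * (LINT v:{0<..}|lborel. v powr s * (1 / (1 + v) ^ 2))
      + 4 * b\<^sup>2 * (LINT v:{0<..}|lborel. v powr s * (1 / (1 + v) ^ 3))"
    using s by (simp only: set_integral_mult_right set_integral_add(2)
        set_integrable_mult_right[OF Beta_half_line_nat(1)])
  finally show "quad_moment c b s 3 + quad_moment c (- b) s 3
      = c * Beta (s + 1) (1 - s) + 4 * b\<^sup>2 * Beta (s + 1) (2 - s)"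
    using Beta_half_line_nat(2)[of s 2] Beta_half_line_nat(2)[of s 3] s by simp
qed

lemma set_integral_half_line_scale:
  fixes f :: "real \<Rightarrow> real"
  assumes k: "k > 0"
  shows "set_integrable lborel {0<..} (\<lambda>r. f (k * r) * r powr (- 1 - 2 * s))
      \<longleftrightarrow> set_integrable lborel {0<..} (\<lambda>u. f u * u powr (- 1 - 2 * s))"
    and "(LINT r:{0<..}|lborel. f (k * r) * r powr (- 1 - 2 * s))
      = k powr (2 * s) * (LINT u:{0<..}|lborel. f u * u powr (- 1 - 2 * s))"
proof -
  define F where "F u = indicator {0<..} u *\<^sub>R (f u * u powr (- 1 - 2 * s))" for u
  have eq: "indicator {0<..} r *\<^sub>R (f (k * r) * r powr (- 1 - 2 * s)) = k powr (1 + 2 * s) * F (0 + k * r)" for r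
  proof (cases "r > 0")
    case True
    have "r powr (- 1 - 2 * s) = k powr (1 + 2 * s) * (k * r) powr (- 1 - 2 * s)"
      using True k by (simp add: powr_mult flip: powr_add mult.assoc)
    then show ?thesis using True k by (simp add: F_def)
  next
    case False
    then show ?thesis using k by (simp add: F_def zero_less_mult_iff)
  qed
  show "set_integrable lborel {0<..} (\<lambda>r. f (k * r) * r powr (- 1 - 2 * s))
      \<longleftrightarrow> set_integrable lborel {0<..} (\<lambda>u. f u * u powr (- 1 - 2 * s))"
    unfolding set_integrable_def eq F_def [symmetric]
    using k lborel_integrable_real_affine_iff[of k F 0] by simp
  have "(LINT r:{0<..}|lborel. f (k * r) * r powr (- 1 - 2 * s)) = k powr (1 + 2 * s) * (LINT r|lborel. F (0 + k * r))"
    unfolding set_lebesgue_integral_def eq by simp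
  also have "\<dots> = k powr (2 * s) * (k * (LINT r|lborel. F (0 + k * r)))"
    using k by (simp add: powr_add)
  also have "k * (LINT r|lborel. F (0 + k * r)) = (LINT u|lborel. F u)"
    using lborel_integral_real_affine[of k F 0] k by simp
  finally show "(LINT r:{0<..}|lborel. f (k * r) * r powr (- 1 - 2 * s))
      = k powr (2 * s) * (LINT u:{0<..}|lborel. f u * u powr (- 1 - 2 * s))"
    by (simp add: F_def set_lebesgue_integral_def)
qed

text \<open>Without a contribution of the centre the shifts can be integrated one by one, and each is a
  dilation of the same integral.\<close>

lemma central_diff_integral_vanishing_centre:
  fixes f :: "real \<Rightarrow> real"
  assumes f0: "f 0 = 0"
    and plus: "set_integrable lborel {0<..} (\<lambda>u. f u * u powr (- 1 - 2 * s))"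
    and minus: "set_integrable lborel {0<..} (\<lambda>u. f (- u) * u powr (- 1 - 2 * s))"
  shows "set_integrable lborel {0<..} (\<lambda>r. central_diff m f r * r powr (- 1 - 2 * s))"
    and "(LINT r:{0<..}|lborel. central_diff m f r * r powr (- 1 - 2 * s))
      = symbol_sum m s * ((LINT u:{0<..}|lborel. f u * u powr (- 1 - 2 * s))
          + (LINT u:{0<..}|lborel. f (- u) * u powr (- 1 - 2 * s)))"
proof -
  have eq: "central_diff m f r * r powr (- 1 - 2 * s)
    = (\<Sum>k = 1..m. diff_weight m (int k) * (f (real k * r) * r powr (- 1 - 2 * s)
          + f (- (real k * r)) * r powr (- 1 - 2 * s)))" for r
    unfolding central_diff_def diff_weight_symmetric_sum
    by (simp add: f0 sum_distrib_right) (intro sum.cong refl, simp add: algebra_simps)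
  have int: "set_integrable lborel {0<..} (\<lambda>r. f (real k * r) * r powr (- 1 - 2 * s))"
    "set_integrable lborel {0<..} (\<lambda>r. f (- (real k * r)) * r powr (- 1 - 2 * s))" if "k \<in> {1..m}" for k
    using set_integral_half_line_scale(1)[of "real k" f s] plus
      set_integral_half_line_scale(1)[of "real k" "\<lambda>u. f (- u)" s] minus that by auto
  show "set_integrable lborel {0<..} (\<lambda>r. central_diff m f r * r powr (- 1 - 2 * s))"
    unfolding eq using int
    by (intro set_integral_sum(1) set_integrable_mult_right set_integral_add)
  have "(LINT r:{0<..}|lborel. central_diff m f r * r powr (- 1 - 2 * s))
     = (\<Sum>k = 1..m. diff_weight m (int k) * ((LINT r:{0<..}|lborel. f (real k * r) * r powr (- 1 - 2 * s))
          + (LINT r:{0<..}|lborel. f (- (real k * r)) * r powr (- 1 - 2 * s))))"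
    unfolding eq using int
    by (subst set_integral_sum(2))
       (auto intro!: set_integrable_mult_right set_integral_add sum.cong)
  also have "\<dots> = (\<Sum>k = 1..m. diff_weight m (int k) * (real k powr (2 * s) *
        ((LINT u:{0<..}|lborel. f u * u powr (- 1 - 2 * s)) + (LINT u:{0<..}|lborel. f (- u) * u powr (- 1 - 2 * s)))))"
    using set_integral_half_line_scale(2)[of _ f s] set_integral_half_line_scale(2)[of _ "\<lambda>u. f (- u)" s]
    by (intro sum.cong refl) (simp add: distrib_left)
  also have "\<dots> = symbol_sum m s * ((LINT u:{0<..}|lborel. f u * u powr (- 1 - 2 * s))
          + (LINT u:{0<..}|lborel. f (- u) * u powr (- 1 - 2 * s)))"
    unfolding symbol_sum_def by (simp add: sum_distrib_right mult_ac)
  finally show "(LINT r:{0<..}|lborel. central_diff m f r * r powr (- 1 - 2 * s))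
      = symbol_sum m s * ((LINT u:{0<..}|lborel. f u * u powr (- 1 - 2 * s))
          + (LINT u:{0<..}|lborel. f (- u) * u powr (- 1 - 2 * s)))" .
qed

definition real_bump :: "nat \<Rightarrow> real \<Rightarrow> real \<Rightarrow> real \<Rightarrow> real \<Rightarrow> real" where
  "real_bump p c b s u = u ^ p * max 0 (quad c b u) powr s"

lemma bump_of_real: "bump p c b (of_real s) u = of_real (real_bump p c b s u)"
  by (simp add: bump_def real_bump_def powr_of_real)

lemma fractional_integrand_of_real:
  assumes "r > 0"
  shows "fractional_integrand m p c b (of_real s) r
    = of_real (central_diff m (real_bump p c b s) r * r powr (- 1 - 2 * s))"
proof -
  have "complex_of_real r powr (- 1 - 2 * of_real s) = of_real (r powr (- 1 - 2 * s))"
    using assms powr_of_real[of r "- 1 - 2 * s"] by simp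
  then show ?thesis
    by (simp add: fractional_integrand_def central_diff_def bump_of_real scaleR_conv_of_real)
qed

lemma real_integrand_integrable:
  assumes c: "0 < c" "c \<le> 1" and b: "\<bar>b\<bar> \<le> 1" and p: "p \<le> 2" and s: "0 < s" "s < real m"
  shows "set_integrable lborel {0<..} (\<lambda>r. central_diff m (real_bump p c b s) r * r powr (- 1 - 2 * s))"
proof -
  obtain g where g: "set_integrable lborel {0<..} g"
    and g_bound: "\<And>b p z r. \<lbrakk>\<bar>b\<bar> \<le> 1; p \<le> 2; s \<le> Re z; Re z \<le> s; \<bar>Im z\<bar> \<le> 1; 0 < r\<rbrakk> \<Longrightarrow>
       cmod (fractional_integrand m p c b z r) \<le> g r"
    using fractional_integrand_dominated[OF c s] by metis
  show ?thesis
  proof (rule set_integrable_bound[OF g])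
    show "set_borel_measurable lborel {0<..} (\<lambda>r. central_diff m (real_bump p c b s) r * r powr (- 1 - 2 * s))"
      unfolding set_borel_measurable_def central_diff_def real_bump_def [abs_def] by measurable
    show "AE r in lborel. r \<in> {0<..} \<longrightarrow>
       norm (central_diff m (real_bump p c b s) r * r powr (- 1 - 2 * s)) \<le> norm (g r)"
    proof (intro AE_I2 impI)
      fix r :: real assume "r \<in> {0<..}"
      then have "cmod (fractional_integrand m p c b (of_real s) r) \<le> g r"
        using b p by (intro g_bound) auto
      then show "norm (central_diff m (real_bump p c b s) r * r powr (- 1 - 2 * s)) \<le> norm (g r)"
        using \<open>r \<in> {0<..}\<close> by (simp add: fractional_integrand_of_real flip: of_real_mult)
    qed
  qed
qed

definition real_fractional_integral :: "nat \<Rightarrow> nat \<Rightarrow> real \<Rightarrow> real \<Rightarrow> real \<Rightarrow> real" where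
  "real_fractional_integral m p c b s
     = (LINT r:{0<..}|lborel. central_diff m (real_bump p c b s) r * r powr (- 1 - 2 * s))"

lemma fractional_integral_of_real:
  "fractional_integral m p c b (of_real s) = of_real (real_fractional_integral m p c b s)"
proof -
  have "fractional_integral m p c b (of_real s)
    = (LINT r:{0<..}|lborel. complex_of_real (central_diff m (real_bump p c b s) r * r powr (- 1 - 2 * s)))"
    unfolding fractional_integral_def
    by (intro set_lebesgue_integral_cong) (auto simp: fractional_integrand_of_real)
  also have "\<dots> = of_real (real_fractional_integral m p c b s)"
    unfolding real_fractional_integral_def by (rule set_integral_complex_of_real)
  finally show ?thesis .
qed

lemma real_bump_minus: "real_bump p c b s (- u) = (- 1) ^ p * real_bump p c (- b) s u"
  by (simp add: real_bump_def quad_def power_minus[of u])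

lemma real_fractional_integral_positive_power:
  assumes c: "0 < c" "c \<le> 1" and b: "\<bar>b\<bar> \<le> 1" and p: "p \<in> {1, 2}" and s: "0 < s" "s < 1 / 2"
  shows "real_fractional_integral m p c b s
    = symbol_sum m s * (quad_moment c b s (p + 1) + (- 1) ^ p * quad_moment c (- b) s (p + 1))"
proof -
  have eq: "real_bump p c b' s u * u powr (- 1 - 2 * s)
      = max 0 (quad c b' u) powr s * u powr (real (p + 1) - 2 - 2 * s)" if "u \<in> {0<..}" for u b'
  proof -
    have "u ^ p * u powr (- 1 - 2 * s) = u powr (real (p + 1) - 2 - 2 * s)"
      using that by (simp flip: powr_realpow powr_add) (simp add: algebra_simps)
    then show ?thesis by (simp add: real_bump_def mult_ac)
  qed
  have int: "set_integrable lborel {0<..} (\<lambda>u. real_bump p c b' s u * u powr (- 1 - 2 * s))"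
    if "\<bar>b'\<bar> \<le> 1" for b'
    using quad_moment_integrable[OF c that, of s "p + 1"] s p
    by (subst set_integrable_cong[OF refl refl eq]) auto
  have val: "(LINT u:{0<..}|lborel. real_bump p c b' s u * u powr (- 1 - 2 * s)) = quad_moment c b' s (p + 1)" for b'
    unfolding quad_moment_def by (rule set_lebesgue_integral_cong) (auto simp: eq)
  have minus: "real_bump p c b s (- u) * u powr (- 1 - 2 * s)
      = (- 1) ^ p * (real_bump p c (- b) s u * u powr (- 1 - 2 * s))" for u
    by (simp add: real_bump_minus)
  show ?thesis
    unfolding real_fractional_integral_def
    by (subst central_diff_integral_vanishing_centre(2))
       (use b p int in \<open>auto simp: real_bump_def[of p c b s 0] minus val\<close>)
qed

section \<open>Integration by parts in the radial variable\<close>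

text \<open>For \<open>p = 0\<close> the integrand does not vanish at the centre, so its shifts cannot be integrated one
  by one.  On the set where \<open>Q > 0\<close>, the function \<open>Q powr s\<close> plus \<open>quad_euler\<close> is
  \<open>Q powr (s - 1) * (c - b * u)\<close>, and up to a constant factor \<open>radial_derivative\<close> exhibits this
  function times the kernel as a derivative.  Hence \<open>Q powr s\<close> may be replaced by minus
  \<open>quad_euler\<close>, which vanishes at the centre.  Where \<open>Q \<le> 0\<close> all of these are \<open>0\<close>, because
  \<open>0 powr x = 0\<close> also for negative \<open>x\<close>.\<close>

definition quad_euler :: "real \<Rightarrow> real \<Rightarrow> real \<Rightarrow> real \<Rightarrow> real" where
  "quad_euler c b s u = max 0 (quad c b u) powr (s - 1) * (b * u + u\<^sup>2)"

lemma radial_derivative: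
  assumes r: "r > 0" and nz: "quad c b (k * r) \<noteq> 0"
  shows "((\<lambda>r. real_bump 0 c b s (k * r) * r powr (- 2 * s)) has_real_derivative
     - 2 * s * ((real_bump 0 c b s (k * r) + quad_euler c b s (k * r)) * r powr (- 1 - 2 * s))) (at r)"
proof (cases "quad c b (k * r) > 0")
  case True
  define A where "A = quad c b (k * r)"
  have A: "A > 0" using True by (simp add: A_def)
  have "open {r. quad c b (k * r) > 0}"
    unfolding quad_def by (intro open_Collect_less continuous_intros)
  moreover have inner: "((\<lambda>r. quad c b (k * r)) has_real_derivative (- 2 * b * k - 2 * k * (k * r))) (at r)"
    unfolding quad_def by (auto intro!: derivative_eq_intros)
  have "((\<lambda>r. quad c b (k * r) powr s * r powr (- 2 * s)) has_real_derivative
      (s * A powr (s - 1) * (- 2 * b * k - 2 * k * (k * r))) * r powr (- 2 * s)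
      + (- 2 * s * r powr (- 2 * s - 1)) * A powr s) (at r)"
    using DERIV_mult[OF DERIV_chain2[OF has_real_derivative_powr[OF True, of s] inner]
        has_real_derivative_powr[OF r, of "- 2 * s"]]
    by (simp add: A_def)
  moreover have "(s * A powr (s - 1) * (- 2 * b * k - 2 * k * (k * r))) * r powr (- 2 * s)
      + (- 2 * s * r powr (- 2 * s - 1)) * A powr s
     = - 2 * s * ((A powr s + A powr (s - 1) * (b * (k * r) + (k * r)\<^sup>2)) * r powr (- 1 - 2 * s))"
  proof -
    have "r powr (- 2 * s) = r * r powr (- 1 - 2 * s)"
      using powr_add[of r 1 "- 1 - 2 * s"] r by simp
    moreover have eq: "- 2 * s - 1 = - 1 - 2 * s" by simp
    ultimately show ?thesis
      unfolding eq by (simp add: algebra_simps power2_eq_square)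
  qed
  ultimately have "((\<lambda>r. quad c b (k * r) powr s * r powr (- 2 * s)) has_real_derivative
     - 2 * s * ((A powr s + A powr (s - 1) * (b * (k * r) + (k * r)\<^sup>2)) * r powr (- 1 - 2 * s))) (at r)"
    by simp
  then have "((\<lambda>r. real_bump 0 c b s (k * r) * r powr (- 2 * s)) has_real_derivative
     - 2 * s * ((A powr s + A powr (s - 1) * (b * (k * r) + (k * r)\<^sup>2)) * r powr (- 1 - 2 * s))) (at r)"
    using \<open>open {r. quad c b (k * r) > 0}\<close>
    by (rule has_field_derivative_transform_within_open) (use True in \<open>auto simp: real_bump_def\<close>)
  then show ?thesis using A by (simp add: real_bump_def quad_euler_def A_def)
next
  case False
  then have neg: "quad c b (k * r) < 0" using nz by simp
  have "open {r. quad c b (k * r) < 0}"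
    unfolding quad_def by (intro open_Collect_less continuous_intros)
  with DERIV_const[of 0 "at r"]
  have "((\<lambda>r. real_bump 0 c b s (k * r) * r powr (- 2 * s)) has_real_derivative 0) (at r)"
    by (rule has_field_derivative_transform_within_open) (use neg in \<open>auto simp: real_bump_def\<close>)
  then show ?thesis using neg by (simp add: real_bump_def quad_euler_def)
qed

lemma finite_quad_zeros:
  assumes "c > 0" shows "finite {r. \<exists>k\<in>{- int m..int m}. quad c b (of_int k * r) = 0}"
proof (rule finite_subset)
  define w where "w = sqrt (c + b\<^sup>2)"
  show "{r. \<exists>k\<in>{- int m..int m}. quad c b (of_int k * r) = 0}
      \<subseteq> (\<lambda>(k, u). u / of_int k) ` ({- int m..int m} \<times> {- b + w, - b - w})"
  proof safe
    fix r k assume k: "k \<in> {- int m..int m}" and zero: "quad c b (of_int k * r) = 0"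
    have "k \<noteq> 0" using zero assms by (auto simp: quad_def)
    have "(of_int k * r + b)\<^sup>2 = c + b\<^sup>2"
      using zero by (simp add: quad_def power2_eq_square algebra_simps)
    also have "\<dots> = w\<^sup>2" using assms by (simp add: w_def)
    finally have "of_int k * r = - b + w \<or> of_int k * r = - b - w"
      by (auto simp: power2_eq_iff)
    then show "r \<in> (\<lambda>(k, u). u / of_int k) ` ({- int m..int m} \<times> {- b + w, - b - w})"
      using k \<open>k \<noteq> 0\<close> by (intro image_eqI[of _ _ "(k, of_int k * r)"]) auto
  qed
qed auto

text \<open>The boundary terms vanish: near \<open>0\<close> the central difference has order \<open>2 * m > 2 * s\<close>, and near
  infinity it is bounded.\<close>

lemma real_fractional_integral_0_by_parts:
  assumes c: "0 < c" "c \<le> 1" and b: "\<bar>b\<bar> \<le> 1" and s: "0 < s" "s < real m"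
    and int: "set_integrable lborel {0<..} (\<lambda>r. central_diff m (quad_euler c b s) r * r powr (- 1 - 2 * s))"
  shows "real_fractional_integral m 0 c b s
    = - (LINT r:{0<..}|lborel. central_diff m (quad_euler c b s) r * r powr (- 1 - 2 * s))"
proof -
  define \<Phi> where "\<Phi> r = central_diff m (real_bump 0 c b s) r * r powr (- 2 * s)" for r
  define \<phi> where "\<phi> r = - 2 * s * (central_diff m (real_bump 0 c b s) r * r powr (- 1 - 2 * s)
      + central_diff m (quad_euler c b s) r * r powr (- 1 - 2 * s))" for r
  define A where "A i = {1 / real (Suc i)..real (Suc i)}" for i
  note int0 = real_integrand_integrable[OF c b _ s, of 0, simplified]
  have \<phi>_int: "set_integrable lborel {0<..} \<phi>"
    unfolding \<phi>_def [abs_def] by (intro set_integrable_mult_right set_integral_add int0 int)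
  have A_Un: "(\<Union>i. A i) = {0<..}"
  proof (intro equalityI subsetI)
    fix r :: real assume "r \<in> (\<Union>i. A i)"
    then obtain i where "1 / real (Suc i) \<le> r" by (auto simp: A_def)
    then show "r \<in> {0<..}" by (auto intro: less_le_trans[of 0 "1 / real (Suc i)"])
  next
    fix r :: real assume "r \<in> {0<..}"
    then have r: "r > 0" by simp
    obtain i where i: "max r (1 / r) \<le> real i" using real_arch_simple by blast
    have "1 / r \<le> real (Suc i)" "r \<le> real (Suc i)" using i by auto
    then have "r \<in> A i" using r by (auto simp: A_def field_simps)
    then show "r \<in> (\<Union>i. A i)" by blast
  qed
  have A_meas: "A i \<in> sets lborel" for i by (simp add: A_def)
  have "incseq A"
    by (rule incseq_SucI) (auto simp: A_def field_simps)
  moreover have "set_integrable lborel (\<Union>i. A i) \<phi>"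
    unfolding A_Un by (rule \<phi>_int)
  ultimately have "(\<lambda>i. LINT r:A i|lborel. \<phi> r) \<longlonglongrightarrow> (LINT r:(\<Union>i. A i)|lborel. \<phi> r)"
    by (intro set_integral_cont_up A_meas)
  then have lim: "(\<lambda>i. LINT r:A i|lborel. \<phi> r) \<longlonglongrightarrow> (LINT r:{0<..}|lborel. \<phi> r)"
    by (simp only: A_Un)
  \<comment> \<open>the finitely many radii at which some shift meets the boundary of the support\<close>
  define Z where "Z = {r. \<exists>k\<in>{- int m..int m}. quad c b (of_int k * r) = 0}"
  have deriv: "(\<Phi> has_real_derivative \<phi> r) (at r)" if "r > 0" "r \<notin> Z" for r
  proof -
    have "((\<lambda>r. \<Sum>k = - int m..int m. diff_weight m k *
          (real_bump 0 c b s (of_int k * r) * r powr (- 2 * s))) has_real_derivative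
        (\<Sum>k = - int m..int m. diff_weight m k * (- 2 * s * ((real_bump 0 c b s (of_int k * r)
           + quad_euler c b s (of_int k * r)) * r powr (- 1 - 2 * s))))) (at r)"
      using that by (intro DERIV_sum DERIV_cmult radial_derivative) (auto simp: Z_def)
    moreover have "\<Phi> = (\<lambda>r. \<Sum>k = - int m..int m. diff_weight m k *
          (real_bump 0 c b s (of_int k * r) * r powr (- 2 * s)))"
      by (simp add: \<Phi>_def central_diff_def sum_distrib_right mult.assoc fun_eq_iff)
    moreover have "(\<Sum>k = - int m..int m. diff_weight m k * (- 2 * s * ((real_bump 0 c b s (of_int k * r)
           + quad_euler c b s (of_int k * r)) * r powr (- 1 - 2 * s)))) = \<phi> r"
      unfolding \<phi>_def central_diff_def distrib_right [symmetric] sum.distrib [symmetric]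
        sum_distrib_right sum_distrib_left
      by (intro sum.cong refl) (simp add: algebra_simps)
    ultimately show ?thesis by simp
  qed
  have cont: "continuous_on {0<..} \<Phi>"
    unfolding \<Phi>_def [abs_def] central_diff_def real_bump_def quad_def
    by (intro continuous_intros continuous_on_powr') (use s in auto)
  have step: "(LINT r:A i|lborel. \<phi> r) = \<Phi> (real (Suc i)) - \<Phi> (1 / real (Suc i))" for i
  proof -
    have "(\<phi> has_integral (\<Phi> (real (Suc i)) - \<Phi> (1 / real (Suc i)))) (A i)"
      unfolding A_def
    proof (rule fundamental_theorem_of_calculus_interior_strong)
      show "finite Z" unfolding Z_def using c(1) by (rule finite_quad_zeros)
      show "1 / real (Suc i) \<le> real (Suc i)" by (simp add: field_simps)
      have pos: "r > 0" if "1 / real (Suc i) \<le> r" for r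
        using that by (auto intro: less_le_trans[of 0 "1 / real (Suc i)"])
      show "(\<Phi> has_vector_derivative \<phi> r) (at r)" if "r \<in> {1 / real (Suc i)<..<real (Suc i)} - Z" for r
        using deriv[of r] pos[of r] that by (simp add: has_real_derivative_iff_has_vector_derivative)
      show "continuous_on {1 / real (Suc i)..real (Suc i)} \<Phi>"
        by (rule continuous_on_subset[OF cont]) (use pos in auto)
    qed
    moreover have "set_integrable lborel (A i) \<phi>"
      using A_Un by (intro set_integrable_subset[OF \<phi>_int]) (auto simp: A_def)
    ultimately show ?thesis
      using set_borel_integral_eq_integral(2) integral_unique by metis
  qed
  have norm_cd: "\<bar>central_diff m (real_bump 0 c b s) r\<bar> = norm (central_diff m (bump 0 c b (of_real s)) r)" for r
  proof -
    have "central_diff m (bump 0 c b (of_real s)) r = of_real (central_diff m (real_bump 0 c b s) r)"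
      by (simp add: central_diff_def bump_of_real scaleR_conv_of_real)
    then show ?thesis by simp
  qed
  have at_infinity: "(\<lambda>i. \<Phi> (real (Suc i))) \<longlonglongrightarrow> 0"
  proof (rule Lim_null_comparison)
    show "eventually (\<lambda>i. norm (\<Phi> (real (Suc i))) \<le> 4 ^ m * (9 * 2 ^ m) * real (Suc i) powr (- 2 * s)) sequentially"
    proof (intro always_eventually allI)
      fix i
      have "norm (central_diff m (bump 0 c b (of_real s)) (real (Suc i)))
          \<le> (\<Sum>k = - int m..int m. \<bar>diff_weight m k\<bar> * (9 * 2 ^ m))"
        unfolding central_diff_def using bump_bound[OF c b, of 0 "of_real s"] s
        by (intro order.trans[OF norm_sum] sum_mono) (auto intro!: mult_left_mono)
      also have "\<dots> = 4 ^ m * (9 * 2 ^ m)"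
        by (simp add: sum_abs_diff_weight flip: sum_distrib_right)
      finally show "norm (\<Phi> (real (Suc i))) \<le> 4 ^ m * (9 * 2 ^ m) * real (Suc i) powr (- 2 * s)"
        unfolding \<Phi>_def real_norm_def abs_mult norm_cd by (intro mult_mono) auto
    qed
    show "(\<lambda>i. 4 ^ m * (9 * 2 ^ m) * real (Suc i) powr (- 2 * s)) \<longlonglongrightarrow> 0"
      using s by (intro tendsto_mult_right_zero tendsto_neg_powr
          filterlim_compose[OF filterlim_real_sequentially filterlim_Suc]) auto
  qed
  have at_zero: "(\<lambda>i. \<Phi> (1 / real (Suc i))) \<longlonglongrightarrow> 0"
  proof (rule Lim_null_comparison)
    define C where "C = 2 * 4 ^ m * exp ((real m + 1) * (\<bar>ln (c / 2)\<bar> + ln 2 + pi)) * (real m / (c / 12)) ^ (2 * m)"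
    have "(\<lambda>i. real m * (1 / real (Suc i))) \<longlonglongrightarrow> real m * 0"
      by (intro tendsto_mult tendsto_const LIMSEQ_Suc) (rule lim_1_over_n)
    then have "eventually (\<lambda>i. real m * (1 / real (Suc i)) < c / 24) sequentially"
      using c by (intro order_tendstoD) auto
    then show "eventually (\<lambda>i. norm (\<Phi> (1 / real (Suc i))) \<le> C * (1 / real (Suc i)) powr (2 * real m - 2 * s)) sequentially"
    proof eventually_elim
      case (elim i)
      define r where "r = 1 / real (Suc i)"
      have r: "r > 0" by (simp add: r_def)
      have small: "real m * r \<le> c / 24" using elim by (simp only: r_def)
      have "norm (central_diff m (bump 0 c b (of_real s)) r) \<le> C * r ^ (2 * m)"
        using central_diff_bump_bound_near_0[OF c b, of "of_real s" m r 0] small r s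
        by (simp add: C_def r_def [symmetric] power_divide power_mult_distrib mult_ac)
      then have "norm (\<Phi> r) \<le> C * r ^ (2 * m) * r powr (- 2 * s)"
        unfolding \<Phi>_def real_norm_def abs_mult norm_cd by (intro mult_mono) (auto simp: C_def)
      also have "C * r ^ (2 * m) * r powr (- 2 * s) = C * r powr (2 * real m - 2 * s)"
        using r by (simp add: mult.assoc flip: powr_realpow powr_add)
      finally show ?case by (simp only: r_def)
    qed
    have "(\<lambda>i. 1 / real (Suc i)) \<longlonglongrightarrow> 0"
      by (intro LIMSEQ_Suc lim_1_over_n)
    then show "(\<lambda>i. C * (1 / real (Suc i)) powr (2 * real m - 2 * s)) \<longlonglongrightarrow> 0"
      using s by (intro tendsto_mult_right_zero tendsto_zero_powrI[where b = "2 * real m - 2 * s"]) auto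
  qed
  have "(\<lambda>i. LINT r:A i|lborel. \<phi> r) \<longlonglongrightarrow> 0 - 0"
    unfolding step by (intro tendsto_diff at_infinity at_zero)
  with lim have "(LINT r:{0<..}|lborel. \<phi> r) = 0"
    using LIMSEQ_unique by fastforce
  moreover have "(LINT r:{0<..}|lborel. \<phi> r) = - 2 * s * (real_fractional_integral m 0 c b s
      + (LINT r:{0<..}|lborel. central_diff m (quad_euler c b s) r * r powr (- 1 - 2 * s)))"
    unfolding \<phi>_def real_fractional_integral_def
    by (simp only: set_integral_mult_right set_integral_add(2)[OF int0 int])
  ultimately show ?thesis using s by simp
qed

lemma real_fractional_integral_0:
  assumes c: "0 < c" "c \<le> 1" and b: "\<bar>b\<bar> \<le> 1" and s: "0 < s" "s < 1 / 2" and m: "m \<ge> 1"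
  shows "real_fractional_integral m 0 c b s = - symbol_sum m s * Beta s (1 - s)"
proof -
  have eq: "quad_euler c b' s u * u powr (- 1 - 2 * s)
    = b' * (max 0 (quad c b' u) powr (s - 1) * u powr (real 0 - 2 - 2 * (s - 1)))
      + max 0 (quad c b' u) powr (s - 1) * u powr (real 1 - 2 - 2 * (s - 1))"
    if "u \<in> {0<..}" for u b'
  proof -
    have "u powr (real 0 - 2 - 2 * (s - 1)) = u * u powr (- 1 - 2 * s)"
      "u powr (real 1 - 2 - 2 * (s - 1)) = u\<^sup>2 * u powr (- 1 - 2 * s)"
      using that powr_add[of u 1 "- 1 - 2 * s"] powr_add[of u 2 "- 1 - 2 * s"] by (simp_all add: algebra_simps)
    then show ?thesis by (simp add: quad_euler_def algebra_simps)
  qed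
  have b': "\<bar>- b\<bar> \<le> 1" using b by simp
  have int: "set_integrable lborel {0<..} (\<lambda>u. b' * (max 0 (quad c b' u) powr (s - 1) * u powr (real 0 - 2 - 2 * (s - 1))))"
    "set_integrable lborel {0<..} (\<lambda>u. max 0 (quad c b' u) powr (s - 1) * u powr (real 1 - 2 - 2 * (s - 1)))"
    if "\<bar>b'\<bar> \<le> 1" for b'
    by (intro set_integrable_mult_right quad_moment_integrable c that; use s in simp)+
  have int_euler: "set_integrable lborel {0<..} (\<lambda>u. quad_euler c b' s u * u powr (- 1 - 2 * s))"
    if "\<bar>b'\<bar> \<le> 1" for b'
    using set_integral_add(1)[OF int(1)[OF that] int(2)[OF that]]
    by (rule set_integrable_congI) (rule eq [symmetric])
  have val: "(LINT u:{0<..}|lborel. quad_euler c b' s u * u powr (- 1 - 2 * s))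
      = b' * quad_moment c b' (s - 1) 0 + quad_moment c b' (s - 1) 1" if "\<bar>b'\<bar> \<le> 1" for b'
  proof -
    have "(LINT u:{0<..}|lborel. quad_euler c b' s u * u powr (- 1 - 2 * s))
      = (LINT u:{0<..}|lborel. b' * (max 0 (quad c b' u) powr (s - 1) * u powr (real 0 - 2 - 2 * (s - 1)))
         + max 0 (quad c b' u) powr (s - 1) * u powr (real 1 - 2 - 2 * (s - 1)))"
      by (intro set_lebesgue_integral_cong allI impI eq) auto
    then show ?thesis
      by (simp only: set_integral_add(2)[OF int(1)[OF that] int(2)[OF that]] set_integral_mult_right quad_moment_def)
  qed
  have minus: "quad_euler c b s (- u) = quad_euler c (- b) s u" for u
    by (simp add: quad_euler_def quad_def)
  have zero: "quad_euler c b s 0 = 0" by (simp add: quad_euler_def)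
  note vc = central_diff_integral_vanishing_centre[of "quad_euler c b s" s m, unfolded minus,
      OF zero int_euler[OF b] int_euler[OF b']]
  have "real_fractional_integral m 0 c b s
      = - (LINT r:{0<..}|lborel. central_diff m (quad_euler c b s) r * r powr (- 1 - 2 * s))"
    using m s by (intro real_fractional_integral_0_by_parts[OF c b]) (auto intro: vc(1))
  also have "\<dots> = - symbol_sum m s * Beta s (1 - s)"
    unfolding vc(2) val[OF b] val[OF b'] using quad_moment_values(1,2)[OF c b s] by simp
  finally show ?thesis .
qed

section \<open>Analytic continuation in the order\<close>

text \<open>The value at \<open>u = 0\<close> of the one-dimensional operator on \<open>u ^ p * Q\<^sub>+ powr s\<close>, up to the sign
  and the normalization in \<open>normalized_fractional_integral\<close>.\<close>

definition core_poly :: "nat \<Rightarrow> real \<Rightarrow> real \<Rightarrow> 'a::real_normed_field \<Rightarrow> 'a" where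
  "core_poly p c b s = (if p = 0 then - 1 else if p = 1 then - 2 * of_real b * s
     else s * (of_real c + 2 * (of_real b)\<^sup>2 * (1 - s)))"

definition symbol_sum_complex :: "nat \<Rightarrow> complex \<Rightarrow> complex" where
  "symbol_sum_complex m s = (\<Sum>k = 1..m. of_real (diff_weight m (int k)) * of_real (real k) powr (2 * s))"

lemma symbol_sum_complex_of_real: "symbol_sum_complex m (of_real s) = of_real (symbol_sum m s)"
proof -
  have "complex_of_real (real k) powr (2 * of_real s) = of_real (real k powr (2 * s))" for k
    using powr_of_real[of "real k" "2 * s"] by simp
  then show ?thesis
    by (simp add: symbol_sum_complex_def symbol_sum_def)
qed

lemma core_poly_of_real: "core_poly p c b (of_real s :: complex) = of_real (core_poly p c b s)"
  by (simp add: core_poly_def)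

lemma Gamma_reflection_real: "Gamma s * Gamma (1 - s) = pi / sin (pi * s)" for s :: real
proof -
  have "complex_of_real (Gamma s * Gamma (1 - s)) = Gamma (of_real s) * Gamma (1 - of_real s)"
    using Gamma_complex_of_real[of "1 - s"] by (simp add: Gamma_complex_of_real)
  also have "\<dots> = of_real pi / sin (of_real pi * of_real s)"
    by (rule Gamma_reflection_complex)
  also have "\<dots> = complex_of_real (pi / sin (pi * s))"
    by (simp add: sin_of_real flip: of_real_mult)
  finally show ?thesis by (simp only: of_real_eq_iff)
qed

lemma sin_fractional_integral_base:
  assumes c: "0 < c" "c \<le> 1" and b: "\<bar>b\<bar> \<le> 1" and p: "p \<le> 2" and s: "0 < s" "s < 1 / 2" and m: "m \<ge> 1"
  shows "sin (pi * s) * real_fractional_integral m p c b s = pi * symbol_sum m s * core_poly p c b s"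
proof -
  have sin: "sin (pi * s) > 0"
    using s by (intro sin_gt_zero) auto
  have refl: "Gamma s * Gamma (1 - s) = pi / sin (pi * s)" by (rule Gamma_reflection_real)
  have pos: "s \<notin> \<int>\<^sub>\<le>\<^sub>0" "1 - s \<notin> \<int>\<^sub>\<le>\<^sub>0"
    using s by (auto elim!: nonpos_Ints_cases)
  have G: "Gamma (s + 1) = s * Gamma s" "Gamma (2 - s) = (1 - s) * Gamma (1 - s)"
    using Gamma_plus1[of s] Gamma_plus1[of "1 - s"] pos by (simp_all add: add.commute)
  have G23: "Gamma (2::real) = 1" "Gamma (3::real) = 2"
    using Gamma_fact[of 1, where ?'a = real] Gamma_fact[of 2, where ?'a = real] by (simp_all add: eval_nat_numeral)
  have B: "Beta s (1 - s) = pi / sin (pi * s)"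
    "Beta (s + 1) (1 - s) = s * (pi / sin (pi * s))"
    "Beta (s + 1) (2 - s) = s * (1 - s) * (pi / sin (pi * s)) / 2"
    using G23 unfolding Beta_def by (simp_all add: G refl[symmetric])
  consider "p = 0" | "p = 1" | "p = 2" using p by linarith
  then show ?thesis
  proof cases
    case 1
    then show ?thesis
      using real_fractional_integral_0[OF c b s m] sin by (simp add: B core_poly_def)
  next
    case 2
    then show ?thesis
      using real_fractional_integral_positive_power[OF c b, of 1 s m] quad_moment_values(3)[OF c b s] s sin
      by (simp add: B core_poly_def numeral_2_eq_2)
  next
    case 3
    then have "real_fractional_integral m p c b s
        = symbol_sum m s * (c * Beta (s + 1) (1 - s) + 4 * b\<^sup>2 * Beta (s + 1) (2 - s))"
      using real_fractional_integral_positive_power[OF c b, of 2 s m] quad_moment_values(4)[OF c b s] s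
      by (simp add: numeral_3_eq_3 numeral_2_eq_2)
    also have "\<dots> = symbol_sum m s * (s * (pi / sin (pi * s)) * (c + 2 * b\<^sup>2 * (1 - s)))"
    proof -
      define X where "X = pi / sin (pi * s)"
      show ?thesis unfolding B X_def [symmetric] by (simp add: field_simps)
    qed
    finally show ?thesis
      using 3 sin by (simp add: core_poly_def)
  qed
qed

text \<open>Multiplication by the sine removes the poles of \<open>Gamma s * Gamma (1 - s)\<close> at the integers.\<close>

definition continuation_defect :: "nat \<Rightarrow> nat \<Rightarrow> real \<Rightarrow> real \<Rightarrow> complex \<Rightarrow> complex" where
  "continuation_defect m p c b s = sin (of_real pi * s) * fractional_integral m p c b s
     - of_real pi * symbol_sum_complex m s * core_poly p c b s"

lemma symbol_sum_complex_holomorphic: "symbol_sum_complex m holomorphic_on A"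
  unfolding symbol_sum_complex_def [abs_def] by (intro holomorphic_intros)

lemma core_poly_holomorphic: "core_poly p c b holomorphic_on A"
  unfolding core_poly_def [abs_def]
  by (cases "p = 0"; cases "p = 1") (auto intro!: holomorphic_intros)

lemma continuation_defect_zero:
  assumes c: "0 < c" "c \<le> 1" and b: "\<bar>b\<bar> \<le> 1" and p: "p \<le> 2" and s: "s \<in> strip m"
  shows "continuation_defect m p c b s = 0"
proof -
  have "0 < real m" using s by (auto simp: strip_def)
  then have m: "m \<ge> 1" by simp
  have hol: "continuation_defect m p c b holomorphic_on strip m"
    unfolding continuation_defect_def [abs_def]
    by (intro holomorphic_intros fractional_integral_holomorphic[OF c b p]
          symbol_sum_complex_holomorphic core_poly_holomorphic)
  have sub: "complex_of_real ` {0<..<1 / 2} \<subseteq> strip m" and mem: "complex_of_real (1 / 4) \<in> strip m"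
    using m by (auto simp: strip_def)
  \<comment> \<open>any point of the open interval would do\<close>
  have lim: "complex_of_real (1 / 4) islimpt complex_of_real ` {0<..<1 / 2}"
    unfolding islimpt_approachable
  proof (intro allI impI)
    fix e :: real assume e: "e > 0"
    define x where "x = 1 / 4 + min (e / 2) (1 / 8)"
    have "x \<in> {0<..<1 / 2}" "x \<noteq> 1 / 4" "\<bar>x - 1 / 4\<bar> < e"
      using e by (auto simp: x_def)
    moreover have "dist (complex_of_real x) (of_real (1 / 4)) = \<bar>x - 1 / 4\<bar>"
      by (simp only: dist_norm norm_of_real flip: of_real_diff)
    ultimately show "\<exists>x'\<in>of_real ` {0<..<1 / 2}. x' \<noteq> complex_of_real (1 / 4) \<and> dist x' (of_real (1 / 4)) < e"
      by (intro bexI[of _ "of_real x"] conjI imageI) (simp_all only: of_real_eq_iff, simp_all)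
  qed
  have zero: "continuation_defect m p c b z = 0" if "z \<in> complex_of_real ` {0<..<1 / 2}" for z
  proof -
    obtain t where t: "z = of_real t" "0 < t" "t < 1 / 2" using \<open>z \<in> _\<close> by auto
    have "continuation_defect m p c b z
        = of_real (sin (pi * t) * real_fractional_integral m p c b t - pi * symbol_sum m t * core_poly p c b t)"
      by (simp add: continuation_defect_def t fractional_integral_of_real symbol_sum_complex_of_real
            core_poly_of_real sin_of_real flip: of_real_mult)
    then show ?thesis
      using sin_fractional_integral_base[OF c b p t(2,3) m] by simp
  qed
  show ?thesis
    by (rule analytic_continuation[OF hol open_strip connected_strip sub mem lim zero s])
qed

lemma of_real_in_strip: "0 < s \<Longrightarrow> s < real m \<Longrightarrow> of_real s \<in> strip m"
  by (simp add: strip_def)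

lemma sin_fractional_integral:
  assumes c: "0 < c" "c \<le> 1" and b: "\<bar>b\<bar> \<le> 1" and p: "p \<le> 2" and s: "0 < s" "s < real m"
  shows "sin (pi * s) * real_fractional_integral m p c b s = pi * symbol_sum m s * core_poly p c b s"
proof -
  have "complex_of_real (sin (pi * s) * real_fractional_integral m p c b s - pi * symbol_sum m s * core_poly p c b s)
      = continuation_defect m p c b (of_real s)"
    by (simp add: continuation_defect_def fractional_integral_of_real symbol_sum_complex_of_real
            core_poly_of_real sin_of_real flip: of_real_mult)
  also have "\<dots> = 0"
    by (rule continuation_defect_zero[OF c b p of_real_in_strip[OF s]])
  finally show ?thesis by (simp only: of_real_eq_0_iff)
qed

lemma symbol_sum_complex_has_derivative:
  "(symbol_sum_complex m has_field_derivative of_real (symbol_sum_deriv m s)) (at (of_real s))"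
proof -
  have "((\<lambda>z. complex_of_real (diff_weight m (int k)) * of_real (real k) powr (2 * z)) has_field_derivative
      of_real (diff_weight m (int k) * real k powr (2 * s) * (2 * ln (real k)))) (at (of_real s))"
    if "k \<in> {1..m}" for k
  proof -
    have k: "real k > 0" using that by simp
    have "complex_of_real (real k) powr (2 * of_real s) = of_real (real k powr (2 * s))"
      using powr_of_real[of "real k" "2 * s"] by simp
    moreover have "Ln (complex_of_real (real k)) = of_real (ln (real k))"
      using k by (rule Ln_of_real)
    moreover have "((\<lambda>z. complex_of_real (real k) powr (2 * z)) has_field_derivative
        (Ln (of_real (real k)) * of_real (real k) powr (2 * of_real s)) * 2) (at (of_real s))"
      using k by (intro DERIV_chain2[OF has_field_derivative_powr_right])
        (auto intro!: derivative_eq_intros)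
    ultimately have "((\<lambda>z. complex_of_real (real k) powr (2 * z)) has_field_derivative
        of_real (real k powr (2 * s) * (2 * ln (real k)))) (at (of_real s))"
      by (simp add: mult_ac del: of_real_of_nat_eq)
    from DERIV_cmult[OF this, of "of_real (diff_weight m (int k))"] show ?thesis
      by (simp add: mult_ac del: of_real_of_nat_eq)
  qed
  then show ?thesis
    unfolding symbol_sum_complex_def [abs_def] symbol_sum_deriv_def of_real_sum
    by (intro DERIV_sum) auto
qed

text \<open>At an integer both \<open>sin (pi * s)\<close> and \<open>symbol_sum m s\<close> vanish, so the value comes from the
  derivative of the identity.\<close>

lemma fractional_integral_nat:
  assumes c: "0 < c" "c \<le> 1" and b: "\<bar>b\<bar> \<le> 1" and p: "p \<le> 2" and N: "0 < N" "N < m"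
  shows "real_fractional_integral m p c b (real N) = (- 1) ^ N * symbol_sum_deriv m (real N) * core_poly p c b (real N)"
proof -
  define z where "z = complex_of_real (real N)"
  have z: "z \<in> strip m" unfolding z_def using N by (intro of_real_in_strip) auto
  obtain E' where E': "(fractional_integral m p c b has_field_derivative E') (at z)"
    using fractional_integral_holomorphic[OF c b p] z open_strip
    by (metis holomorphic_on_open)
  obtain P' where P': "(core_poly p c b has_field_derivative P') (at z)"
    using core_poly_holomorphic[of p c b UNIV] by (metis holomorphic_on_open open_UNIV UNIV_I)
  note S' = symbol_sum_complex_has_derivative[of m "real N", folded z_def]
  have sin: "((\<lambda>s. sin (of_real pi * s)) has_field_derivative cos (of_real pi * z) * of_real pi) (at z)"
    by (auto intro!: derivative_eq_intros)
  have "((continuation_defect m p c b) has_field_derivative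
      (cos (of_real pi * z) * of_real pi) * fractional_integral m p c b z + E' * sin (of_real pi * z)
     - ((of_real pi * of_real (symbol_sum_deriv m (real N))) * core_poly p c b z
       + P' * (of_real pi * symbol_sum_complex m z))) (at z)"
    unfolding continuation_defect_def [abs_def]
    by (intro DERIV_diff DERIV_mult sin E' P' DERIV_cmult S')
  moreover have "((continuation_defect m p c b) has_field_derivative 0) (at z)"
    using DERIV_const[of 0 "at z"] open_strip z
    by (rule has_field_derivative_transform_within_open)
       (use continuation_defect_zero[OF c b p] in auto)
  ultimately have "(cos (of_real pi * z) * of_real pi) * fractional_integral m p c b z + E' * sin (of_real pi * z)
     - ((of_real pi * of_real (symbol_sum_deriv m (real N))) * core_poly p c b z
       + P' * (of_real pi * symbol_sum_complex m z)) = 0"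
    by (rule DERIV_unique)
  moreover have "sin (of_real pi * z) = 0" "cos (of_real pi * z) = (-1) ^ N"
  proof -
    have eq: "of_real pi * z = complex_of_real (real N * pi)" by (simp add: z_def)
    show "sin (of_real pi * z) = 0" unfolding eq sin_of_real by simp
    show "cos (of_real pi * z) = (-1) ^ N" unfolding eq cos_of_real by simp
  qed
  moreover have "symbol_sum_complex m z = 0"
    unfolding z_def symbol_sum_complex_of_real using symbol_sum_nat_zero[OF N] by simp
  ultimately have "of_real pi * ((-1) ^ N * fractional_integral m p c b z
      - of_real (symbol_sum_deriv m (real N)) * core_poly p c b z) = 0"
    by (simp add: algebra_simps)
  then have "(-1) ^ N * fractional_integral m p c b z
      = of_real (symbol_sum_deriv m (real N)) * core_poly p c b z"
    by simp
  then have "complex_of_real ((-1) ^ N * real_fractional_integral m p c b (real N))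
      = of_real (symbol_sum_deriv m (real N) * core_poly p c b (real N))"
    by (simp add: z_def fractional_integral_of_real core_poly_of_real del: of_real_of_nat_eq)
  then have eq: "(-1) ^ N * real_fractional_integral m p c b (real N)
      = symbol_sum_deriv m (real N) * core_poly p c b (real N)"
    by (simp only: of_real_eq_iff)
  have "(-1) ^ N * ((-1) ^ N * real_fractional_integral m p c b (real N)) = real_fractional_integral m p c b (real N)"
    by (simp flip: mult.assoc power_mult_distrib)
  then show ?thesis unfolding eq by (simp add: mult_ac)
qed

lemma normalized_fractional_integral:
  assumes c: "0 < c" "c \<le> 1" and b: "\<bar>b\<bar> \<le> 1" and p: "p \<le> 2" and s: "0 < s" "s < real m"
  shows "c_const n m s / 2 * real_fractional_integral m p c b s
     = - (k_const n s * Gamma (1 + s)) * core_poly p c b s"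
proof -
  define G where "G = Gamma (real n / 2 + s)"
  define P where "P = core_poly p c b s"
  have pw: "4 powr s = 2 * 2 powr (2 * s - 1)"
  proof -
    have "(4::real) powr s = 2 powr (2 * s)" using powr_powr[of 2 2 s] by simp
    then show ?thesis by (simp add: powr_diff)
  qed
  show ?thesis
  proof (cases "s \<in> \<nat>")
    case False
    have sin: "sin (pi * s) \<noteq> 0"
    proof
      assume "sin (pi * s) = 0"
      then obtain i :: int where "pi * s = of_int i * pi" using sin_zero_iff_int2 by blast
      then have i: "s = of_int i" by simp
      then have "s = real (nat i)" using s by simp
      then show False using False by simp
    qed
    have S: "symbol_sum m s \<noteq> 0" by (rule symbol_sum_nonzero[OF s False])
    have I: "real_fractional_integral m p c b s = pi * symbol_sum m s * P / sin (pi * s)"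
      using sin_fractional_integral[OF c b p s] sin by (simp add: P_def field_simps)
    have Gn: "Gamma (- s) \<noteq> 0"
    proof
      assume "Gamma (- s) = 0"
      then have "- s \<in> \<int>\<^sub>\<le>\<^sub>0" by (simp only: Gamma_eq_zero_iff)
      then obtain n where "- s = - real n" by (rule nonpos_Ints_cases')
      then have "s = real n" by simp
      then show False using False by simp
    qed
    have refl: "Gamma (- s) * Gamma (1 + s) = - pi / sin (pi * s)"
      using Gamma_reflection_real[of "- s"] by simp
    have sum: "(\<Sum>k = 1..m. (- 1) ^ k * real ((2 * m) choose (m - k)) * real k powr (2 * s)) = symbol_sum m s"
      unfolding symbol_sum_def diff_weight_def by (intro sum.cong refl) (auto simp: nat_diff_distrib)
    have "c_const n m s / 2 * real_fractional_integral m p c b s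
       = 4 powr s * G / (2 * pi powr (real n / 2)) * (pi / sin (pi * s) / Gamma (- s)) * P"
      using False S unfolding c_const_def sum I G_def by (simp add: field_simps)
    also have "pi / sin (pi * s) = - (Gamma (- s) * Gamma (1 + s))"
      unfolding refl by simp
    also have "- (Gamma (- s) * Gamma (1 + s)) / Gamma (- s) = - Gamma (1 + s)"
      using Gn by simp
    finally show ?thesis
      by (simp add: k_const_def G_def P_def pw)
  next
    case True
    then obtain N where N: "s = real N" by (auto elim: Nats_cases)
    have N': "0 < N" "N < m" using s by (auto simp: N)
    define S' where "S' = symbol_sum_deriv m (real N)"
    have S': "S' \<noteq> 0" unfolding S'_def by (rule symbol_sum_deriv_nonzero[OF N'])
    have I: "real_fractional_integral m p c b s = (- 1) ^ N * S' * P"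
      unfolding N P_def S'_def by (rule fractional_integral_nat[OF c b p N'])
    have "(\<Sum>k = 2..m. (- 1) powi (int k - \<lfloor>s\<rfloor> + 1) * real ((2 * m) choose (m - k)) * real k powr (2 * s) * ln (real k))
        = - ((- 1) ^ N * S' / 2)"
    proof -
      have "S' = (\<Sum>k = 2..m. diff_weight m (int k) * real k powr (2 * s) * (2 * ln (real k)))"
        unfolding S'_def symbol_sum_deriv_def N by (intro sum.mono_neutral_right) (auto simp: not_le less_Suc_eq)
      then have "- ((- 1) ^ N * S' / 2) = (\<Sum>k = 2..m. - ((- 1) ^ N * diff_weight m (int k) * real k powr (2 * s) * ln (real k)))"
        by (simp add: sum_distrib_left sum_divide_distrib sum_negf mult_ac)
      also have "\<dots> = (\<Sum>k = 2..m. (- 1) powi (int k - \<lfloor>s\<rfloor> + 1) * real ((2 * m) choose (m - k)) * real k powr (2 * s) * ln (real k))"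
      proof (intro sum.cong refl)
        fix k assume k: "k \<in> {2..m}"
        have "(- 1 :: real) powi (int k - \<lfloor>s\<rfloor> + 1) = (- 1) powi (int k) * (- 1) powi (- int N) * (- 1)"
          unfolding N by (simp add: power_int_add power_int_diff power_int_minus divide_inverse)
        also have "(- 1 :: real) powi (- int N) = (- 1) ^ N"
          by (simp add: power_int_minus uminus_power_if)
        finally show "- ((- 1) ^ N * diff_weight m (int k) * real k powr (2 * s) * ln (real k))
          = (- 1) powi (int k - \<lfloor>s\<rfloor> + 1) * real ((2 * m) choose (m - k)) * real k powr (2 * s) * ln (real k)"
          using k by (simp add: diff_weight_def nat_diff_distrib)
      qed
      finally show ?thesis by simp
    qed
    then have "c_const n m s = 4 powr s * G * fact N / (2 * pi powr (real n / 2)) * inverse (- ((- 1) ^ N * S' / 2))"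
      using True unfolding c_const_def G_def by (simp add: N)
    then have "c_const n m s / 2 * real_fractional_integral m p c b s
      = - (4 powr s * G * fact N / (2 * pi powr (real n / 2))) * P"
      unfolding I using S' by (simp add: field_simps)
    also have "fact N = Gamma (1 + s)"
      by (simp add: N Gamma_fact)
    finally show ?thesis
      by (simp add: k_const_def G_def P_def pw)
  qed
qed

section \<open>Polar coordinates adapted to the ellipsoid\<close>

lemma measurable_vec_lambda [measurable (raw)]:
  fixes f :: "'a \<Rightarrow> 'n::finite \<Rightarrow> real"
  assumes "\<And>i. (\<lambda>x. f x i) \<in> borel_measurable M"
  shows "(\<lambda>x. \<chi> i. f x i) \<in> borel_measurable M"
proof (subst borel_measurable_euclidean_space, intro ballI)
  fix e :: "real ^ 'n" assume "e \<in> Basis"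
  then obtain i where "e = axis i 1" by (auto simp: Basis_vec_def)
  then show "(\<lambda>x. (\<chi> i. f x i) \<bullet> e) \<in> borel_measurable M"
    using assms by (simp add: inner_axis)
qed

lemma measurable_vec_nth [measurable (raw)]:
  fixes f :: "'a \<Rightarrow> real ^ 'n::finite"
  assumes "f \<in> borel_measurable M"
  shows "(\<lambda>x. f x $ i) \<in> borel_measurable M"
  by (rule measurable_compose[OF assms]) (intro borel_measurable_continuous_onI continuous_intros)

interpretation lborel_product: product_sigma_finite "\<lambda>_::'i. lborel :: real measure"
  by standard

lemma lborel_vec:
  "(lborel :: (real ^ 'n::finite) measure) = distr (PiM UNIV (\<lambda>_. lborel)) borel vec_lambda"
proof (rule lborel_eqI)
  fix l u :: "real ^ 'n"
  assume le: "\<And>b. b \<in> Basis \<Longrightarrow> l \<bullet> b \<le> u \<bullet> b"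
  have le': "l $ i \<le> u $ i" for i
    using le[of "axis i 1"] by (simp add: inner_axis axis_in_Basis_iff)
  have [measurable]: "vec_lambda \<in> measurable (PiM UNIV (\<lambda>_::'n. lborel :: real measure)) borel"
    by measurable
  have "emeasure (distr (PiM UNIV (\<lambda>_. lborel)) borel vec_lambda) (box l u)
     = emeasure (PiM UNIV (\<lambda>_::'n. lborel)) (PiE UNIV (\<lambda>i. {l $ i<..<u $ i}))"
    by (subst emeasure_distr) (auto simp: mem_box_cart space_PiM PiE_iff intro!: arg_cong2[where f = emeasure])
  also have "\<dots> = (\<Prod>i\<in>UNIV. emeasure lborel {l $ i<..<u $ i})"
    by (rule lborel_product.emeasure_PiM) auto
  also have "\<dots> = ennreal (\<Prod>i\<in>UNIV. u $ i - l $ i)"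
    using le' by (simp add: prod_ennreal)
  also have "(\<Prod>i\<in>UNIV. u $ i - l $ i) = (\<Prod>b\<in>Basis. (u - l) \<bullet> b)"
  proof -
    have Basis: "(Basis :: (real ^ 'n) set) = (\<lambda>i. axis i 1) ` UNIV"
      by (auto simp: Basis_vec_def)
    have inj: "inj (\<lambda>i::'n. axis i (1::real))"
      by (auto simp: inj_def axis_eq_axis)
    show ?thesis
      unfolding Basis prod.reindex[OF inj] by (simp add: inner_axis)
  qed
  finally show "emeasure (distr (PiM UNIV (\<lambda>_. lborel)) borel vec_lambda) (box l u)
      = (\<Prod>b\<in>Basis. (u - l) \<bullet> b)" .
qed simp

lemma nn_integral_lborel_vec_split:
  fixes F :: "real ^ 'n::finite \<Rightarrow> ennreal" and j :: 'n
  assumes [measurable]: "F \<in> borel_measurable borel"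
  shows "(\<integral>\<^sup>+x. F x \<partial>lborel)
    = (\<integral>\<^sup>+y. \<integral>\<^sup>+t. F (\<chi> i. if i = j then t else y i) \<partial>lborel \<partial>PiM (UNIV - {j}) (\<lambda>_. lborel))"
proof -
  have UNIV: "Set.insert j (UNIV - {j}) = UNIV" by auto
  have "(\<integral>\<^sup>+x. F x \<partial>lborel) = (\<integral>\<^sup>+y. F (vec_lambda y) \<partial>PiM UNIV (\<lambda>_. lborel))"
    by (subst lborel_vec, subst nn_integral_distr) auto
  also have "\<dots> = (\<integral>\<^sup>+y. F (vec_lambda y) \<partial>PiM (Set.insert j (UNIV - {j})) (\<lambda>_. lborel))"
    by (simp only: UNIV)
  also have "\<dots> = (\<integral>\<^sup>+y. \<integral>\<^sup>+t. F (vec_lambda (y(j := t))) \<partial>lborel \<partial>PiM (UNIV - {j}) (\<lambda>_. lborel))"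
    by (rule lborel_product.product_nn_integral_insert) (auto simp: UNIV)
  also have "\<dots> = (\<integral>\<^sup>+y. \<integral>\<^sup>+t. F (\<chi> i. if i = j then t else y i) \<partial>lborel \<partial>PiM (UNIV - {j}) (\<lambda>_. lborel))"
    by (simp add: fun_upd_def)
  finally show ?thesis .
qed

lemma nn_integral_PiM_lborel_scale:
  assumes "finite I" "r > 0" "F \<in> borel_measurable (PiM I (\<lambda>_. lborel))"
  shows "(\<integral>\<^sup>+y. F y \<partial>PiM I (\<lambda>_. lborel))
    = ennreal (r ^ card I) * (\<integral>\<^sup>+y. F (\<lambda>i\<in>I. r * y i) \<partial>PiM I (\<lambda>_. lborel :: real measure))"
  using assms(1,3)
proof (induction I arbitrary: F rule: finite_induct)
  case empty
  then show ?case by (simp add: PiM_empty nn_integral_count_space_finite restrict_def)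
next
  case (insert i I)
  note [measurable] = insert.prems
  have scale_meas: "(\<lambda>y. \<lambda>k\<in>Set.insert i I. r * y k) \<in> measurable (PiM (Set.insert i I) (\<lambda>_. lborel)) (PiM (Set.insert i I) (\<lambda>_. lborel))"
    by (intro measurable_restrict) measurable
  define H where "H x = (\<integral>\<^sup>+t. F (x(i := r * t)) \<partial>lborel)" for x
  have upd: "(\<lambda>(x, t). x(i := r * t)) \<in> measurable (PiM I (\<lambda>_. lborel) \<Otimes>\<^sub>M lborel) (PiM (Set.insert i I) (\<lambda>_. lborel :: real measure))"
    by measurable
  have H: "H \<in> borel_measurable (PiM I (\<lambda>_. lborel))"
    unfolding H_def using measurable_compose[OF upd insert.prems]
    by (intro lborel.borel_measurable_nn_integral) (simp add: case_prod_unfold)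
  have "(\<integral>\<^sup>+y. F y \<partial>PiM (Set.insert i I) (\<lambda>_. lborel)) = (\<integral>\<^sup>+x. \<integral>\<^sup>+t. F (x(i := t)) \<partial>lborel \<partial>PiM I (\<lambda>_. lborel))"
    by (rule lborel_product.product_nn_integral_insert) (use insert in auto)
  also have "\<dots> = (\<integral>\<^sup>+x. ennreal r * H x \<partial>PiM I (\<lambda>_. lborel))"
  proof (rule nn_integral_cong)
    fix x assume x: "x \<in> space (PiM I (\<lambda>_. lborel :: real measure))"
    have "(\<lambda>t. F (x(i := t))) \<in> borel_measurable borel"
      using measurable_compose[OF measurable_component_update[OF x insert.hyps(2)] insert.prems]
      by (simp add: fun_upd_def)
    then show "(\<integral>\<^sup>+t. F (x(i := t)) \<partial>lborel) = ennreal r * H x"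
      using nn_integral_real_affine[of "\<lambda>t. F (x(i := t))" r 0] assms(2) by (simp add: H_def)
  qed
  also have "\<dots> = ennreal r * (\<integral>\<^sup>+x. H x \<partial>PiM I (\<lambda>_. lborel))"
    using H by (rule nn_integral_cmult)
  also have "\<dots> = ennreal r * (ennreal (r ^ card I) * (\<integral>\<^sup>+x. H (\<lambda>k\<in>I. r * x k) \<partial>PiM I (\<lambda>_. lborel)))"
    unfolding insert.IH[OF H] ..
  also have "\<dots> = ennreal (r ^ card (Set.insert i I)) * (\<integral>\<^sup>+x. H (\<lambda>k\<in>I. r * x k) \<partial>PiM I (\<lambda>_. lborel))"
    using insert.hyps assms(2) by (simp add: ennreal_mult mult.assoc)
  also have "(\<integral>\<^sup>+x. H (\<lambda>k\<in>I. r * x k) \<partial>PiM I (\<lambda>_. lborel))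
      = (\<integral>\<^sup>+x. \<integral>\<^sup>+t. F (\<lambda>k\<in>Set.insert i I. r * (x(i := t)) k) \<partial>lborel \<partial>PiM I (\<lambda>_. lborel))"
  proof (intro nn_integral_cong)
    fix x :: "'a \<Rightarrow> real"
    have "(restrict (\<lambda>k. r * x k) I)(i := r * t) = (\<lambda>k\<in>Set.insert i I. r * (x(i := t)) k)" for t
      using insert.hyps by (auto simp: fun_eq_iff)
    then show "H (\<lambda>k\<in>I. r * x k) = (\<integral>\<^sup>+t. F (\<lambda>k\<in>Set.insert i I. r * (x(i := t)) k) \<partial>lborel)"
      by (simp add: H_def)
  qed
  also have "\<dots> = (\<integral>\<^sup>+y. F (\<lambda>k\<in>Set.insert i I. r * y k) \<partial>PiM (Set.insert i I) (\<lambda>_. lborel))"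
    using measurable_compose[OF scale_meas insert.prems]
    by (intro lborel_product.product_nn_integral_insert[symmetric]) (use insert in auto)
  finally show ?case .
qed

lemma nn_integral_change_of_variables:
  fixes g g' :: "real \<Rightarrow> real" and f :: "real \<Rightarrow> ennreal"
  assumes [measurable]: "S \<in> sets borel" "g ` S \<in> sets borel"
    "f \<in> borel_measurable borel" "g \<in> borel_measurable borel" "g' \<in> borel_measurable borel"
    and deriv: "\<And>x. x \<in> S \<Longrightarrow> (g has_field_derivative g' x) (at x)"
    and inj: "inj_on g S"
  shows "(\<integral>\<^sup>+t. indicator (g ` S) t * f t \<partial>lborel)
       = (\<integral>\<^sup>+x. indicator S x * (ennreal \<bar>g' x\<bar> * f (g x)) \<partial>lborel)"
proof -
  define M1 where "M1 = density lborel (indicator (g ` S))"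
  define M2 where "M2 = distr (density lborel (\<lambda>x. indicator S x * ennreal \<bar>g' x\<bar>)) borel g"
  have "M1 = M2"
  proof (rule measure_eqI)
    fix X assume "X \<in> sets M1"
    then have X [measurable]: "X \<in> sets borel" by (simp add: M1_def)
    have eq1: "emeasure M1 X = (\<integral>\<^sup>+t. ennreal (indicator (g ` S) t *\<^sub>R indicator X t) \<partial>lborel)"
      unfolding M1_def by (subst emeasure_density) (auto intro!: nn_integral_cong split: split_indicator)
    have [measurable]: "g -` X \<in> sets borel"
      using measurable_sets[of g borel borel X] by simp
    have eq2: "emeasure M2 X = (\<integral>\<^sup>+x. ennreal (indicator S x *\<^sub>R (\<bar>g' x\<bar> * indicator X (g x))) \<partial>lborel)"
    proof -
      have "emeasure M2 X = (\<integral>\<^sup>+x. indicator S x * ennreal \<bar>g' x\<bar> * indicator (g -` X) x \<partial>lborel)"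
        unfolding M2_def by (subst emeasure_distr, simp, simp, subst emeasure_density) auto
      also have "\<dots> = (\<integral>\<^sup>+x. ennreal (indicator S x *\<^sub>R (\<bar>g' x\<bar> * indicator X (g x))) \<partial>lborel)"
        by (auto intro!: nn_integral_cong split: split_indicator)
      finally show ?thesis .
    qed
    have meas: "indicator X \<in> borel_measurable (borel :: real measure)" by measurable
    note cov = set_integral_change_of_variables[of S g "indicator X" g', OF assms(1,2) meas assms(4,5) deriv inj]
    show "emeasure M1 X = emeasure M2 X"
    proof (cases "set_integrable lborel (g ` S) (indicator X :: real \<Rightarrow> real)")
      case True
      then have "set_integrable lborel S (\<lambda>x. \<bar>g' x\<bar> * indicator X (g x))"
        using cov(1) by simp
      then have "emeasure M2 X = ennreal (LINT x:S|lborel. \<bar>g' x\<bar> * indicator X (g x))"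
        unfolding eq2 set_integrable_def set_lebesgue_integral_def by (intro nn_integral_eq_integral) auto
      moreover have "emeasure M1 X = ennreal (LINT t:g ` S|lborel. indicator X t)"
        using True unfolding eq1 set_integrable_def set_lebesgue_integral_def
        by (intro nn_integral_eq_integral) auto
      ultimately show ?thesis using cov(2) by simp
    next
      case False
      then have "\<not> set_integrable lborel S (\<lambda>x. \<bar>g' x\<bar> * indicator X (g x))"
        using cov(1) by simp
      then have "emeasure M2 X = \<infinity>"
        unfolding eq2 set_integrable_def
        by (subst (asm) integrable_iff_bounded) (auto simp: less_top[symmetric])
      moreover have "emeasure M1 X = \<infinity>"
        using False unfolding eq1 set_integrable_def
        by (subst (asm) integrable_iff_bounded) (auto simp: less_top[symmetric])
      ultimately show ?thesis by simp
    qed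
  qed (simp add: M1_def M2_def)
  then have "(\<integral>\<^sup>+t. f t \<partial>M1) = (\<integral>\<^sup>+t. f t \<partial>M2)" by simp
  also have "(\<integral>\<^sup>+t. f t \<partial>M1) = (\<integral>\<^sup>+t. indicator (g ` S) t * f t \<partial>lborel)"
    unfolding M1_def by (rule nn_integral_density) auto
  also have "(\<integral>\<^sup>+t. f t \<partial>M2) = (\<integral>\<^sup>+x. indicator S x * (ennreal \<bar>g' x\<bar> * f (g x)) \<partial>lborel)"
    unfolding M2_def by (subst nn_integral_distr, simp, simp, subst nn_integral_density)
      (auto simp: mult.assoc)
  finally show ?thesis .
qed

text \<open>Replacing the height \<open>t\<close> above a point of the coordinate hyperplane by the radius
  \<open>r = sqrt (w + \<alpha> t\<^sup>2)\<close>.\<close>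

lemma nn_integral_height_to_radius:
  fixes f :: "real \<Rightarrow> ennreal"
  assumes [measurable]: "f \<in> borel_measurable borel" and \<alpha>: "\<alpha> > 0" and w: "w \<ge> 0"
  shows "(\<integral>\<^sup>+t. indicator {0<..} t * f t \<partial>lborel)
    = (\<integral>\<^sup>+r. indicator {sqrt w<..} r * (ennreal (r / (\<alpha> * sqrt ((r\<^sup>2 - w) / \<alpha>))) * f (sqrt ((r\<^sup>2 - w) / \<alpha>))) \<partial>lborel)"
proof -
  define g where "g r = sqrt ((r\<^sup>2 - w) / \<alpha>)" for r
  define g' where "g' r = r / (\<alpha> * sqrt ((r\<^sup>2 - w) / \<alpha>))" for r
  have gt: "r > 0" "r\<^sup>2 > w" if "r \<in> {sqrt w<..}" for r
  proof -
    have less: "0 \<le> sqrt w" "sqrt w < r" using that w by auto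
    then show "r > 0" by linarith
    have "(sqrt w)\<^sup>2 < r\<^sup>2" using less by (intro power_strict_mono) auto
    then show "r\<^sup>2 > w" using w by simp
  qed
  have pos: "g r > 0" if "r \<in> {sqrt w<..}" for r
    using gt[OF that] \<alpha> by (simp add: g_def)
  have image: "g ` {sqrt w<..} = {0<..}"
  proof (intro equalityI subsetI)
    fix t :: real assume "t \<in> {0<..}"
    then have t: "t > 0" by simp
    have "w < w + \<alpha> * t\<^sup>2" using t \<alpha> by simp
    then have "sqrt w < sqrt (w + \<alpha> * t\<^sup>2)" by simp
    moreover have "g (sqrt (w + \<alpha> * t\<^sup>2)) = t"
      using t \<alpha> w by (simp add: g_def)
    ultimately show "t \<in> g ` {sqrt w<..}" by (metis greaterThan_iff imageI)
  qed (use pos in auto)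
  have deriv: "(g has_field_derivative g' r) (at r)" if "r \<in> {sqrt w<..}" for r
  proof -
    have arg: "(r\<^sup>2 - w) / \<alpha> > 0" using gt[OF that] \<alpha> by simp
    have "((\<lambda>r. (r\<^sup>2 - w) / \<alpha>) has_field_derivative 2 * r / \<alpha>) (at r)"
      using \<alpha> by (auto intro!: derivative_eq_intros)
    from DERIV_chain2[OF DERIV_real_sqrt[OF arg] this] show ?thesis
      unfolding g_def [abs_def] g'_def by (simp add: field_simps)
  qed
  have inj: "inj_on g {sqrt w<..}"
  proof (rule inj_onI)
    fix r r' assume *: "r \<in> {sqrt w<..}" "r' \<in> {sqrt w<..}" "g r = g r'"
    then have "r\<^sup>2 = r'\<^sup>2" using \<alpha> by (simp add: g_def)
    then show "r = r'" using gt(1)[OF *(1)] gt(1)[OF *(2)] by (simp add: power2_eq_iff)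
  qed
  have [measurable]: "g \<in> borel_measurable borel" "g' \<in> borel_measurable borel"
    unfolding g_def [abs_def] g'_def [abs_def] by measurable
  have "(\<integral>\<^sup>+t. indicator {0<..} t * f t \<partial>lborel)
      = (\<integral>\<^sup>+r. indicator {sqrt w<..} r * (ennreal \<bar>g' r\<bar> * f (g r)) \<partial>lborel)"
    using nn_integral_change_of_variables[of "{sqrt w<..}" g f g'] deriv inj by (simp add: image)
  also have "\<dots> = (\<integral>\<^sup>+r. indicator {sqrt w<..} r * (ennreal (g' r) * f (g r)) \<partial>lborel)"
  proof (intro nn_integral_cong)
    fix r :: real
    have "\<bar>g' r\<bar> = g' r" if "r \<in> {sqrt w<..}"
      using gt[OF that] pos[OF that] \<alpha> by (simp add: g'_def)
    then show "indicator {sqrt w<..} r * (ennreal \<bar>g' r\<bar> * f (g r)) = indicator {sqrt w<..} r * (ennreal (g' r) * f (g r))"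
      by (simp split: split_indicator)
  qed
  finally show ?thesis by (simp add: g_def g'_def)
qed

abbreviation hyperplane_lborel :: "'n::finite \<Rightarrow> ('n \<Rightarrow> real) measure" where
  "hyperplane_lborel j \<equiv> PiM (UNIV - {j}) (\<lambda>_. lborel)"

abbreviation sheet_measure :: "'n::finite \<Rightarrow> (real \<times> ('n \<Rightarrow> real)) measure" where
  "sheet_measure j \<equiv> count_space {1, - 1} \<Otimes>\<^sub>M hyperplane_lborel j"

text \<open>The points of the ellipsoid over \<open>z\<close>, on the upper sheet for \<open>\<epsilon> = 1\<close> and on the lower one for
  \<open>\<epsilon> = - 1\<close>.\<close>

definition sheet_point :: "'n::finite \<Rightarrow> real ^ 'n \<Rightarrow> real \<Rightarrow> ('n \<Rightarrow> real) \<Rightarrow> real ^ 'n" where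
  "sheet_point j a \<epsilon> z = graph_point j (\<lambda>z. \<epsilon> * ellipsoid_height j a z) z"

lemma sigma_finite_hyperplane: "sigma_finite_measure (hyperplane_lborel j)"
  by (rule lborel_product.sigma_finite) simp

lemma hyperplane_component_measurable:
  "i \<noteq> j \<Longrightarrow> (\<lambda>y. y i) \<in> borel_measurable (hyperplane_lborel j)"
  using measurable_component_singleton[of i "UNIV - {j}" "\<lambda>_. lborel :: real measure"] by simp

lemma hyperplane_sum_measurable [measurable]:
  "(\<lambda>y. \<Sum>i\<in>UNIV - {j}. a $ i * (y i)\<^sup>2) \<in> borel_measurable (hyperplane_lborel j)"
  by (intro borel_measurable_sum borel_measurable_times borel_measurable_power
      hyperplane_component_measurable) auto

lemma ellipsoid_height_measurable [measurable]:
  "ellipsoid_height j a \<in> borel_measurable (hyperplane_lborel j)"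
  unfolding ellipsoid_height_def [abs_def] by measurable

lemma hyperplane_vec_measurable [measurable (raw)]:
  assumes "f \<in> borel_measurable M" "y \<in> measurable M (hyperplane_lborel j)"
  shows "(\<lambda>x. \<chi> i. if i = j then f x else y x i) \<in> borel_measurable M"
proof (rule measurable_vec_lambda)
  fix i
  show "(\<lambda>x. if i = j then f x else y x i) \<in> borel_measurable M"
    using assms measurable_compose[OF assms(2) hyperplane_component_measurable[of i j]]
    by (cases "i = j") auto
qed

lemma sheet_point_measurable [measurable]:
  "(\<lambda>(\<epsilon>, z). sheet_point j a \<epsilon> z) \<in> borel_measurable (sheet_measure j)"
proof -
  have "fst \<in> borel_measurable (sheet_measure j)"
    by (rule measurable_compose[OF measurable_fst]) simp
  moreover have "(\<lambda>x. ellipsoid_height j a (snd x)) \<in> borel_measurable (sheet_measure j)"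
    by (rule measurable_compose[OF measurable_snd ellipsoid_height_measurable])
  ultimately show ?thesis
    unfolding sheet_point_def graph_point_def case_prod_unfold
    by (intro hyperplane_vec_measurable borel_measurable_times measurable_snd)
qed

lemma ellipsoid_shadow_measurable [measurable]:
  "Measurable.pred (hyperplane_lborel j) (\<lambda>z. z \<in> ellipsoid_shadow j a)"
  unfolding ellipsoid_shadow_def mem_Collect_eq by measurable

text \<open>The area element of the sheet divided by the norm of the normal vector \<open>A \<theta>\<close>.\<close>

abbreviation sheet_weight :: "'n::finite \<Rightarrow> real ^ 'n \<Rightarrow> ('n \<Rightarrow> real) \<Rightarrow> ennreal" where
  "sheet_weight j a z \<equiv>
     indicator (ellipsoid_shadow j a) z * ennreal (1 / (a $ j * ellipsoid_height j a z))"

abbreviation radial_integral :: "(real ^ 'n::finite \<Rightarrow> ennreal) \<Rightarrow> real ^ 'n \<Rightarrow> ennreal" where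
  "radial_integral F \<theta> \<equiv>
     (\<integral>\<^sup>+r. indicator {0<..} r * ennreal (r ^ (CARD('n) - 1)) * F (r *\<^sub>R \<theta>) \<partial>lborel)"

abbreviation kernel_integral :: "real \<Rightarrow> (real ^ 'n::finite \<Rightarrow> ennreal) \<Rightarrow> real ^ 'n \<Rightarrow> ennreal" where
  "kernel_integral s F \<theta> \<equiv>
     (\<integral>\<^sup>+r. indicator {0<..} r * (ennreal (r powr (- 1 - 2 * s)) * F (r *\<^sub>R \<theta>)) \<partial>lborel)"

abbreviation riesz_weight :: "real \<Rightarrow> real ^ 'n::finite \<Rightarrow> ennreal" where
  "riesz_weight s y \<equiv> ennreal (1 / norm y powr (real CARD('n) + 2 * s))"

text \<open>On the vertical line over \<open>y\<close> the height is replaced by the radius \<open>r\<close>; after exchanging the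
  integrals, \<open>y\<close> is scaled by \<open>r\<close>.  This needs no change of variables in several dimensions.\<close>

lemma nn_integral_lborel_half_polar:
  fixes F :: "real ^ 'n::finite \<Rightarrow> ennreal" and a :: "real ^ 'n" and j :: 'n
  assumes F [measurable]: "F \<in> borel_measurable borel" and a: "\<And>i. a $ i > 0"
  shows "(\<integral>\<^sup>+y. \<integral>\<^sup>+t. indicator {0<..} t * F (\<chi> i. if i = j then \<epsilon> * t else y i) \<partial>lborel \<partial>hyperplane_lborel j)
    = (\<integral>\<^sup>+z. sheet_weight j a z *
        radial_integral F (sheet_point j a \<epsilon> z)
        \<partial>hyperplane_lborel j)"
proof -
  define I where "I = UNIV - {j}"
  define w where "w y = (\<Sum>i\<in>UNIV - {j}. a $ i * (y i)\<^sup>2)" for y :: "'n \<Rightarrow> real"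
  define \<alpha> where "\<alpha> = a $ j"
  define h where "h = ellipsoid_height j a"
  define R where "R y r = sqrt ((r\<^sup>2 - w y) / \<alpha>)" for y r
  define K where "K y r = (if 0 < r \<and> w y < r\<^sup>2 then ennreal (r / (\<alpha> * R y r)) *
      F (\<chi> i. if i = j then \<epsilon> * R y r else y i) else 0)" for y r
  define L where "L z r = (if 0 < r \<and> w z < 1 then ennreal (r ^ (CARD('n) - 1)) *
      (ennreal (1 / (\<alpha> * h z)) * F (r *\<^sub>R sheet_point j a \<epsilon> z)) else 0)" for z r
  have \<alpha>: "\<alpha> > 0" using a by (simp add: \<alpha>_def)
  have w_nonneg: "w y \<ge> 0" for y
    unfolding w_def using a by (intro sum_nonneg mult_nonneg_nonneg) (auto intro: less_imp_le)
  have w_meas [measurable]: "w \<in> borel_measurable (hyperplane_lborel j)"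
    unfolding w_def [abs_def] by measurable
  have h_meas [measurable]: "h \<in> borel_measurable (hyperplane_lborel j)"
    unfolding h_def by measurable
  interpret H: sigma_finite_measure "hyperplane_lborel j" by (rule sigma_finite_hyperplane)
  interpret P: pair_sigma_finite "hyperplane_lborel j" "lborel :: real measure" ..
  have K_meas: "(\<lambda>(y, r). K y r) \<in> borel_measurable (hyperplane_lborel j \<Otimes>\<^sub>M lborel)"
    unfolding K_def R_def case_prod_unfold by measurable
  have pt: "sheet_point j a \<epsilon> z = (\<chi> i. if i = j then \<epsilon> * h z else z i)" for z
    unfolding sheet_point_def graph_point_def h_def ..
  have L_meas: "(\<lambda>(z, r). L z r) \<in> borel_measurable (hyperplane_lborel j \<Otimes>\<^sub>M lborel)"
    unfolding L_def pt case_prod_unfold by measurable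
  have "(\<integral>\<^sup>+y. \<integral>\<^sup>+t. indicator {0<..} t * F (\<chi> i. if i = j then \<epsilon> * t else y i) \<partial>lborel \<partial>hyperplane_lborel j)
      = (\<integral>\<^sup>+y. \<integral>\<^sup>+r. K y r \<partial>lborel \<partial>hyperplane_lborel j)"
  proof (rule nn_integral_cong)
    fix y assume y: "y \<in> space (hyperplane_lborel j)"
    have [measurable]: "(\<lambda>t. \<chi> i. if i = j then \<epsilon> * t else y i) \<in> borel_measurable borel"
      by (intro measurable_vec_lambda) auto
    have "(\<integral>\<^sup>+t. indicator {0<..} t * F (\<chi> i. if i = j then \<epsilon> * t else y i) \<partial>lborel)
      = (\<integral>\<^sup>+r. indicator {sqrt (w y)<..} r * (ennreal (r / (\<alpha> * R y r)) *
          F (\<chi> i. if i = j then \<epsilon> * R y r else y i)) \<partial>lborel)"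
      unfolding R_def by (rule nn_integral_height_to_radius[OF _ \<alpha> w_nonneg]) measurable
    also have "\<dots> = (\<integral>\<^sup>+r. K y r \<partial>lborel)"
    proof (rule nn_integral_cong)
      fix r :: real
      have "sqrt (w y) < r \<longleftrightarrow> 0 < r \<and> w y < r\<^sup>2"
        using w_nonneg[of y] by (metis abs_of_pos le_less_trans real_sqrt_abs real_sqrt_ge_zero real_sqrt_less_iff)
      then show "indicator {sqrt (w y)<..} r * (ennreal (r / (\<alpha> * R y r)) *
          F (\<chi> i. if i = j then \<epsilon> * R y r else y i)) = K y r"
        by (simp add: K_def)
    qed
    finally show "(\<integral>\<^sup>+t. indicator {0<..} t * F (\<chi> i. if i = j then \<epsilon> * t else y i) \<partial>lborel)
       = (\<integral>\<^sup>+r. K y r \<partial>lborel)" .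
  qed
  also have "\<dots> = (\<integral>\<^sup>+r. \<integral>\<^sup>+y. K y r \<partial>hyperplane_lborel j \<partial>lborel)"
    by (rule P.Fubini'[OF K_meas, symmetric])
  also have "\<dots> = (\<integral>\<^sup>+r. \<integral>\<^sup>+z. L z r \<partial>hyperplane_lborel j \<partial>lborel)"
  proof (rule nn_integral_cong)
    fix r :: real
    show "(\<integral>\<^sup>+y. K y r \<partial>hyperplane_lborel j) = (\<integral>\<^sup>+z. L z r \<partial>hyperplane_lborel j)"
    proof (cases "r > 0")
      case False
      then show ?thesis by (simp add: K_def L_def)
    next
      case r: True
      have card: "card I = CARD('n) - 1" by (simp add: I_def)
      have Kr: "(\<lambda>y. K y r) \<in> borel_measurable (PiM I (\<lambda>_. lborel))"
        using measurable_compose[OF measurable_Pair2' K_meas, of r] by (simp add: I_def)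
      have scaled: "K (\<lambda>i\<in>I. r * z i) r = (if w z < 1 then ennreal (1 / (\<alpha> * h z)) * F (r *\<^sub>R sheet_point j a \<epsilon> z) else 0)" for z
      proof -
        have w_scale: "w (\<lambda>i\<in>I. r * z i) = r\<^sup>2 * w z"
          unfolding w_def sum_distrib_left by (intro sum.cong) (auto simp: I_def power_mult_distrib)
        have lt: "r\<^sup>2 * w z < r\<^sup>2 \<longleftrightarrow> w z < 1" using r by (simp add: mult_less_cancel_left2)
        have eq: "(r\<^sup>2 - r\<^sup>2 * w z) / \<alpha> = r\<^sup>2 * ((1 - w z) / \<alpha>)" by (simp add: algebra_simps diff_divide_distrib)
        have "h z = sqrt ((1 - w z) / \<alpha>)"
          by (simp add: h_def ellipsoid_height_def w_def \<alpha>_def)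
        then have R_scale: "R (\<lambda>i\<in>I. r * z i) r = r * h z"
          using r unfolding R_def w_scale eq real_sqrt_mult by simp
        have vec: "(\<chi> i. if i = j then \<epsilon> * (r * h z) else (\<lambda>i\<in>I. r * z i) i) = r *\<^sub>R sheet_point j a \<epsilon> z"
          by (simp add: pt vec_eq_iff I_def)
        show ?thesis
          using r unfolding K_def w_scale lt R_scale vec by simp
      qed
      have "(\<integral>\<^sup>+y. K y r \<partial>hyperplane_lborel j) = ennreal (r ^ card I) * (\<integral>\<^sup>+z. K (\<lambda>i\<in>I. r * z i) r \<partial>hyperplane_lborel j)"
        using nn_integral_PiM_lborel_scale[OF _ r Kr] by (simp add: I_def)
      also have "\<dots> = (\<integral>\<^sup>+z. L z r \<partial>hyperplane_lborel j)"
        unfolding scaled card pt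
        by (subst nn_integral_cmult [symmetric]) (auto simp: L_def r pt intro!: nn_integral_cong)
      finally show ?thesis .
    qed
  qed
  also have "\<dots> = (\<integral>\<^sup>+z. \<integral>\<^sup>+r. L z r \<partial>lborel \<partial>hyperplane_lborel j)"
    by (rule P.Fubini'[OF L_meas])
  also have "\<dots> = (\<integral>\<^sup>+z. sheet_weight j a z *
        radial_integral F (sheet_point j a \<epsilon> z)
        \<partial>hyperplane_lborel j)"
  proof (rule nn_integral_cong)
    fix z
    have "(\<integral>\<^sup>+r. L z r \<partial>lborel) = (\<integral>\<^sup>+r. (sheet_weight j a z) *
        (indicator {0<..} r * ennreal (r ^ (CARD('n) - 1)) * F (r *\<^sub>R sheet_point j a \<epsilon> z)) \<partial>lborel)"
      by (intro nn_integral_cong)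
         (auto simp: L_def ellipsoid_shadow_def w_def \<alpha>_def h_def mult_ac split: split_indicator)
    also have "\<dots> = (sheet_weight j a z) *
        radial_integral F (sheet_point j a \<epsilon> z)"
      by (rule nn_integral_cmult) measurable
    finally show "(\<integral>\<^sup>+r. L z r \<partial>lborel) = (sheet_weight j a z) *
        radial_integral F (sheet_point j a \<epsilon> z)" .
  qed
  finally show ?thesis .
qed

lemma nn_integral_sheet:
  fixes G :: "real \<times> ('n::finite \<Rightarrow> real) \<Rightarrow> ennreal"
  assumes "G \<in> borel_measurable (sheet_measure j)"
  shows "(\<integral>\<^sup>+x. G x \<partial>sheet_measure j)
    = (\<integral>\<^sup>+z. G (1, z) \<partial>hyperplane_lborel j) + (\<integral>\<^sup>+z. G (- 1, z) \<partial>hyperplane_lborel j)"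
proof -
  interpret H: sigma_finite_measure "hyperplane_lborel j" by (rule sigma_finite_hyperplane)
  have "(\<integral>\<^sup>+x. G x \<partial>sheet_measure j)
      = (\<integral>\<^sup>+\<epsilon>. \<integral>\<^sup>+z. G (\<epsilon>, z) \<partial>hyperplane_lborel j \<partial>count_space {1, - 1})"
    by (rule H.nn_integral_fst [symmetric]) (use assms in simp)
  then show ?thesis
    by (simp add: nn_integral_count_space_finite)
qed

lemma nn_integral_lborel_polar:
  fixes F :: "real ^ 'n::finite \<Rightarrow> ennreal" and a :: "real ^ 'n" and j :: 'n
  assumes F [measurable]: "F \<in> borel_measurable borel" and a: "\<And>i. a $ i > 0"
  shows "(\<integral>\<^sup>+x. F x \<partial>lborel)
    = (\<integral>\<^sup>+(\<epsilon>, z). sheet_weight j a z *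
        radial_integral F (sheet_point j a \<epsilon> z)
        \<partial>sheet_measure j)"
proof -
  define A where "A \<epsilon> y = (\<integral>\<^sup>+t. indicator {0<..} t * F (\<chi> i. if i = j then \<epsilon> * t else y i) \<partial>lborel)"
    for \<epsilon> :: real and y
  have A_meas: "A \<epsilon> \<in> borel_measurable (hyperplane_lborel j)" for \<epsilon>
    unfolding A_def by (intro lborel.borel_measurable_nn_integral) (simp add: case_prod_unfold, measurable)
  have "(\<integral>\<^sup>+t. F (\<chi> i. if i = j then t else y i) \<partial>lborel) = A 1 y + A (- 1) y" for y
  proof -
    have [measurable]: "(\<lambda>t. \<chi> i. if i = j then \<epsilon> * t else y i) \<in> borel_measurable borel" for \<epsilon> :: real
      by (intro measurable_vec_lambda) auto
    have [measurable]: "(\<lambda>t. \<chi> i. if i = j then t else y i) \<in> borel_measurable borel"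
      by (intro measurable_vec_lambda) auto
    have "(\<integral>\<^sup>+t. F (\<chi> i. if i = j then t else y i) \<partial>lborel)
        = (\<integral>\<^sup>+t. indicator {0<..} t * F (\<chi> i. if i = j then 1 * t else y i)
            + indicator {..<0} t * F (\<chi> i. if i = j then t else y i) \<partial>lborel)"
    proof (rule nn_integral_cong_AE)
      show "AE t in lborel. F (\<chi> i. if i = j then t else y i)
        = indicator {0<..} t * F (\<chi> i. if i = j then 1 * t else y i)
            + indicator {..<0} t * F (\<chi> i. if i = j then t else y i)"
        using AE_lborel_singleton[of "0::real"]
        by eventually_elim (auto split: split_indicator cong: if_cong)
    qed
    also have "\<dots> = A 1 y + (\<integral>\<^sup>+t. indicator {..<0} t * F (\<chi> i. if i = j then t else y i) \<partial>lborel)"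
      unfolding A_def by (rule nn_integral_add) measurable
    also have "(\<integral>\<^sup>+t. indicator {..<0} t * F (\<chi> i. if i = j then t else y i) \<partial>lborel)
        = (\<integral>\<^sup>+t. indicator {..<0} (0 + - 1 * t) * F (\<chi> i. if i = j then 0 + - 1 * t else y i) \<partial>lborel)"
      by (subst nn_integral_real_affine[of _ "- 1" 0]) auto
    also have "\<dots> = A (- 1) y"
      unfolding A_def by (intro nn_integral_cong) (auto split: split_indicator cong: if_cong)
    finally show ?thesis .
  qed
  then have split: "(\<integral>\<^sup>+x. F x \<partial>lborel) = (\<integral>\<^sup>+y. A 1 y \<partial>hyperplane_lborel j) + (\<integral>\<^sup>+y. A (- 1) y \<partial>hyperplane_lborel j)"
    using A_meas by (subst nn_integral_lborel_vec_split[OF F, of j]) (simp add: nn_integral_add)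
  have half: "(\<integral>\<^sup>+y. A \<epsilon> y \<partial>hyperplane_lborel j)
      = (\<integral>\<^sup>+z. sheet_weight j a z *
        radial_integral F (sheet_point j a \<epsilon> z)
        \<partial>hyperplane_lborel j)" for \<epsilon>
    unfolding A_def by (rule nn_integral_lborel_half_polar[OF F a])
  note split
  also have "(\<integral>\<^sup>+y. A 1 y \<partial>hyperplane_lborel j) + (\<integral>\<^sup>+y. A (- 1) y \<partial>hyperplane_lborel j) = (\<integral>\<^sup>+(\<epsilon>, z). sheet_weight j a z *
        radial_integral F (sheet_point j a \<epsilon> z)
        \<partial>sheet_measure j)"
  proof (subst nn_integral_sheet)
    have pt: "(\<lambda>x. sheet_point j a (fst (fst x)) (snd (fst x))) \<in> borel_measurable (sheet_measure j \<Otimes>\<^sub>M lborel)"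
      using measurable_compose[OF measurable_fst sheet_point_measurable] by (simp add: case_prod_unfold)
    note [measurable] = pt
    have "(\<lambda>x. \<integral>\<^sup>+r. indicator {0<..} r * ennreal (r ^ (CARD('n) - 1)) * F (r *\<^sub>R sheet_point j a (fst x) (snd x)) \<partial>lborel)
        \<in> borel_measurable (sheet_measure j)"
      by (intro lborel.borel_measurable_nn_integral) (simp add: case_prod_unfold, measurable)
    moreover have "(\<lambda>z. sheet_weight j a z)
        \<in> borel_measurable (hyperplane_lborel j)"
      by measurable
    ultimately show "(\<lambda>(\<epsilon>, z). sheet_weight j a z *
        radial_integral F (sheet_point j a \<epsilon> z))
        \<in> borel_measurable (sheet_measure j)"
      unfolding case_prod_unfold
      by (intro borel_measurable_times_ennreal measurable_compose[OF measurable_snd]) auto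
  qed (simp only: half prod.case)
  finally show ?thesis .
qed

lemma diag_matrix_mult: "(diag_matrix a *v x) $ i = a $ i * x $ i"
  by (simp add: diag_matrix_def matrix_vector_mult_def if_distrib[of "\<lambda>t. t * _"] cong: if_cong)

lemma norm_a_eq: "norm_a a x = sqrt (\<Sum>i\<in>UNIV. a $ i * (x $ i)\<^sup>2)"
  by (simp add: norm_a_def inner_vec_def diag_matrix_mult power2_eq_square mult_ac)

lemma sheet_point_nth: "sheet_point j a \<epsilon> z $ i = (if i = j then \<epsilon> * ellipsoid_height j a z else z i)"
  by (simp add: sheet_point_def graph_point_def)

context
  fixes a :: "real ^ 'n::finite" and j :: 'n
  assumes a: "\<And>i. a $ i > 0"
begin

lemma ellipsoid_height_pos: "z \<in> ellipsoid_shadow j a \<Longrightarrow> ellipsoid_height j a z > 0"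
  using a[of j] by (simp add: ellipsoid_shadow_def ellipsoid_height_def)

lemma ellipsoid_height_square:
  "z \<in> ellipsoid_shadow j a \<Longrightarrow>
    a $ j * (ellipsoid_height j a z)\<^sup>2 = 1 - (\<Sum>i\<in>UNIV - {j}. a $ i * (z i)\<^sup>2)"
  using a[of j] by (simp add: ellipsoid_shadow_def ellipsoid_height_def)

lemma norm_a_sheet_point:
  assumes z: "z \<in> ellipsoid_shadow j a" and \<epsilon>: "\<epsilon> \<in> {1, - 1}"
  shows "norm_a a (sheet_point j a \<epsilon> z) = 1"
proof -
  have "(\<Sum>i\<in>UNIV. a $ i * (sheet_point j a \<epsilon> z $ i)\<^sup>2)
    = a $ j * (\<epsilon> * ellipsoid_height j a z)\<^sup>2 + (\<Sum>i\<in>UNIV - {j}. a $ i * (z i)\<^sup>2)"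
    by (subst sum.remove[of UNIV j]) (auto simp: sheet_point_nth)
  also have "(\<epsilon> * ellipsoid_height j a z)\<^sup>2 = (ellipsoid_height j a z)\<^sup>2"
    using \<epsilon> by auto
  finally show ?thesis
    using ellipsoid_height_square[OF z] by (simp add: norm_a_eq)
qed

lemma ellipsoid_height_partial_deriv:
  assumes z: "z \<in> ellipsoid_shadow j a" and i: "i \<noteq> j"
  shows "deriv (\<lambda>t. \<epsilon> * ellipsoid_height j a (z(i := t))) (z i)
    = - \<epsilon> * (a $ i * z i) / (a $ j * ellipsoid_height j a z)"
proof -
  define S where "S = (\<Sum>l\<in>UNIV - {j} - {i}. a $ l * (z l)\<^sup>2)"
  have sum: "(\<Sum>l\<in>UNIV - {j}. a $ l * ((z(i := t)) l)\<^sup>2) = a $ i * t\<^sup>2 + S" for t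
    unfolding S_def by (subst sum.remove[of _ i]) (use i in \<open>auto intro!: sum.cong\<close>)
  define f where "f t = (1 - (a $ i * t\<^sup>2 + S)) / a $ j" for t
  have h: "ellipsoid_height j a (z(i := t)) = sqrt (f t)" for t
    unfolding ellipsoid_height_def sum f_def ..
  have h0: "ellipsoid_height j a z = sqrt (f (z i))"
    using h[of "z i"] by simp
  have pos: "f (z i) > 0"
    using ellipsoid_height_pos[OF z] unfolding h0 by simp
  have "(f has_field_derivative (- (2 * a $ i * z i) / a $ j)) (at (z i))"
    unfolding f_def [abs_def] using a[of j] by (auto intro!: derivative_eq_intros)
  from DERIV_cmult[OF DERIV_chain2[OF DERIV_real_sqrt[OF pos] this], of \<epsilon>]
  have "deriv (\<lambda>t. \<epsilon> * sqrt (f t)) (z i) = \<epsilon> * (inverse (sqrt (f (z i))) / 2 * (- (2 * a $ i * z i) / a $ j))"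
    by (rule DERIV_imp_deriv)
  then show ?thesis
    unfolding h h0 using a[of j] pos by (simp add: field_simps)
qed

text \<open>The gradient of the height consists of the ratios of the components of the normal vector
  \<open>A \<theta>\<close> to its component along the axis \<open>j\<close>, up to sign.\<close>

lemma graph_area_element_ellipsoid:
  assumes z: "z \<in> ellipsoid_shadow j a" and \<epsilon>: "\<epsilon> \<in> {1, - 1}"
  shows "graph_area_element j (\<lambda>z. \<epsilon> * ellipsoid_height j a z) z
    = norm (diag_matrix a *v sheet_point j a \<epsilon> z) / (a $ j * ellipsoid_height j a z)"
proof -
  define H where "H = a $ j * ellipsoid_height j a z"
  have H: "H > 0" using a[of j] ellipsoid_height_pos[OF z] by (simp add: H_def)
  have \<epsilon>2: "\<epsilon>\<^sup>2 = 1" using \<epsilon> by auto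
  have "(\<Sum>i\<in>UNIV. (a $ i * sheet_point j a \<epsilon> z $ i)\<^sup>2) = H\<^sup>2 + (\<Sum>i\<in>UNIV - {j}. (a $ i * z i)\<^sup>2)"
    using \<epsilon>2 by (subst sum.remove[of UNIV j])
      (auto simp: sheet_point_nth H_def power_mult_distrib intro!: sum.cong)
  then have norm: "norm (diag_matrix a *v sheet_point j a \<epsilon> z) = sqrt (H\<^sup>2 + (\<Sum>i\<in>UNIV - {j}. (a $ i * z i)\<^sup>2))"
    by (simp add: norm_vec_def L2_set_def diag_matrix_mult)
  have "(\<Sum>i\<in>UNIV - {j}. (deriv (\<lambda>t. \<epsilon> * ellipsoid_height j a (z(i := t))) (z i))\<^sup>2)
      = (\<Sum>i\<in>UNIV - {j}. (a $ i * z i)\<^sup>2 / H\<^sup>2)"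
    using \<epsilon>2 by (intro sum.cong refl)
      (simp add: ellipsoid_height_partial_deriv[OF z] H_def power_divide power_mult_distrib)
  then have "graph_area_element j (\<lambda>z. \<epsilon> * ellipsoid_height j a z) z
      = sqrt ((H\<^sup>2 + (\<Sum>i\<in>UNIV - {j}. (a $ i * z i)\<^sup>2)) / H\<^sup>2)"
    using H by (simp add: graph_area_element_def add_divide_distrib sum_divide_distrib)
  then show ?thesis
    using H by (simp add: norm real_sqrt_divide H_def [symmetric])
qed

end

lemma indicator_shadow_measurable:
  "(\<lambda>x. indicator (ellipsoid_shadow j a) (snd x) :: ennreal) \<in> borel_measurable (sheet_measure j)"
  "(\<lambda>x. indicator (ellipsoid_shadow j a) (snd x) :: real) \<in> borel_measurable (sheet_measure j)"
  "(\<lambda>x. ellipsoid_height j a (snd x)) \<in> borel_measurable (sheet_measure j)"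
  by (rule measurable_compose[OF measurable_snd], measurable)+

lemma sheet_point_measurable':
  "(\<lambda>x. sheet_point j a (fst x) (snd x)) \<in> borel_measurable (sheet_measure j)"
  using sheet_point_measurable[of j a] by (simp add: case_prod_unfold)

lemma diag_matrix_measurable [measurable]: "(\<lambda>x. diag_matrix a *v x) \<in> borel_measurable borel"
  by (intro borel_measurable_continuous_onI linear_continuous_on)
     (simp add: linear_linear matrix_vector_mul_bounded_linear)

lemma nn_integral_surface:
  fixes a :: "real ^ 'n::finite"
  assumes a: "\<And>i. a $ i > 0" and f [measurable]: "f \<in> borel_measurable borel"
  shows "(\<integral>\<^sup>+\<theta>. f \<theta> \<partial>ellipsoid_surface_along j a)
    = (\<integral>\<^sup>+(\<epsilon>, z). sheet_weight j a z *
        (ennreal (norm (diag_matrix a *v sheet_point j a \<epsilon> z)) * f (sheet_point j a \<epsilon> z)) \<partial>sheet_measure j)"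
proof -
  note [measurable] = indicator_shadow_measurable[of j a] sheet_point_measurable'[of j a]
  define W where "W x = ennreal (indicator (ellipsoid_shadow j a) (snd x)
      * graph_area_element j (\<lambda>z. fst x * ellipsoid_height j a z) (snd x))" for x
  define V where "V x = indicator (ellipsoid_shadow j a) (snd x) *
     (norm (diag_matrix a *v sheet_point j a (fst x) (snd x)) / (a $ j * ellipsoid_height j a (snd x)))" for x
  have V: "W x = ennreal (V x)" if "x \<in> space (sheet_measure j)" for x
    using that graph_area_element_ellipsoid[OF a, of "snd x" j "fst x"]
    by (auto simp: W_def V_def space_pair_measure split: split_indicator)
  have V_meas: "V \<in> borel_measurable (sheet_measure j)"
    unfolding V_def by measurable
  have W_meas: "W \<in> borel_measurable (sheet_measure j)"
    using V_meas by (subst measurable_cong[OF V]) auto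
  have "(\<integral>\<^sup>+\<theta>. f \<theta> \<partial>ellipsoid_surface_along j a)
      = (\<integral>\<^sup>+x. f (sheet_point j a (fst x) (snd x)) \<partial>density (sheet_measure j) W)"
    unfolding ellipsoid_surface_along_def case_prod_unfold sheet_point_def [symmetric] W_def
    by (rule nn_integral_distr) simp_all
  also have "\<dots> = (\<integral>\<^sup>+x. W x * f (sheet_point j a (fst x) (snd x)) \<partial>sheet_measure j)"
    by (rule nn_integral_density[OF W_meas]) measurable
  also have "\<dots> = (\<integral>\<^sup>+(\<epsilon>, z). sheet_weight j a z *
        (ennreal (norm (diag_matrix a *v sheet_point j a \<epsilon> z)) * f (sheet_point j a \<epsilon> z)) \<partial>sheet_measure j)"
  proof (intro nn_integral_cong)
    fix x assume "x \<in> space (sheet_measure j)"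
    then show "W x * f (sheet_point j a (fst x) (snd x)) = (case x of (\<epsilon>, z) \<Rightarrow>
        sheet_weight j a z *
        (ennreal (norm (diag_matrix a *v sheet_point j a \<epsilon> z)) * f (sheet_point j a \<epsilon> z)))"
    proof (cases "snd x \<in> ellipsoid_shadow j a")
      case True
      then have "ennreal (V x) = ennreal (1 / (a $ j * ellipsoid_height j a (snd x)))
          * ennreal (norm (diag_matrix a *v sheet_point j a (fst x) (snd x)))"
        using a[of j] ellipsoid_height_pos[OF a True] by (simp add: V_def flip: ennreal_mult)
      then show ?thesis
        using True by (simp add: V[OF \<open>x \<in> _\<close>] case_prod_unfold mult_ac)
    qed (simp add: V V_def case_prod_unfold)
  qed
  finally show ?thesis .
qed

lemma nn_integral_mu:
  fixes a :: "real ^ 'n::finite"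
  assumes a: "\<And>i. a $ i > 0" and f [measurable]: "f \<in> borel_measurable borel"
  defines "j \<equiv> SOME j. True"
  shows "(\<integral>\<^sup>+\<theta>. f \<theta> \<partial>mu a s)
    = (\<integral>\<^sup>+(\<epsilon>, z). sheet_weight j a z *
        (riesz_weight s (sheet_point j a \<epsilon> z) * f (sheet_point j a \<epsilon> z)) \<partial>sheet_measure j)"
proof -
  define g where "g \<theta> = 1 / (norm \<theta> powr (real CARD('n) + 2 * s) * norm (diag_matrix a *v \<theta>))" for \<theta> :: "real ^ 'n"
  have [measurable]: "g \<in> borel_measurable borel" unfolding g_def [abs_def] by measurable
  have [measurable_cong]: "sets (ellipsoid_surface a) = sets borel"
    by (simp add: ellipsoid_surface_def ellipsoid_surface_along_def)
  have "(\<integral>\<^sup>+\<theta>. f \<theta> \<partial>mu a s) = (\<integral>\<^sup>+\<theta>. ennreal (g \<theta>) * f \<theta> \<partial>ellipsoid_surface a)"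
    unfolding mu_def g_def [symmetric] by (rule nn_integral_density) measurable
  also have "\<dots> = (\<integral>\<^sup>+\<theta>. ennreal (g \<theta>) * f \<theta> \<partial>ellipsoid_surface_along j a)"
    by (simp only: ellipsoid_surface_def j_def)
  also have "\<dots> = (\<integral>\<^sup>+(\<epsilon>, z). sheet_weight j a z *
        (ennreal (norm (diag_matrix a *v sheet_point j a \<epsilon> z)) *
          (ennreal (g (sheet_point j a \<epsilon> z)) * f (sheet_point j a \<epsilon> z))) \<partial>sheet_measure j)"
    by (rule nn_integral_surface[OF a]) measurable
  also have "\<dots> = (\<integral>\<^sup>+(\<epsilon>, z). sheet_weight j a z *
        (riesz_weight s (sheet_point j a \<epsilon> z) * f (sheet_point j a \<epsilon> z)) \<partial>sheet_measure j)"
  proof (intro nn_integral_cong, clarify)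
    fix \<epsilon> z assume "(\<epsilon>, z) \<in> space (sheet_measure j)"
    then have \<epsilon>: "\<epsilon> \<in> {1, - 1}" by (simp add: space_pair_measure)
    show "sheet_weight j a z *
        (ennreal (norm (diag_matrix a *v sheet_point j a \<epsilon> z)) *
          (ennreal (g (sheet_point j a \<epsilon> z)) * f (sheet_point j a \<epsilon> z)))
      = sheet_weight j a z *
        (riesz_weight s (sheet_point j a \<epsilon> z) * f (sheet_point j a \<epsilon> z))"
    proof (cases "z \<in> ellipsoid_shadow j a")
      case True
      have "(diag_matrix a *v sheet_point j a \<epsilon> z) $ j \<noteq> 0"
        using ellipsoid_height_pos[OF a True] a[of j] \<epsilon> by (auto simp: diag_matrix_mult sheet_point_nth)
      then have "norm (diag_matrix a *v sheet_point j a \<epsilon> z) > 0" by auto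
      then have "ennreal (norm (diag_matrix a *v sheet_point j a \<epsilon> z)) * ennreal (g (sheet_point j a \<epsilon> z))
        = riesz_weight s (sheet_point j a \<epsilon> z)"
        by (subst ennreal_mult [symmetric]) (auto simp: g_def)
      then show ?thesis by (simp add: mult.assoc [symmetric])
    qed simp
  qed
  finally show ?thesis .
qed

lemma sets_mu [measurable_cong, simp]: "sets (mu a s) = sets borel"
  by (simp add: mu_def ellipsoid_surface_def ellipsoid_surface_along_def)

lemma space_mu [simp]: "space (mu a s) = UNIV"
  by (simp add: mu_def ellipsoid_surface_def ellipsoid_surface_along_def)

text \<open>The Jacobian \<open>r ^ (n - 1)\<close> and the factor \<open>r powr - (n + 2 * s)\<close> of the kernel combine to
  the one-dimensional kernel; the remaining factor of the kernel is part of \<open>mu\<close>.\<close>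

lemma nn_integral_kernel_polar:
  fixes a :: "real ^ 'n::finite" and F :: "real ^ 'n \<Rightarrow> ennreal"
  assumes a: "\<And>i. a $ i > 0" and F [measurable]: "F \<in> borel_measurable borel"
  shows "(\<integral>\<^sup>+y. riesz_weight s y * F y \<partial>lborel)
    = (\<integral>\<^sup>+\<theta>. kernel_integral s F \<theta> \<partial>mu a s)"
proof -
  define j where "j = (SOME j :: 'n. True)"
  define q where "q = real CARD('n) + 2 * s"
  define G where "G \<theta> = (kernel_integral s F \<theta>)" for \<theta>
  have G_meas: "G \<in> borel_measurable borel"
    unfolding G_def by (intro lborel.borel_measurable_nn_integral) (simp add: case_prod_unfold, measurable)
  have "(\<integral>\<^sup>+y. ennreal (1 / norm y powr q) * F y \<partial>lborel)
    = (\<integral>\<^sup>+(\<epsilon>, z). sheet_weight j a z *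
        (\<integral>\<^sup>+r. indicator {0<..} r * ennreal (r ^ (CARD('n) - 1)) *
          (ennreal (1 / norm (r *\<^sub>R sheet_point j a \<epsilon> z) powr q) * F (r *\<^sub>R sheet_point j a \<epsilon> z)) \<partial>lborel)
        \<partial>sheet_measure j)"
    by (rule nn_integral_lborel_polar[OF _ a]) measurable
  also have "\<dots> = (\<integral>\<^sup>+(\<epsilon>, z). sheet_weight j a z *
        (ennreal (1 / norm (sheet_point j a \<epsilon> z) powr q) * G (sheet_point j a \<epsilon> z)) \<partial>sheet_measure j)"
  proof (intro nn_integral_cong, clarify)
    fix \<epsilon> z
    define \<theta> where "\<theta> = sheet_point j a \<epsilon> z"
    have "(\<integral>\<^sup>+r. indicator {0<..} r * ennreal (r ^ (CARD('n) - 1)) *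
          (ennreal (1 / norm (r *\<^sub>R \<theta>) powr q) * F (r *\<^sub>R \<theta>)) \<partial>lborel)
      = (\<integral>\<^sup>+r. ennreal (1 / norm \<theta> powr q) * (indicator {0<..} r * (ennreal (r powr (- 1 - 2 * s)) * F (r *\<^sub>R \<theta>))) \<partial>lborel)"
    proof (intro nn_integral_cong)
      fix r :: real
      show "indicator {0<..} r * ennreal (r ^ (CARD('n) - 1)) *
          (ennreal (1 / norm (r *\<^sub>R \<theta>) powr q) * F (r *\<^sub>R \<theta>))
        = ennreal (1 / norm \<theta> powr q) * (indicator {0<..} r * (ennreal (r powr (- 1 - 2 * s)) * F (r *\<^sub>R \<theta>)))"
      proof (cases "r > 0")
        case True
        have "r ^ (CARD('n) - 1) = r powr (real CARD('n) - 1)"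
          using True by (simp add: of_nat_diff flip: powr_realpow)
        moreover have "norm (r *\<^sub>R \<theta>) powr q = r powr q * norm \<theta> powr q"
          using True by (simp add: powr_mult)
        moreover have "r powr (real CARD('n) - 1) / r powr q = r powr (- 1 - 2 * s)"
          by (simp add: q_def flip: powr_diff)
        ultimately have "r ^ (CARD('n) - 1) * (1 / norm (r *\<^sub>R \<theta>) powr q) = 1 / norm \<theta> powr q * r powr (- 1 - 2 * s)"
          by (metis (no_types, opaque_lifting) divide_divide_eq_left mult.commute times_divide_eq_right mult.right_neutral)
        then have "ennreal (r ^ (CARD('n) - 1)) * ennreal (1 / norm (r *\<^sub>R \<theta>) powr q)
            = ennreal (1 / norm \<theta> powr q) * ennreal (r powr (- 1 - 2 * s))"
          using True by (simp flip: ennreal_mult)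
        then show ?thesis using True by (simp add: mult.assoc [symmetric])
      qed simp
    qed
    also have "\<dots> = ennreal (1 / norm \<theta> powr q) * G \<theta>"
      unfolding G_def by (rule nn_integral_cmult) measurable
    finally show "sheet_weight j a z *
        (\<integral>\<^sup>+r. indicator {0<..} r * ennreal (r ^ (CARD('n) - 1)) *
          (ennreal (1 / norm (r *\<^sub>R sheet_point j a \<epsilon> z) powr q) * F (r *\<^sub>R sheet_point j a \<epsilon> z)) \<partial>lborel)
      = sheet_weight j a z *
        (ennreal (1 / norm (sheet_point j a \<epsilon> z) powr q) * G (sheet_point j a \<epsilon> z))"
      by (simp only: \<theta>_def)
  qed
  also have "\<dots> = (\<integral>\<^sup>+\<theta>. G \<theta> \<partial>mu a s)"
    using nn_integral_mu[OF a G_meas, of s] by (simp only: q_def j_def)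
  finally show ?thesis by (simp only: q_def G_def)
qed

section \<open>Finiteness and symmetry of the measure\<close>

lemma norm_a_square: "(\<And>i. a $ i > 0) \<Longrightarrow> (norm_a a x)\<^sup>2 = (\<Sum>i\<in>UNIV. a $ i * (x $ i)\<^sup>2)"
  unfolding norm_a_eq by (intro real_sqrt_pow2 sum_nonneg mult_nonneg_nonneg) (auto intro: less_imp_le)

lemma norm_a_nonneg: "(\<And>i. a $ i > 0) \<Longrightarrow> norm_a a x \<ge> 0"
  unfolding norm_a_eq by (intro real_sqrt_ge_zero sum_nonneg mult_nonneg_nonneg) (auto intro: less_imp_le)

lemma sqrt_a_nth_le_norm_a:
  fixes a x :: "real ^ 'n::finite"
  assumes a: "\<And>i. a $ i > 0"
  shows "sqrt (a $ i) * \<bar>x $ i\<bar> \<le> norm_a a x"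
proof -
  have "(sqrt (a $ i) * \<bar>x $ i\<bar>)\<^sup>2 = a $ i * (x $ i)\<^sup>2"
    using a[of i] by (simp add: power_mult_distrib less_imp_le)
  also have "\<dots> \<le> (norm_a a x)\<^sup>2"
    unfolding norm_a_square[OF a] using a by (intro member_le_sum) (auto intro!: mult_nonneg_nonneg intro: less_imp_le)
  finally show ?thesis using norm_a_nonneg[OF a] by (rule power2_le_imp_le)
qed

lemma norm_a_scaleR: "norm_a a (r *\<^sub>R x) = \<bar>r\<bar> * norm_a a x"
proof -
  have "(\<Sum>i\<in>UNIV. a $ i * ((r *\<^sub>R x) $ i)\<^sup>2) = r\<^sup>2 * (\<Sum>i\<in>UNIV. a $ i * (x $ i)\<^sup>2)"
    unfolding sum_distrib_left by (intro sum.cong refl) (simp add: power_mult_distrib)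
  then show ?thesis by (simp add: norm_a_eq real_sqrt_mult)
qed

lemma continuous_on_norm_a [continuous_intros]:
  "continuous_on A f \<Longrightarrow> continuous_on A (\<lambda>x. norm_a a (f x))"
  unfolding norm_a_eq by (intro continuous_intros)

lemma norm_a_measurable [measurable]: "norm_a a \<in> borel_measurable borel"
  by (intro borel_measurable_continuous_onI continuous_intros)

lemma frontier_ellipsoidI:
  assumes "norm_a a \<theta> = 1"
  shows "\<theta> \<in> frontier (ellipsoid a)"
proof -
  have "open (ellipsoid a)"
    unfolding ellipsoid_def by (intro open_Collect_less continuous_intros)
  then have "interior (ellipsoid a) = ellipsoid a" by (rule interior_open)
  moreover have "\<theta> \<notin> ellipsoid a" using assms by (simp add: ellipsoid_def)
  moreover have "\<theta> \<in> closure (ellipsoid a)"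
    unfolding closure_sequential
  proof (intro exI conjI allI)
    fix i :: nat
    show "(1 - 1 / real (Suc i)) *\<^sub>R \<theta> \<in> ellipsoid a"
      using assms by (simp add: ellipsoid_def norm_a_scaleR)
    have "(\<lambda>i. (1 - 1 / real (Suc i)) *\<^sub>R \<theta>) \<longlonglongrightarrow> (1 - 0) *\<^sub>R \<theta>"
      by (intro tendsto_intros LIMSEQ_Suc lim_1_over_n)
    then show "(\<lambda>i. (1 - 1 / real (Suc i)) *\<^sub>R \<theta>) \<longlonglongrightarrow> \<theta>" by simp
  qed
  ultimately show ?thesis by (simp add: frontier_def)
qed

definition reflect :: "'n::finite \<Rightarrow> real ^ 'n \<Rightarrow> real ^ 'n" where
  "reflect j x = (\<chi> i. if i = j then - x $ i else x $ i)"

lemma reflect_measurable [measurable]: "reflect (j :: 'n::finite) \<in> borel_measurable borel"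
  unfolding reflect_def [abs_def]
proof (rule measurable_vec_lambda)
  fix i
  have "(\<lambda>x :: real ^ 'n. x $ i) \<in> borel_measurable borel"
    by (rule measurable_vec_nth) simp
  then show "(\<lambda>x :: real ^ 'n. if i = j then - x $ i else x $ i) \<in> borel_measurable borel"
    by (cases "i = j") auto
qed

lemma nn_integral_lborel_reflect:
  fixes F :: "real ^ 'n::finite \<Rightarrow> ennreal"
  assumes [measurable]: "F \<in> borel_measurable borel"
  shows "(\<integral>\<^sup>+y. F (reflect j y) \<partial>lborel) = (\<integral>\<^sup>+y. F y \<partial>lborel)"
proof -
  have "(\<integral>\<^sup>+y. F (reflect j y) \<partial>lborel)
      = (\<integral>\<^sup>+y. \<integral>\<^sup>+t. F (reflect j (\<chi> i. if i = j then t else y i)) \<partial>lborel \<partial>hyperplane_lborel j)"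
    by (rule nn_integral_lborel_vec_split) measurable
  also have "\<dots> = (\<integral>\<^sup>+y. \<integral>\<^sup>+t. F (\<chi> i. if i = j then t else y i) \<partial>lborel \<partial>hyperplane_lborel j)"
  proof (rule nn_integral_cong)
    fix y :: "'n \<Rightarrow> real"
    have [measurable]: "(\<lambda>t. \<chi> i. if i = j then t else y i) \<in> borel_measurable borel"
      by (intro measurable_vec_lambda) auto
    have "reflect j (\<chi> i. if i = j then t else y i) = (\<chi> i. if i = j then 0 + - 1 * t else y i)" for t
      by (simp add: reflect_def vec_eq_iff)
    then show "(\<integral>\<^sup>+t. F (reflect j (\<chi> i. if i = j then t else y i)) \<partial>lborel)
        = (\<integral>\<^sup>+t. F (\<chi> i. if i = j then t else y i) \<partial>lborel)"
      by (subst (2) nn_integral_real_affine[of _ "- 1" 0]) auto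
  qed
  also have "\<dots> = (\<integral>\<^sup>+y. F y \<partial>lborel)"
    by (rule nn_integral_lborel_vec_split [symmetric]) measurable
  finally show ?thesis .
qed

lemma norm_a_reflect: "norm_a a (reflect j y) = norm_a a y"
  unfolding norm_a_eq by (intro arg_cong[of _ _ sqrt] sum.cong) (auto simp: reflect_def)

lemma norm_reflect: "norm (reflect j y) = norm y"
  unfolding norm_vec_def L2_set_def by (intro arg_cong[of _ _ sqrt] sum.cong) (auto simp: reflect_def)

lemma reflect_scaleR: "reflect j (r *\<^sub>R y) = r *\<^sub>R reflect j y"
  by (simp add: reflect_def vec_eq_iff)

text \<open>The shell \<open>1 < norm_a < 2\<close> over a set of directions: its kernel mass is a fixed positive
  multiple of the \<open>mu\<close>-mass, so finiteness and symmetries of \<open>mu\<close> follow from those of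
  Lebesgue measure.\<close>

definition shell_mass :: "real \<Rightarrow> ennreal" where
  "shell_mass s = (\<integral>\<^sup>+r. indicator {1<..<2} r * ennreal (r powr (- 1 - 2 * s)) \<partial>lborel)"

definition shell_kernel :: "real ^ 'n::finite \<Rightarrow> real \<Rightarrow> (real ^ 'n) set \<Rightarrow> real ^ 'n \<Rightarrow> ennreal" where
  "shell_kernel a s X y = riesz_weight s y *
     (indicator X (y /\<^sub>R norm_a a y) * indicator {1<..<2} (norm_a a y))"

context
  fixes a :: "real ^ 'n::finite" and s :: real
  assumes a: "\<And>i. a $ i > 0" and s: "s > 0"
begin

lemma AE_mu_norm_a: "AE \<theta> in mu a s. norm_a a \<theta> = 1"
proof -
  define N where "N = {\<theta>. norm_a a \<theta> \<noteq> 1}"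
  have N: "N \<in> sets borel" unfolding N_def by measurable
  define j where "j = (SOME j :: 'n. True)"
  have "emeasure (mu a s) N = (\<integral>\<^sup>+\<theta>. indicator N \<theta> \<partial>mu a s)"
    using N by simp
  also have "\<dots> = (\<integral>\<^sup>+(\<epsilon>, z). sheet_weight j a z *
        (riesz_weight s (sheet_point j a \<epsilon> z) * indicator N (sheet_point j a \<epsilon> z)) \<partial>sheet_measure j)"
    using nn_integral_mu[OF a, of "indicator N" s] N by (simp add: j_def)
  also have "\<dots> = (\<integral>\<^sup>+x. 0 \<partial>sheet_measure j)"
    by (intro nn_integral_cong)
       (auto simp: space_pair_measure N_def norm_a_sheet_point[OF a] split: split_indicator)
  finally have "N \<in> null_sets (mu a s)" using N by (simp add: null_sets_def)
  then show ?thesis by (rule AE_I') (auto simp: N_def)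
qed

lemma nn_integral_mu_cong:
  "(\<And>\<theta>. norm_a a \<theta> = 1 \<Longrightarrow> f \<theta> = g \<theta>) \<Longrightarrow> (\<integral>\<^sup>+\<theta>. f \<theta> \<partial>mu a s) = (\<integral>\<^sup>+\<theta>. g \<theta> \<partial>mu a s)"
  by (intro nn_integral_cong_AE eventually_mono[OF AE_mu_norm_a])

lemma integral_mu_cong:
  fixes f g :: "real ^ 'n \<Rightarrow> real"
  assumes "f \<in> borel_measurable borel" "g \<in> borel_measurable borel"
    and "\<And>\<theta>. norm_a a \<theta> = 1 \<Longrightarrow> f \<theta> = g \<theta>"
  shows "(LINT \<theta>|mu a s. f \<theta>) = (LINT \<theta>|mu a s. g \<theta>)"
  using assms by (intro integral_cong_AE eventually_mono[OF AE_mu_norm_a]) auto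

lemma set_integral_frontier_mu:
  fixes f :: "real ^ 'n \<Rightarrow> real"
  assumes [measurable]: "f \<in> borel_measurable borel"
  shows "(LINT \<theta>:frontier (ellipsoid a)|mu a s. f \<theta>) = (LINT \<theta>|mu a s. f \<theta>)"
proof -
  have [measurable]: "frontier (ellipsoid a) \<in> sets borel" by simp
  show ?thesis
    unfolding set_lebesgue_integral_def
    by (rule integral_mu_cong) (auto simp: frontier_ellipsoidI)
qed

lemma shell_mass_bounds: "shell_mass s \<noteq> 0" "shell_mass s \<noteq> \<infinity>"
proof -
  have "ennreal (2 powr (- 1 - 2 * s)) = (\<integral>\<^sup>+r. ennreal (2 powr (- 1 - 2 * s)) * indicator {1<..<2::real} r \<partial>lborel)"
    by (subst nn_integral_cmult_indicator) auto
  also have "\<dots> \<le> shell_mass s"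
    unfolding shell_mass_def
    by (intro nn_integral_mono) (use s in \<open>auto split: split_indicator intro!: ennreal_leI powr_mono2'\<close>)
  finally have "shell_mass s \<ge> ennreal (2 powr (- 1 - 2 * s))" .
  moreover have "ennreal (2 powr (- 1 - 2 * s)) > 0" by simp
  ultimately show "shell_mass s \<noteq> 0" by (metis not_le)
  have "shell_mass s \<le> (\<integral>\<^sup>+r. indicator {1<..<2::real} r \<partial>lborel)"
    unfolding shell_mass_def
  proof (intro nn_integral_mono)
    fix r :: real
    have "r powr (- 1 - 2 * s) \<le> 1" if "r > 1"
      using powr_mono[of "- 1 - 2 * s" 0 r] that s by simp
    then show "indicator {1<..<2} r * ennreal (r powr (- 1 - 2 * s)) \<le> indicator {1<..<2} r"
      by (auto split: split_indicator)
  qed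
  also have "\<dots> = 1" by simp
  finally show "shell_mass s \<noteq> \<infinity>" by (auto simp: top_unique)
qed

lemma shell_mass_times_mu:
  assumes X [measurable]: "X \<in> sets borel"
  shows "(\<integral>\<^sup>+y. shell_kernel a s X y \<partial>lborel) = shell_mass s * emeasure (mu a s) X"
proof -
  define F where "F y = (indicator X (y /\<^sub>R norm_a a y) * indicator {1<..<2} (norm_a a y) :: ennreal)" for y
  have F: "F \<in> borel_measurable borel"
    unfolding F_def by measurable
  have "(\<integral>\<^sup>+y. shell_kernel a s X y \<partial>lborel)
      = (\<integral>\<^sup>+\<theta>. kernel_integral s F \<theta> \<partial>mu a s)"
    using nn_integral_kernel_polar[OF a F, of s] by (simp add: shell_kernel_def F_def)
  also have "\<dots> = (\<integral>\<^sup>+\<theta>. shell_mass s * indicator X \<theta> \<partial>mu a s)"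
  proof (rule nn_integral_mu_cong)
    fix \<theta> assume \<theta>: "norm_a a \<theta> = 1"
    have "(kernel_integral s F \<theta>)
       = (\<integral>\<^sup>+r. (indicator {1<..<2} r * ennreal (r powr (- 1 - 2 * s))) * indicator X \<theta> \<partial>lborel)"
      by (intro nn_integral_cong) (auto simp: F_def norm_a_scaleR \<theta> split: split_indicator)
    then show "(kernel_integral s F \<theta>)
       = shell_mass s * indicator X \<theta>"
      by (simp add: shell_mass_def nn_integral_multc)
  qed
  also have "\<dots> = shell_mass s * emeasure (mu a s) X"
    by (rule nn_integral_cmult_indicator) simp
  finally show ?thesis .
qed

lemma finite_measure_mu: "finite_measure (mu a s)"
proof
  define lo where "lo = Min (range (\<lambda>i. a $ i))"
  define hi where "hi = Max (range (\<lambda>i. a $ i))"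
  have lo: "lo > 0" "\<And>i. lo \<le> a $ i" and hi: "\<And>i. a $ i \<le> hi"
    using a by (auto simp: lo_def hi_def)
  have hi_pos: "hi > 0" using a[of undefined] hi[of undefined] by linarith
  have norm_sq: "(norm y)\<^sup>2 = (\<Sum>i\<in>UNIV. (y $ i)\<^sup>2)" for y :: "real ^ 'n"
    by (simp add: norm_vec_def L2_set_def sum_nonneg)
  have lower: "lo * (norm y)\<^sup>2 \<le> (norm_a a y)\<^sup>2" and upper: "(norm_a a y)\<^sup>2 \<le> hi * (norm y)\<^sup>2" for y
    unfolding norm_a_square[OF a] norm_sq sum_distrib_left
    using lo hi by (auto intro!: sum_mono mult_right_mono)
  define q where "q = real CARD('n) + 2 * s"
  define B where "B = 1 / (sqrt (1 / hi)) powr q"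
  define R where "R = sqrt (4 / lo)"
  have "(\<integral>\<^sup>+y. shell_kernel a s UNIV y \<partial>lborel) \<le> (\<integral>\<^sup>+y. ennreal B * indicator (cball (0 :: real ^ 'n) R) y \<partial>lborel)"
  proof (intro nn_integral_mono)
    fix y :: "real ^ 'n"
    show "shell_kernel a s UNIV y \<le> ennreal B * indicator (cball 0 R) y"
    proof (cases "norm_a a y \<in> {1<..<2}")
      case True
      have "1\<^sup>2 \<le> (norm_a a y)\<^sup>2" "(norm_a a y)\<^sup>2 \<le> 2\<^sup>2"
        using True by (intro power_mono; simp)+
      then have "1 \<le> hi * (norm y)\<^sup>2" "lo * (norm y)\<^sup>2 \<le> 4"
        using lower[of y] upper[of y] by simp_all
      then have "1 / hi \<le> (norm y)\<^sup>2" "(norm y)\<^sup>2 \<le> 4 / lo"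
        using hi_pos lo by (simp_all add: field_simps)
      then have le: "sqrt (1 / hi) \<le> norm y" "norm y \<le> R"
        by (auto simp: R_def intro: real_le_lsqrt real_le_rsqrt)
      have "1 / norm y powr q \<le> B"
        unfolding B_def using le hi_pos s by (intro divide_left_mono powr_mono2 mult_pos_pos) (auto simp: q_def)
      then show ?thesis
        using le True by (simp add: shell_kernel_def q_def ennreal_leI)
    qed (simp add: shell_kernel_def)
  qed
  also have "\<dots> = ennreal B * emeasure lborel (cball 0 R :: (real ^ 'n) set)"
    by (rule nn_integral_cmult_indicator) simp
  also have "\<dots> < \<infinity>"
    using emeasure_bounded_finite[OF bounded_cball, of "0 :: real ^ 'n" R]
    by (simp add: ennreal_mult_less_top)
  finally have "shell_mass s * emeasure (mu a s) UNIV < \<infinity>"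
    by (subst (asm) shell_mass_times_mu) auto
  then show "emeasure (mu a s) (space (mu a s)) \<noteq> \<infinity>"
    using shell_mass_bounds by (auto simp: ennreal_mult_less_top)
qed

text \<open>The definition of \<open>mu\<close> singles out one coordinate; the shells do not, and Lebesgue measure is
  invariant under all reflections.\<close>

lemma distr_mu_reflect: "distr (mu a s) borel (reflect j) = mu a s"
proof (rule measure_eqI)
  fix X assume "X \<in> sets (distr (mu a s) borel (reflect j))"
  then have X [measurable]: "X \<in> sets borel" by simp
  have pre [measurable]: "reflect j -` X \<in> sets borel"
    using measurable_sets[OF reflect_measurable X] by simp
  have "shell_mass s * emeasure (mu a s) (reflect j -` X) = (\<integral>\<^sup>+y. shell_kernel a s (reflect j -` X) y \<partial>lborel)"
    by (rule shell_mass_times_mu [symmetric]) measurable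
  also have "\<dots> = (\<integral>\<^sup>+y. shell_kernel a s X (reflect j y) \<partial>lborel)"
  proof (rule nn_integral_cong)
    fix y :: "real ^ 'n"
    have "indicator (reflect j -` X) z = (indicator X (reflect j z) :: ennreal)" for z
      by (simp add: indicator_def)
    then show "shell_kernel a s (reflect j -` X) y = shell_kernel a s X (reflect j y)"
      by (simp add: shell_kernel_def norm_a_reflect norm_reflect reflect_scaleR)
  qed
  also have "\<dots> = (\<integral>\<^sup>+y. shell_kernel a s X y \<partial>lborel)"
    by (rule nn_integral_lborel_reflect) (unfold shell_kernel_def, measurable)
  also have "\<dots> = shell_mass s * emeasure (mu a s) X"
    by (rule shell_mass_times_mu) measurable
  finally have "emeasure (mu a s) (reflect j -` X) = emeasure (mu a s) X"
    using shell_mass_bounds by (simp add: ennreal_mult_cancel_left)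
  then show "emeasure (distr (mu a s) borel (reflect j)) X = emeasure (mu a s) X"
    by (subst emeasure_distr) auto
qed simp

lemma integral_mu_odd:
  fixes f :: "real ^ 'n \<Rightarrow> real"
  assumes [measurable]: "f \<in> borel_measurable borel" and odd: "\<And>x. f (reflect j x) = - f x"
  shows "(LINT \<theta>|mu a s. f \<theta>) = 0"
proof -
  have "(LINT \<theta>|mu a s. f \<theta>) = (LINT \<theta>|distr (mu a s) borel (reflect j). f \<theta>)"
    by (simp only: distr_mu_reflect)
  also have "\<dots> = (LINT \<theta>|mu a s. f (reflect j \<theta>))"
    by (rule integral_distr) measurable
  also have "\<dots> = - (LINT \<theta>|mu a s. f \<theta>)"
    by (simp add: odd)
  finally show ?thesis by simp
qed

lemma integrable_mu_bounded:
  fixes f :: "real ^ 'n \<Rightarrow> real"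
  assumes "f \<in> borel_measurable borel" and "\<And>\<theta>. norm_a a \<theta> = 1 \<Longrightarrow> \<bar>f \<theta>\<bar> \<le> B"
  shows "integrable (mu a s) f"
proof -
  interpret finite_measure "mu a s" by (rule finite_measure_mu)
  show ?thesis
    using assms by (intro integrable_const_bound[of _ B] eventually_mono[OF AE_mu_norm_a]) auto
qed

end

section \<open>Integration along rays\<close>

definition ray_measure :: "real \<Rightarrow> real measure" where
  "ray_measure s = density lborel (\<lambda>r. ennreal (indicator {0<..} r * r powr (- 1 - 2 * s)))"

lemma sigma_finite_ray_measure: "sigma_finite_measure (ray_measure s)"
  unfolding ray_measure_def
  by (subst sigma_finite_measure.sigma_finite_iff_density_finite[OF sigma_finite_lborel]) auto

lemma sets_ray_measure [measurable_cong, simp]: "sets (ray_measure s) = sets borel"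
  by (simp add: ray_measure_def)

lemma ray_integral:
  fixes f :: "real \<Rightarrow> real"
  assumes [measurable]: "f \<in> borel_measurable borel"
  shows "integrable (ray_measure s) f \<longleftrightarrow> set_integrable lborel {0<..} (\<lambda>r. f r * r powr (- 1 - 2 * s))"
    and "(LINT r|ray_measure s. f r) = (LINT r:{0<..}|lborel. f r * r powr (- 1 - 2 * s))"
  unfolding ray_measure_def set_integrable_def set_lebesgue_integral_def
  by (subst integrable_density integral_density; simp add: mult_ac)+

lemma kernel_measure_eq_distr:
  fixes a :: "real ^ 'n::finite"
  assumes a: "\<And>i. a $ i > 0"
  shows "density lborel (\<lambda>y. riesz_weight s y)
    = distr (mu a s \<Otimes>\<^sub>M ray_measure s) borel (\<lambda>(\<theta>, r). r *\<^sub>R \<theta>)"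
proof (rule measure_eqI)
  interpret R: sigma_finite_measure "ray_measure s" by (rule sigma_finite_ray_measure)
  fix X assume "X \<in> sets (density lborel (\<lambda>y :: real ^ 'n. riesz_weight s y))"
  then have X [measurable]: "X \<in> sets borel" by simp
  have "emeasure (distr (mu a s \<Otimes>\<^sub>M ray_measure s) borel (\<lambda>(\<theta>, r). r *\<^sub>R \<theta>)) X
      = (\<integral>\<^sup>+y. indicator X y \<partial>distr (mu a s \<Otimes>\<^sub>M ray_measure s) borel (\<lambda>(\<theta>, r). r *\<^sub>R \<theta>))"
    by simp
  also have "\<dots> = (\<integral>\<^sup>+p. indicator X (snd p *\<^sub>R fst p) \<partial>(mu a s \<Otimes>\<^sub>M ray_measure s))"
    by (subst nn_integral_distr) (simp_all add: case_prod_unfold)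
  also have "\<dots> = (\<integral>\<^sup>+\<theta>. \<integral>\<^sup>+r. indicator X (r *\<^sub>R \<theta>) \<partial>ray_measure s \<partial>mu a s)"
    by (subst R.nn_integral_fst [symmetric]) simp_all
  also have "\<dots> = (\<integral>\<^sup>+\<theta>. kernel_integral s (indicator X) \<theta> \<partial>mu a s)"
    unfolding ray_measure_def
    by (intro nn_integral_cong, subst nn_integral_density)
       (auto intro!: nn_integral_cong split: split_indicator)
  also have "\<dots> = (\<integral>\<^sup>+y. riesz_weight s y * indicator X y \<partial>lborel)"
    by (rule nn_integral_kernel_polar[OF a, symmetric]) measurable
  also have "\<dots> = emeasure (density lborel (\<lambda>y. riesz_weight s y)) X"
    by (subst emeasure_density) auto
  finally show "emeasure (density lborel (\<lambda>y. riesz_weight s y)) X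
    = emeasure (distr (mu a s \<Otimes>\<^sub>M ray_measure s) borel (\<lambda>(\<theta>, r). r *\<^sub>R \<theta>)) X" by simp
qed simp

lemma integral_kernel_polar:
  fixes a :: "real ^ 'n::finite" and F :: "real ^ 'n \<Rightarrow> real"
  assumes a: "\<And>i. a $ i > 0" and s: "s > 0"
    and F [measurable]: "F \<in> borel_measurable borel"
    and g: "set_integrable lborel {0<..} g"
    and bound: "\<And>\<theta> r. norm_a a \<theta> = 1 \<Longrightarrow> r > 0 \<Longrightarrow> \<bar>F (r *\<^sub>R \<theta>) * r powr (- 1 - 2 * s)\<bar> \<le> g r"
  shows "(LINT y|lborel. F y / norm y powr (real CARD('n) + 2 * s))
    = (LINT \<theta>|mu a s. (LINT r:{0<..}|lborel. F (r *\<^sub>R \<theta>) * r powr (- 1 - 2 * s)))"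
proof -
  interpret M: finite_measure "mu a s" by (rule finite_measure_mu[OF a s])
  interpret R: sigma_finite_measure "ray_measure s" by (rule sigma_finite_ray_measure)
  interpret P: pair_sigma_finite "mu a s" "ray_measure s" ..
  have meas: "(\<lambda>p. F (snd p *\<^sub>R fst p)) \<in> borel_measurable (mu a s \<Otimes>\<^sub>M ray_measure s)"
    by measurable
  have line [measurable]: "(\<lambda>r. F (r *\<^sub>R \<theta>)) \<in> borel_measurable borel" for \<theta> by measurable
  have line_int: "set_integrable lborel {0<..} (\<lambda>r. F (r *\<^sub>R \<theta>) * r powr (- 1 - 2 * s))"
    if "norm_a a \<theta> = 1" for \<theta>
    using bound[OF that]
    by (intro set_integrable_bound[OF g] AE_I2)
       (auto simp: set_borel_measurable_def intro: order.trans[OF _ abs_ge_self])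
  have ray_int: "integrable (ray_measure s) (\<lambda>r. F (r *\<^sub>R \<theta>))" if "norm_a a \<theta> = 1" for \<theta>
    using line_int[OF that] by (simp add: ray_integral)
  define B where "B = (LINT r:{0<..}|lborel. g r)"
  have "integrable (mu a s \<Otimes>\<^sub>M ray_measure s) (\<lambda>(\<theta>, r). F (r *\<^sub>R \<theta>))"
  proof (rule P.Fubini_integrable)
    show "(\<lambda>(\<theta>, r). F (r *\<^sub>R \<theta>)) \<in> borel_measurable (mu a s \<Otimes>\<^sub>M ray_measure s)"
      using meas by (simp add: case_prod_unfold)
    show "AE \<theta> in mu a s. integrable (ray_measure s) (\<lambda>r. case (\<theta>, r) of (\<theta>, r) \<Rightarrow> F (r *\<^sub>R \<theta>))"
      using ray_int by (auto intro: eventually_mono[OF AE_mu_norm_a[OF a s]])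
    show "integrable (mu a s) (\<lambda>\<theta>. LINT r|ray_measure s. norm (case (\<theta>, r) of (\<theta>, r) \<Rightarrow> F (r *\<^sub>R \<theta>)))"
    proof (rule integrable_mu_bounded[OF a s])
      show "(\<lambda>\<theta>. LINT r|ray_measure s. norm (case (\<theta>, r) of (\<theta>, r) \<Rightarrow> F (r *\<^sub>R \<theta>))) \<in> borel_measurable borel"
        by (intro R.borel_measurable_lebesgue_integral) (simp add: case_prod_unfold)
      fix \<theta> assume \<theta>: "norm_a a \<theta> = 1"
      have "(LINT r|ray_measure s. \<bar>F (r *\<^sub>R \<theta>)\<bar>) = (LINT r:{0<..}|lborel. \<bar>F (r *\<^sub>R \<theta>)\<bar> * r powr (- 1 - 2 * s))"
        by (rule ray_integral) measurable
      also have "\<dots> \<le> B"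
        unfolding B_def
      proof (rule set_integral_mono)
        show "set_integrable lborel {0<..} (\<lambda>r. \<bar>F (r *\<^sub>R \<theta>)\<bar> * r powr (- 1 - 2 * s))"
          using set_integrable_abs[OF line_int[OF \<theta>]] by (simp add: abs_mult)
        show "\<bar>F (r *\<^sub>R \<theta>)\<bar> * r powr (- 1 - 2 * s) \<le> g r" if "r \<in> {0<..}" for r
          using bound[OF \<theta>, of r] that by (simp add: abs_mult)
      qed (rule g)
      finally show "\<bar>(LINT r|ray_measure s. norm (case (\<theta>, r) of (\<theta>, r) \<Rightarrow> F (r *\<^sub>R \<theta>)))\<bar> \<le> B"
        by (simp add: integral_nonneg_AE)
    qed
  qed
  then have int: "integrable (mu a s \<Otimes>\<^sub>M ray_measure s) (\<lambda>p. F (snd p *\<^sub>R fst p))"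
    by (simp add: case_prod_unfold)
  have "(LINT y|lborel. F y / norm y powr (real CARD('n) + 2 * s))
      = (LINT y|density lborel (\<lambda>y. riesz_weight s y). F y)"
    by (subst integral_density) auto
  also have "\<dots> = (LINT p|(mu a s \<Otimes>\<^sub>M ray_measure s). F (snd p *\<^sub>R fst p))"
    unfolding kernel_measure_eq_distr[OF a] by (subst integral_distr) (simp_all add: case_prod_unfold)
  also have "\<dots> = (LINT \<theta>|mu a s. (LINT r|ray_measure s. F (r *\<^sub>R \<theta>)))"
    using P.integral_fst'[OF int] by simp
  also have "\<dots> = (LINT \<theta>|mu a s. (LINT r:{0<..}|lborel. F (r *\<^sub>R \<theta>) * r powr (- 1 - 2 * s)))"
    by (simp add: ray_integral)
  finally show ?thesis .
qed

definition inner_a :: "real ^ 'n::finite \<Rightarrow> real ^ 'n \<Rightarrow> real ^ 'n \<Rightarrow> real" where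
  "inner_a a x \<theta> = (\<Sum>i\<in>UNIV. a $ i * x $ i * \<theta> $ i)"

lemma inner_a_measurable [measurable]: "inner_a a x \<in> borel_measurable borel"
  unfolding inner_a_def [abs_def] by measurable

text \<open>The coefficient of \<open>u ^ p\<close> in \<open>(1 - sqrt (a $ k) * (x + u *\<^sub>R \<theta>) $ k)\<^sup>2\<close>.\<close>

definition ray_coeff :: "real ^ 'n::finite \<Rightarrow> real ^ 'n \<Rightarrow> 'n \<Rightarrow> real ^ 'n \<Rightarrow> nat \<Rightarrow> real" where
  "ray_coeff a x k \<theta> p = (if p = 0 then (1 - sqrt (a $ k) * x $ k)\<^sup>2
     else if p = 1 then - 2 * (1 - sqrt (a $ k) * x $ k) * (sqrt (a $ k) * \<theta> $ k)
     else (sqrt (a $ k) * \<theta> $ k)\<^sup>2)"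

context
  fixes a x :: "real ^ 'n::finite" and s :: real and k :: 'n and m :: nat
  assumes a: "\<And>i. a $ i > 0" and s: "s > 0" and m: "s < real m" and x: "x \<in> ellipsoid a"
begin

lemma norm_a_line:
  assumes \<theta>: "norm_a a \<theta> = 1"
  shows "1 - (norm_a a (x + u *\<^sub>R \<theta>))\<^sup>2 = quad (1 - (norm_a a x)\<^sup>2) (inner_a a x \<theta>) u"
proof -
  have "(norm_a a (x + u *\<^sub>R \<theta>))\<^sup>2 = (norm_a a x)\<^sup>2 + 2 * inner_a a x \<theta> * u + u\<^sup>2 * (norm_a a \<theta>)\<^sup>2"
    unfolding norm_a_square[OF a] inner_a_def sum_distrib_left sum_distrib_right sum.distrib [symmetric]
    by (intro sum.cong refl) (simp add: power2_eq_square algebra_simps)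
  then show ?thesis using \<theta> by (simp add: quad_def)
qed

lemma gap_bounds: "0 < 1 - (norm_a a x)\<^sup>2" "1 - (norm_a a x)\<^sup>2 \<le> 1"
  using x norm_a_nonneg[OF a, of x] by (auto simp: ellipsoid_def abs_square_less_1)

text \<open>The restriction of \<open>1 - (norm_a a y)\<^sup>2\<close> to the line is at most \<open>1\<close>; evaluating it at
  \<open>u = 1\<close> and \<open>u = - 1\<close> gives the bound.\<close>

lemma inner_a_bound:
  assumes \<theta>: "norm_a a \<theta> = 1"
  shows "\<bar>inner_a a x \<theta>\<bar> \<le> 1"
proof -
  have "quad (1 - (norm_a a x)\<^sup>2) (inner_a a x \<theta>) u \<le> 1" for u
    unfolding norm_a_line[OF \<theta>, symmetric] by simp
  from this[of 1] this[of "- 1"] gap_bounds show ?thesis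
    by (simp add: quad_def)
qed

lemma restriction_to_line:
  assumes \<theta>: "norm_a a \<theta> = 1"
  shows "(1 - sqrt (a $ k) * (x + u *\<^sub>R \<theta>) $ k)\<^sup>2 * u_s a s (x + u *\<^sub>R \<theta>)
    = (\<Sum>p\<le>2. ray_coeff a x k \<theta> p * real_bump p (1 - (norm_a a x)\<^sup>2) (inner_a a x \<theta>) s u)"
proof -
  define W where "W = max 0 (quad (1 - (norm_a a x)\<^sup>2) (inner_a a x \<theta>) u) powr s"
  define A B where "A = 1 - sqrt (a $ k) * x $ k" and "B = sqrt (a $ k) * \<theta> $ k"
  have "u_s a s (x + u *\<^sub>R \<theta>) = W"
    unfolding u_s_def norm_a_line[OF \<theta>] W_def ..
  moreover have "1 - sqrt (a $ k) * (x + u *\<^sub>R \<theta>) $ k = A - u * B"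
    by (simp add: A_def B_def algebra_simps)
  moreover have "{..2::nat} = {0, 1, 2}" by auto
  then have "(\<Sum>p\<le>2. ray_coeff a x k \<theta> p * real_bump p (1 - (norm_a a x)\<^sup>2) (inner_a a x \<theta>) s u)
      = A\<^sup>2 * W - 2 * A * B * (u * W) + B\<^sup>2 * (u\<^sup>2 * W)"
    by (simp add: ray_coeff_def real_bump_def W_def [symmetric] A_def [symmetric] B_def [symmetric])
  moreover have "(A - u * B)\<^sup>2 * W = A\<^sup>2 * W - 2 * A * B * (u * W) + B\<^sup>2 * (u\<^sup>2 * W)"
    by (simp add: power2_eq_square algebra_simps)
  ultimately show ?thesis by simp
qed

lemma finite_diff_on_ray:
  assumes \<theta>: "norm_a a \<theta> = 1"
  shows "finite_diff m (\<lambda>z. (1 - sqrt (a $ k) * z $ k)\<^sup>2 * u_s a s z) x (r *\<^sub>R \<theta>)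
    = (\<Sum>p\<le>2. ray_coeff a x k \<theta> p * central_diff m (real_bump p (1 - (norm_a a x)\<^sup>2) (inner_a a x \<theta>) s) r)"
proof -
  define f where "f p = real_bump p (1 - (norm_a a x)\<^sup>2) (inner_a a x \<theta>) s" for p
  have "finite_diff m (\<lambda>z. (1 - sqrt (a $ k) * z $ k)\<^sup>2 * u_s a s z) x (r *\<^sub>R \<theta>)
      = (\<Sum>i = - int m..int m. diff_weight m i * (\<Sum>p\<le>2. ray_coeff a x k \<theta> p * f p (of_int i * r)))"
    unfolding finite_diff_def diff_weight_def scaleR_scaleR restriction_to_line[OF \<theta>] f_def ..
  also have "\<dots> = (\<Sum>p\<le>2. ray_coeff a x k \<theta> p * central_diff m (f p) r)"
    unfolding central_diff_def sum_distrib_left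
    by (subst sum.swap) (simp add: mult_ac)
  finally show ?thesis by (simp only: f_def)
qed

lemma ray_coeff_bound:
  assumes \<theta>: "norm_a a \<theta> = 1"
  shows "\<bar>ray_coeff a x k \<theta> p\<bar> \<le> (\<bar>1 - sqrt (a $ k) * x $ k\<bar> + 1)\<^sup>2"
proof -
  define A B where "A = 1 - sqrt (a $ k) * x $ k" and "B = sqrt (a $ k) * \<theta> $ k"
  have "\<bar>B\<bar> \<le> 1"
    using sqrt_a_nth_le_norm_a[OF a, of k \<theta>] a[of k] \<theta> by (simp add: B_def abs_mult)
  then have B: "\<bar>B\<bar> \<le> 1" "B\<^sup>2 \<le> 1" "\<bar>A\<bar> * \<bar>B\<bar> \<le> \<bar>A\<bar>"
    by (auto simp: abs_square_le_1 mult_left_le)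
  have "(\<bar>A\<bar> + 1)\<^sup>2 = A\<^sup>2 + 2 * \<bar>A\<bar> + 1"
    by (simp add: power2_sum)
  moreover have "A\<^sup>2 \<ge> 0" by simp
  ultimately have "A\<^sup>2 \<le> (\<bar>A\<bar> + 1)\<^sup>2" "2 * (\<bar>A\<bar> * \<bar>B\<bar>) \<le> (\<bar>A\<bar> + 1)\<^sup>2" "B\<^sup>2 \<le> (\<bar>A\<bar> + 1)\<^sup>2"
    using B by linarith+
  then have "\<bar>ray_coeff a x k \<theta> p\<bar> \<le> (\<bar>A\<bar> + 1)\<^sup>2"
    unfolding ray_coeff_def A_def [symmetric] B_def [symmetric]
    by (cases "p = 0"; cases "p = 1") (simp_all add: abs_mult)
  then show ?thesis by (simp only: A_def)
qed

lemma frac_laplacian_mu_integral: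
  "frac_laplacian m s (\<lambda>z. (1 - sqrt (a $ k) * z $ k)\<^sup>2 * u_s a s z) x
    = - (k_const CARD('n) s * Gamma (1 + s)) *
      (LINT \<theta>|mu a s. (\<Sum>p\<le>2. ray_coeff a x k \<theta> p * core_poly p (1 - (norm_a a x)\<^sup>2) (inner_a a x \<theta>) s))"
proof -
  define U where "U = (\<lambda>z :: real ^ 'n. (1 - sqrt (a $ k) * z $ k)\<^sup>2 * u_s a s z)"
  define c where "c = 1 - (norm_a a x)\<^sup>2"
  define b where "b = inner_a a x"
  define K where "K = (\<bar>1 - sqrt (a $ k) * x $ k\<bar> + 1)\<^sup>2"
  note c = gap_bounds[folded c_def]
  have [measurable]: "U \<in> borel_measurable borel"
    unfolding U_def u_s_def by measurable
  have F [measurable]: "finite_diff m U x \<in> borel_measurable borel"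
    unfolding finite_diff_def [abs_def] by measurable
  obtain g where g: "set_integrable lborel {0<..} g"
    and g_bound: "\<And>b p z r. \<lbrakk>\<bar>b\<bar> \<le> 1; p \<le> 2; s \<le> Re z; Re z \<le> s; \<bar>Im z\<bar> \<le> 1; 0 < r\<rbrakk> \<Longrightarrow>
       cmod (fractional_integrand m p c b z r) \<le> g r"
    using fractional_integrand_dominated[OF c s m] by metis
  have ray: "finite_diff m U x (r *\<^sub>R \<theta>) * r powr (- 1 - 2 * s)
      = (\<Sum>p\<le>2. ray_coeff a x k \<theta> p * (central_diff m (real_bump p c (b \<theta>) s) r * r powr (- 1 - 2 * s)))"
    if "norm_a a \<theta> = 1" for \<theta> r
    unfolding U_def finite_diff_on_ray[OF that] c_def b_def by (simp add: sum_distrib_right mult.assoc)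
  have b_bound: "\<bar>b \<theta>\<bar> \<le> 1" if "norm_a a \<theta> = 1" for \<theta>
    using inner_a_bound[OF that] by (simp add: b_def)
  have "(LINT y|lborel. finite_diff m U x y / norm y powr (real CARD('n) + 2 * s))
    = (LINT \<theta>|mu a s. (LINT r:{0<..}|lborel. finite_diff m U x (r *\<^sub>R \<theta>) * r powr (- 1 - 2 * s)))"
  proof (rule integral_kernel_polar[OF a s F])
    show "set_integrable lborel {0<..} (\<lambda>r. 3 * K * g r)"
      using g by (rule set_integrable_mult_right)
    fix \<theta> and r :: real assume \<theta>: "norm_a a \<theta> = 1" and r: "r > 0"
    have bump: "\<bar>central_diff m (real_bump p c (b \<theta>) s) r * r powr (- 1 - 2 * s)\<bar> \<le> g r" if "p \<le> 2" for p
      using g_bound[OF b_bound[OF \<theta>] that, of "of_real s" r] r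
      by (simp add: fractional_integrand_of_real flip: of_real_mult)
    have "\<bar>finite_diff m U x (r *\<^sub>R \<theta>) * r powr (- 1 - 2 * s)\<bar> \<le> (\<Sum>p\<le>(2::nat). K * g r)"
      unfolding ray[OF \<theta>] abs_mult
      by (rule order.trans[OF sum_abs], rule sum_mono)
         (use bump ray_coeff_bound[OF \<theta>] in \<open>auto simp: abs_mult K_def intro!: mult_mono\<close>)
    then show "\<bar>finite_diff m U x (r *\<^sub>R \<theta>) * r powr (- 1 - 2 * s)\<bar> \<le> 3 * K * g r"
      by simp
  qed
  then have "frac_laplacian m s U x
      = (LINT \<theta>|mu a s. c_const CARD('n) m s / 2 *
          (LINT r:{0<..}|lborel. finite_diff m U x (r *\<^sub>R \<theta>) * r powr (- 1 - 2 * s)))"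
    by (simp add: frac_laplacian_def)
  also have "\<dots> = (LINT \<theta>|mu a s. - (k_const CARD('n) s * Gamma (1 + s)) *
      (\<Sum>p\<le>2. ray_coeff a x k \<theta> p * core_poly p c (b \<theta>) s))"
  proof (rule integral_mu_cong[OF a s])
    show "(\<lambda>\<theta>. c_const CARD('n) m s / 2 *
          (LINT r:{0<..}|lborel. finite_diff m U x (r *\<^sub>R \<theta>) * r powr (- 1 - 2 * s))) \<in> borel_measurable borel"
      unfolding set_lebesgue_integral_def
      by (intro borel_measurable_times borel_measurable_const lborel.borel_measurable_lebesgue_integral)
         (simp add: case_prod_unfold)
    have "(\<lambda>\<theta>. ray_coeff a x k \<theta> p) \<in> borel_measurable borel" for p
      unfolding ray_coeff_def by (cases "p = 0"; cases "p = 1") simp_all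
    moreover have "(\<lambda>\<theta>. core_poly p c (b \<theta>) s) \<in> borel_measurable borel" for p
      unfolding core_poly_def b_def by (cases "p = 0"; cases "p = 1") simp_all
    ultimately show "(\<lambda>\<theta>. - (k_const CARD('n) s * Gamma (1 + s)) *
      (\<Sum>p\<le>2. ray_coeff a x k \<theta> p * core_poly p c (b \<theta>) s)) \<in> borel_measurable borel"
      by (intro borel_measurable_times borel_measurable_const borel_measurable_sum)
    fix \<theta> assume \<theta>: "norm_a a \<theta> = 1"
    have int: "set_integrable lborel {0<..} (\<lambda>r. ray_coeff a x k \<theta> p *
        (central_diff m (real_bump p c (b \<theta>) s) r * r powr (- 1 - 2 * s)))" if "p \<in> {..2}" for p
      using that by (intro set_integrable_mult_right real_integrand_integrable c b_bound \<theta> s m) auto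
    have "(LINT r:{0<..}|lborel. finite_diff m U x (r *\<^sub>R \<theta>) * r powr (- 1 - 2 * s))
        = (\<Sum>p\<le>2. LINT r:{0<..}|lborel. ray_coeff a x k \<theta> p *
            (central_diff m (real_bump p c (b \<theta>) s) r * r powr (- 1 - 2 * s)))"
      unfolding ray[OF \<theta>] by (rule set_integral_sum(2)) (rule int)
    also have "\<dots> = (\<Sum>p\<le>2. ray_coeff a x k \<theta> p * real_fractional_integral m p c (b \<theta>) s)"
      unfolding real_fractional_integral_def set_integral_mult_right ..
    finally have "(LINT r:{0<..}|lborel. finite_diff m U x (r *\<^sub>R \<theta>) * r powr (- 1 - 2 * s))
        = (\<Sum>p\<le>2. ray_coeff a x k \<theta> p * real_fractional_integral m p c (b \<theta>) s)" .
    then have "c_const CARD('n) m s / 2 *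
          (LINT r:{0<..}|lborel. finite_diff m U x (r *\<^sub>R \<theta>) * r powr (- 1 - 2 * s))
        = (\<Sum>p\<le>2. ray_coeff a x k \<theta> p * (c_const CARD('n) m s / 2 * real_fractional_integral m p c (b \<theta>) s))"
      by (simp add: sum_distrib_left mult_ac)
    also have "\<dots> = (\<Sum>p\<le>2. ray_coeff a x k \<theta> p * (- (k_const CARD('n) s * Gamma (1 + s)) * core_poly p c (b \<theta>) s))"
      by (intro sum.cong refl arg_cong2[where f = "(*)"] normalized_fractional_integral c b_bound \<theta> s m) auto
    finally show "c_const CARD('n) m s / 2 *
          (LINT r:{0<..}|lborel. finite_diff m U x (r *\<^sub>R \<theta>) * r powr (- 1 - 2 * s))
        = - (k_const CARD('n) s * Gamma (1 + s)) * (\<Sum>p\<le>2. ray_coeff a x k \<theta> p * core_poly p c (b \<theta>) s)"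
      by (simp add: sum_distrib_left mult_ac)
  qed
  also have "\<dots> = - (k_const CARD('n) s * Gamma (1 + s)) *
      (LINT \<theta>|mu a s. (\<Sum>p\<le>2. ray_coeff a x k \<theta> p * core_poly p c (b \<theta>) s))"
    by (rule integral_mult_right_zero)
  finally show ?thesis by (simp only: U_def c_def b_def)
qed

section \<open>Moments of the measure\<close>

lemma nth_bound: "norm_a a \<theta> = 1 \<Longrightarrow> \<bar>\<theta> $ i\<bar> \<le> 1 / sqrt (a $ i)"
  using sqrt_a_nth_le_norm_a[OF a, of i \<theta>] a[of i] by (simp add: field_simps)

lemma integrable_mu_monomials:
  "integrable (mu a s) (\<lambda>\<theta>. \<theta> $ i * \<theta> $ l)"
  "integrable (mu a s) (\<lambda>\<theta>. (\<theta> $ i * \<theta> $ l) * (\<theta> $ p * \<theta> $ q))"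
proof -
  have two: "\<bar>\<theta> $ i * \<theta> $ l\<bar> \<le> 1 / sqrt (a $ i) * (1 / sqrt (a $ l))" if "norm_a a \<theta> = 1" for \<theta> i l
    unfolding abs_mult using nth_bound[OF that] a by (intro mult_mono) (auto intro: less_imp_le)
  show "integrable (mu a s) (\<lambda>\<theta>. \<theta> $ i * \<theta> $ l)"
    by (rule integrable_mu_bounded[OF a s _ two]) measurable
  have "\<bar>(\<theta> $ i * \<theta> $ l) * (\<theta> $ p * \<theta> $ q)\<bar>
      \<le> (1 / sqrt (a $ i) * (1 / sqrt (a $ l))) * (1 / sqrt (a $ p) * (1 / sqrt (a $ q)))"
    if "norm_a a \<theta> = 1" for \<theta>
    unfolding abs_mult[of "\<theta> $ i * \<theta> $ l"] using two[OF that] a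
    by (intro mult_mono two that) (auto intro: less_imp_le)
  then show "integrable (mu a s) (\<lambda>\<theta>. (\<theta> $ i * \<theta> $ l) * (\<theta> $ p * \<theta> $ q))"
    by (rule integrable_mu_bounded[OF a s, rotated]) measurable
qed

text \<open>Both integrands change sign under the reflection of the coordinate \<open>i\<close>, even if \<open>i = k\<close> or
  \<open>l = k\<close>, because \<open>\<theta> $ k\<close> enters the additional factor twice.\<close>

lemma mixed_moments_vanish:
  assumes "i \<noteq> l"
  shows "(LINT \<theta>|mu a s. \<theta> $ i * \<theta> $ l) = 0"
    and "(LINT \<theta>|mu a s. (\<theta> $ k * \<theta> $ k) * (\<theta> $ i * \<theta> $ l)) = 0"
  using assms by (intro integral_mu_odd[OF a s, of _ i]; simp add: reflect_def)+

lemma first_moment: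
  "(LINT \<theta>|mu a s. inner_a a x \<theta> * \<theta> $ k) = a $ k * x $ k * (LINT \<theta>|mu a s. \<theta> $ k * \<theta> $ k)"
proof -
  have "(LINT \<theta>|mu a s. inner_a a x \<theta> * \<theta> $ k)
      = (LINT \<theta>|mu a s. (\<Sum>i\<in>UNIV. (a $ i * x $ i) * (\<theta> $ i * \<theta> $ k)))"
    by (simp add: inner_a_def sum_distrib_right mult.assoc)
  also have "\<dots> = (\<Sum>i\<in>UNIV. (a $ i * x $ i) * (LINT \<theta>|mu a s. \<theta> $ i * \<theta> $ k))"
    using integrable_mu_monomials(1) by (subst Bochner_Integration.integral_sum) auto
  also have "\<dots> = a $ k * x $ k * (LINT \<theta>|mu a s. \<theta> $ k * \<theta> $ k)"
    by (subst sum.remove[of UNIV k]) (auto simp: mixed_moments_vanish(1))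
  finally show ?thesis .
qed

lemma second_moment:
  "(LINT \<theta>|mu a s. (inner_a a x \<theta>)\<^sup>2 * (\<theta> $ k * \<theta> $ k))
    = (\<Sum>i\<in>UNIV. (a $ i)\<^sup>2 * (x $ i)\<^sup>2 * (LINT \<theta>|mu a s. (\<theta> $ k * \<theta> $ k) * (\<theta> $ i * \<theta> $ i)))"
proof -
  have eq: "(inner_a a x \<theta>)\<^sup>2 * (\<theta> $ k * \<theta> $ k)
    = (\<Sum>i\<in>UNIV. \<Sum>l\<in>UNIV. (a $ i * x $ i * (a $ l * x $ l)) * ((\<theta> $ k * \<theta> $ k) * (\<theta> $ i * \<theta> $ l)))" for \<theta>
  proof -
    have "(inner_a a x \<theta>)\<^sup>2 = (\<Sum>i\<in>UNIV. \<Sum>l\<in>UNIV. (a $ i * x $ i * \<theta> $ i) * (a $ l * x $ l * \<theta> $ l))"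
      unfolding inner_a_def power2_eq_square sum_product ..
    then show ?thesis by (simp add: sum_distrib_left mult_ac)
  qed
  have "(LINT \<theta>|mu a s. (inner_a a x \<theta>)\<^sup>2 * (\<theta> $ k * \<theta> $ k))
    = (\<Sum>i\<in>UNIV. \<Sum>l\<in>UNIV. (a $ i * x $ i * (a $ l * x $ l)) *
        (LINT \<theta>|mu a s. (\<theta> $ k * \<theta> $ k) * (\<theta> $ i * \<theta> $ l)))"
    unfolding eq using integrable_mu_monomials(2)
    by (simp add: Bochner_Integration.integral_sum)
  also have "\<dots> = (\<Sum>i\<in>UNIV. (a $ i)\<^sup>2 * (x $ i)\<^sup>2 * (LINT \<theta>|mu a s. (\<theta> $ k * \<theta> $ k) * (\<theta> $ i * \<theta> $ i)))"
  proof (intro sum.cong refl)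
    fix i
    show "(\<Sum>l\<in>UNIV. (a $ i * x $ i * (a $ l * x $ l)) * (LINT \<theta>|mu a s. (\<theta> $ k * \<theta> $ k) * (\<theta> $ i * \<theta> $ l)))
      = (a $ i)\<^sup>2 * (x $ i)\<^sup>2 * (LINT \<theta>|mu a s. (\<theta> $ k * \<theta> $ k) * (\<theta> $ i * \<theta> $ i))"
      by (subst sum.remove[of UNIV i]) (auto simp: mixed_moments_vanish(2) power2_eq_square)
  qed
  finally show ?thesis .
qed

lemma integrable_mu_inner_a:
  "integrable (mu a s) (\<lambda>\<theta>. inner_a a x \<theta> * \<theta> $ k)"
  "integrable (mu a s) (\<lambda>\<theta>. (inner_a a x \<theta>)\<^sup>2 * (\<theta> $ k * \<theta> $ k))"
proof -
  have le: "\<bar>inner_a a x \<theta> * \<theta> $ k\<bar> \<le> 1 * (1 / sqrt (a $ k))" if "norm_a a \<theta> = 1" for \<theta>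
    unfolding abs_mult using inner_a_bound[OF that] nth_bound[OF that, of k] by (intro mult_mono) auto
  show "integrable (mu a s) (\<lambda>\<theta>. inner_a a x \<theta> * \<theta> $ k)"
    by (rule integrable_mu_bounded[OF a s _ le]) measurable
  have "\<bar>(inner_a a x \<theta>)\<^sup>2 * (\<theta> $ k * \<theta> $ k)\<bar> \<le> (1 * (1 / sqrt (a $ k)))\<^sup>2" if "norm_a a \<theta> = 1" for \<theta>
  proof -
    have "\<bar>(inner_a a x \<theta>)\<^sup>2 * (\<theta> $ k * \<theta> $ k)\<bar> = \<bar>inner_a a x \<theta> * \<theta> $ k\<bar>\<^sup>2"
      by (simp add: power2_eq_square abs_mult mult_ac)
    also have "\<dots> \<le> (1 * (1 / sqrt (a $ k)))\<^sup>2"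
      using le[OF that] by (intro power_mono) auto
    finally show ?thesis .
  qed
  then show "integrable (mu a s) (\<lambda>\<theta>. (inner_a a x \<theta>)\<^sup>2 * (\<theta> $ k * \<theta> $ k))"
    by (rule integrable_mu_bounded[OF a s, rotated]) measurable
qed

lemma integral_core_poly:
  fixes \<alpha> c :: real
  defines "\<alpha> \<equiv> 1 - sqrt (a $ k) * x $ k" and "c \<equiv> 1 - (norm_a a x)\<^sup>2"
  shows "(LINT \<theta>|mu a s. (\<Sum>p\<le>2. ray_coeff a x k \<theta> p * core_poly p c (inner_a a x \<theta>) s))
    = - \<alpha>\<^sup>2 * (LINT \<theta>|mu a s. 1)
      + 4 * s * \<alpha> * sqrt (a $ k) * (LINT \<theta>|mu a s. inner_a a x \<theta> * \<theta> $ k)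
      + s * c * a $ k * (LINT \<theta>|mu a s. \<theta> $ k * \<theta> $ k)
      + 2 * s * (1 - s) * a $ k * (LINT \<theta>|mu a s. (inner_a a x \<theta>)\<^sup>2 * (\<theta> $ k * \<theta> $ k))"
proof -
  interpret finite_measure "mu a s" by (rule finite_measure_mu[OF a s])
  have "(sqrt (a $ k))\<^sup>2 = a $ k" using a[of k] by simp
  then have "(\<Sum>p\<le>2. ray_coeff a x k \<theta> p * core_poly p c (inner_a a x \<theta>) s)
    = - \<alpha>\<^sup>2 * 1 + 4 * s * \<alpha> * sqrt (a $ k) * (inner_a a x \<theta> * \<theta> $ k)
      + s * c * a $ k * (\<theta> $ k * \<theta> $ k)
      + 2 * s * (1 - s) * a $ k * ((inner_a a x \<theta>)\<^sup>2 * (\<theta> $ k * \<theta> $ k))" for \<theta>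
  proof -
    have "{..2::nat} = {0, 1, 2}" by auto
    then have "(\<Sum>p\<le>2. ray_coeff a x k \<theta> p * core_poly p c (inner_a a x \<theta>) s)
      = - \<alpha>\<^sup>2 + (- 2 * \<alpha> * (sqrt (a $ k) * \<theta> $ k)) * (- 2 * inner_a a x \<theta> * s)
        + (sqrt (a $ k) * \<theta> $ k)\<^sup>2 * (s * (c + 2 * (inner_a a x \<theta>)\<^sup>2 * (1 - s)))"
      by (simp add: ray_coeff_def core_poly_def \<alpha>_def)
    also have "(sqrt (a $ k) * \<theta> $ k)\<^sup>2 = a $ k * (\<theta> $ k * \<theta> $ k)"
      using \<open>(sqrt (a $ k))\<^sup>2 = a $ k\<close> by (simp add: power_mult_distrib power2_eq_square)
    finally show ?thesis by (simp add: algebra_simps)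
  qed
  then show ?thesis
    using integrable_mu_inner_a integrable_mu_monomials(1)[of k k]
    by (simp del: mult_minus_left)
qed

end

theorem lemma3p7:
  fixes a x :: "real ^ 'n" and s :: real and k :: 'n and m :: nat
    and U :: "real ^ 'n \<Rightarrow> real"
  assumes a_pos: "\<And>i. a $ i > 0"
    and s_pos: "s > 0"
    and m_gt: "real m > s"
    and U_def: "U = (\<lambda>z. (1 - sqrt (a $ k) * z $ k)\<^sup>2 * u_s a s z)"
    and x_in: "x \<in> ellipsoid a"
  shows "frac_laplacian m s U x / (k_const CARD('n) s * Gamma (1 + s)) =
      (J0 a s + 5 * s * J a s k 1 + 2 * s * (s - 1) * J a s k 2) * a $ k * (x $ k)\<^sup>2
      - 2 * (J0 a s + 2 * s * J a s k 1) * sqrt (a $ k) * x $ k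
      + J0 a s - s * J a s k 1
      + s * (\<Sum>i\<in>UNIV - {k}.
          (J a s k 1
            + 2 * (s - 1) * a $ i * a $ k
              * (LINT \<theta>:frontier (ellipsoid a)|mu a s. (\<theta> $ i)\<^sup>2 * (\<theta> $ k)\<^sup>2))
          * a $ i * (x $ i)\<^sup>2)"
proof -
  note a = a_pos and s = s_pos and m = m_gt and x = x_in
  define w where "w = sqrt (a $ k)"
  define t where "t = x $ k"
  define T where "T i = (LINT \<theta>|mu a s. (\<theta> $ k * \<theta> $ k) * (\<theta> $ i * \<theta> $ i))" for i
  define M0 where "M0 = (LINT \<theta>|mu a s. 1 :: real)"
  define M2 where "M2 = (LINT \<theta>|mu a s. \<theta> $ k * \<theta> $ k)"
  define X where "X = (\<Sum>i\<in>UNIV - {k}. a $ i * (x $ i)\<^sup>2)"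
  define Y where "Y = (\<Sum>i\<in>UNIV - {k}. (a $ i)\<^sup>2 * (x $ i)\<^sup>2 * T i)"
  have w2: "w\<^sup>2 = a $ k" using a[of k] by (simp add: w_def)
  have J0: "J0 a s = M0"
    unfolding J0_def M0_def by (rule set_integral_frontier_mu[OF a s]) simp
  have J1: "J a s k 1 = w\<^sup>2 * M2"
    unfolding J_def w2 M2_def by (subst set_integral_frontier_mu[OF a s]) (simp_all add: power2_eq_square)
  have J2: "J a s k 2 = w ^ 4 * T k"
  proof -
    have "(\<theta> $ k) ^ (2 * 2) = (\<theta> $ k * \<theta> $ k) * (\<theta> $ k * \<theta> $ k)" for \<theta> :: "real ^ 'n"
      by (simp add: power4_eq_xxxx mult.assoc)
    moreover have "w ^ 4 = (a $ k)\<^sup>2" unfolding w2 [symmetric] by simp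
    ultimately show ?thesis
      unfolding J_def T_def by (subst set_integral_frontier_mu[OF a s]) simp_all
  qed
  have mixed: "(LINT \<theta>:frontier (ellipsoid a)|mu a s. (\<theta> $ i)\<^sup>2 * (\<theta> $ k)\<^sup>2) = T i" for i
    unfolding T_def by (subst set_integral_frontier_mu[OF a s]) (simp_all add: power2_eq_square mult_ac)
  have norm_x: "(norm_a a x)\<^sup>2 = w\<^sup>2 * t\<^sup>2 + X"
    unfolding norm_a_square[OF a] X_def w2 t_def by (rule sum.remove) auto
  have M1: "(LINT \<theta>|mu a s. inner_a a x \<theta> * \<theta> $ k) = w\<^sup>2 * t * M2"
    using first_moment[OF a s m x] by (simp add: w2 t_def M2_def)
  have M3: "(LINT \<theta>|mu a s. (inner_a a x \<theta>)\<^sup>2 * (\<theta> $ k * \<theta> $ k)) = w ^ 4 * t\<^sup>2 * T k + Y"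
  proof -
    have "(LINT \<theta>|mu a s. (inner_a a x \<theta>)\<^sup>2 * (\<theta> $ k * \<theta> $ k)) = (\<Sum>i\<in>UNIV. (a $ i)\<^sup>2 * (x $ i)\<^sup>2 * T i)"
      using second_moment[OF a s m x, of k] by (simp add: T_def)
    also have "\<dots> = (a $ k)\<^sup>2 * (x $ k)\<^sup>2 * T k + Y"
      unfolding Y_def by (rule sum.remove) auto
    finally show ?thesis unfolding w2 [symmetric] t_def by simp
  qed
  have "k_const CARD('n) s > 0" "Gamma (1 + s) > 0"
    using s by (auto simp: k_const_def intro!: divide_pos_pos mult_pos_pos Gamma_real_pos)
  then have pos: "k_const CARD('n) s * Gamma (1 + s) \<noteq> 0" by simp
  define L where "L = (LINT \<theta>|mu a s. (\<Sum>p\<le>2. ray_coeff a x k \<theta> p *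
      core_poly p (1 - (norm_a a x)\<^sup>2) (inner_a a x \<theta>) s))"
  have L: "L = - (1 - w * t)\<^sup>2 * M0 + 4 * s * (1 - w * t) * w * (w\<^sup>2 * t * M2)
      + s * (1 - (w\<^sup>2 * t\<^sup>2 + X)) * w\<^sup>2 * M2 + 2 * s * (1 - s) * w\<^sup>2 * (w ^ 4 * t\<^sup>2 * T k + Y)"
    using integral_core_poly[OF a s m x, of k, folded L_def M0_def M2_def w_def t_def]
    unfolding M1 M3 norm_x w2 .
  have "frac_laplacian m s U x = - (k_const CARD('n) s * Gamma (1 + s)) * L"
    unfolding U_def L_def by (rule frac_laplacian_mu_integral[OF a s m x])
  then have "frac_laplacian m s U x / (k_const CARD('n) s * Gamma (1 + s)) = - L"
    using pos by simp
  also have "- L = (M0 + 5 * s * (w\<^sup>2 * M2) + 2 * s * (s - 1) * (w ^ 4 * T k)) * w\<^sup>2 * t\<^sup>2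
      - 2 * (M0 + 2 * s * (w\<^sup>2 * M2)) * w * t + M0 - s * (w\<^sup>2 * M2)
      + s * (w\<^sup>2 * M2 * X + 2 * (s - 1) * w\<^sup>2 * Y)"
    unfolding L by (simp add: algebra_simps power2_eq_square power4_eq_xxxx)
  also have "w\<^sup>2 * M2 * X + 2 * (s - 1) * w\<^sup>2 * Y
      = (\<Sum>i\<in>UNIV - {k}. (w\<^sup>2 * M2 + 2 * (s - 1) * a $ i * w\<^sup>2 * T i) * a $ i * (x $ i)\<^sup>2)"
    unfolding X_def Y_def sum_distrib_left sum.distrib [symmetric]
    by (intro sum.cong refl) (simp add: algebra_simps power2_eq_square)
  finally show ?thesis
    unfolding J0 J1 J2 mixed w2 by (simp only: w_def t_def)
qed

end
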